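(* Let $p\in[1,\infty)$, $I=[0,1]$, $0=x_0<x_1<\dots<x_N=1$, $u_i(x)=a_ix+b_i$ ($i\in\mathbb{N}_N$) affine with $u_i(0)=x_{i-1}$, $u_i(1)=x_i$, and $\alpha_i\in L^\infty(I)$ with $\Lambda:=\left(\sum_{i=1}^Na_i\|\alpha_i\|_\infty^p\right)^{1/p}<1$. Let $\{\lambda_i\}_{i\ge0}$ be distinct real numbers with $\lambda_i>-\frac1p$ for all $i$ and \[ \sum_{i=0}^\infty\frac{\lambda_i+\frac1p}{(\lambda_i+\frac1p)^2+1}=\infty. \] Then $S=\bigcup_{n=1}^\infty\bigcup_{m=1}^\infty\operatorname{span}\{(x^{\lambda_0})^\alpha_n,\dots,(x^{\lambda_m})^\alpha_n\}$ is dense in $L^p(I)$.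
   Context: The integral MKZ operator is $\widehat M_nh(x)=\int_0^1H_n(x,s)h(s)\,ds$, $H_n(x,s)=\sum_{k\ge0}\widehat m_{nk}(x)\chi_{I_k}(s)$, $\widehat m_{nk}(x)=(n+1)\binom{k+n+1}{k}x^k(1-x)^n$, $I_k=\left[\frac{k}{k+n},\frac{k+1}{k+n+1}\right]$. For $h\in L^p(I)$, $h^\alpha_n$ is the unique $G\in L^p(I)$ with $G=h+\sum_{i=1}^N(\alpha_i\circ u_i^{-1})((G-\widehat M_nh)\circ u_i^{-1})\chi_{u_i(I)}$; $(x^\lambda)^\alpha_n$ denotes this for $h(x)=x^\lambda$. *)

theory Defs
  imports "HOL-Analysis.Analysis" "HOL-Probability.Essential_Supremum"
begin

abbreviation I01 :: "real measure" where "I01 \<equiv> lebesgue_on {0..1}"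

definition in_Lp :: "real \<Rightarrow> (real \<Rightarrow> real) \<Rightarrow> bool" where
  "in_Lp p f \<longleftrightarrow> f \<in> borel_measurable I01 \<and> integrable I01 (\<lambda>x. \<bar>f x\<bar> powr p)"

definition Lp_norm :: "real \<Rightarrow> (real \<Rightarrow> real) \<Rightarrow> real" where
  "Lp_norm p f = (integral\<^sup>L I01 (\<lambda>x. \<bar>f x\<bar> powr p)) powr (1 / p)"

definition in_Linf :: "(real \<Rightarrow> real) \<Rightarrow> bool" where
  "in_Linf f \<longleftrightarrow> f \<in> borel_measurable I01 \<and> esssup I01 (\<lambda>x. ereal \<bar>f x\<bar>) < \<infinity>"

definition Linf_norm :: "(real \<Rightarrow> real) \<Rightarrow> real" where
  "Linf_norm f = real_of_ereal (esssup I01 (\<lambda>x. ereal \<bar>f x\<bar>))"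

definition mkz_basis :: "nat \<Rightarrow> nat \<Rightarrow> real \<Rightarrow> real" where
  "mkz_basis n k x = real (n + 1) * real ((k + n + 1) choose k) * x ^ k * (1 - x) ^ n"

definition mkz_interval :: "nat \<Rightarrow> nat \<Rightarrow> real set" where
  "mkz_interval n k = {real k / real (k + n) .. real (k + 1) / real (k + n + 1)}"

text \<open>\<open>\<integral>\<^sub>0\<^sup>1 H_n(x,s) h(s) ds = \<Sum>\<^sub>k m_nk(x) \<integral>\<^bsub>I_k\<^esub> h\<close>.\<close>
definition MKZ :: "nat \<Rightarrow> (real \<Rightarrow> real) \<Rightarrow> real \<Rightarrow> real" where
  "MKZ n h x = (\<Sum>k. mkz_basis n k x * (LINT s : mkz_interval n k | lborel. h s))"

text \<open>G satisfies the self-referential equation defining h^alpha_n (equality in L^p, i.e. a.e. on I).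
  Here u_i(t) = a_i t + b_i, so u_i^{-1}(x) = (x - b_i)/a_i and u_i(I) = [b_i, a_i + b_i].\<close>
definition is_alpha_fractal ::
  "real \<Rightarrow> nat \<Rightarrow> (nat \<Rightarrow> real) \<Rightarrow> (nat \<Rightarrow> real) \<Rightarrow> (nat \<Rightarrow> real \<Rightarrow> real)
     \<Rightarrow> nat \<Rightarrow> (real \<Rightarrow> real) \<Rightarrow> (real \<Rightarrow> real) \<Rightarrow> bool" where
  "is_alpha_fractal p N a b \<alpha> n h G \<longleftrightarrow> in_Lp p G \<and>
     (AE x in I01. G x = h x + (\<Sum>i=1..N.
        \<alpha> i ((x - b i) / a i) * (G ((x - b i) / a i) - MKZ n h ((x - b i) / a i))
        * indicator ((\<lambda>t. a i * t + b i) ` {0..1}) x))"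

text \<open>h^alpha_n: the (a.e. unique) solution in L^p(I).\<close>
definition alpha_fractal ::
  "real \<Rightarrow> nat \<Rightarrow> (nat \<Rightarrow> real) \<Rightarrow> (nat \<Rightarrow> real) \<Rightarrow> (nat \<Rightarrow> real \<Rightarrow> real)
     \<Rightarrow> nat \<Rightarrow> (real \<Rightarrow> real) \<Rightarrow> real \<Rightarrow> real" where
  "alpha_fractal p N a b \<alpha> n h = (SOME G. is_alpha_fractal p N a b \<alpha> n h G)"

end

(* With x = exp (-t) and mu = lam + 1/p, the power x^lam becomes x^(-1/p) exp (-mu t), and L^p(0,1)
becomes L^p(0,oo). Both halves of the Muntz theorem come from explicit combinations
exp (-nu t) - sum c_mu exp (-mu t) with small pointwise bounds, so no duality is needed.

Exponents mu > 1: adding a node replaces Q by (mu - nu) exp (-mu t) int_0^t Q(s) exp (mu s) ds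
(von Golitschek), which multiplies a bound K exp (-c t) by (mu - nu) / (mu - c).

Exponents mu <= 1: the combination is the residue sum of exp (-z t) z^4 / B(z) / (z - nu) over the
circle with diameter [0, 2R], where B is the Blaschke product of that disc with zeros mu. On the
circle |B| = 1 and the factor z^4 gives decay (1 + t)^(-2); dividing by the residue at nu gains |B(nu)|.

The operator M_n averages over a negative binomial law of variance O(n) and its kernel has both
marginals 1, so M_n is an L^p contraction converging to the identity. The map
L e = sum (alpha_i e) o u_i^(-1) has norm at most Lambda < 1; hence h^alpha_n exists by a Neumann
series and |h^alpha_n - h| <= Lambda / (1 - Lambda) |h - M_n h|, which tends to 0 for each of the
finitely many powers needed. *)
theory Submission
  imports Defs "HOL-Complex_Analysis.Complex_Analysis"
begin

section \<open>The Lp seminorm\<close>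

text \<open>In the variable t the measure is infinite, so a uniform bound on an exponential sum says
  nothing: the error has to decay in t. The rate (1 + t)^(-2) is integrable to every power p >= 1
  and is the form in which both constructions deliver their bounds. For small exponents the contour
  has to surround points mu arbitrarily close to 0 while exp (-z t) stays bounded. It therefore
  touches the imaginary axis at 0, where exp (-z t) does not decay. There |z|^2 = 2 R Re z, so z^4
  supplies the factor (Re z)^2 that pays for this. The radius R = 1 + nu puts (0, 1] and nu inside
  the disc and keeps nu at distance nu from the circle. Since x / (x^2 + 1) is at most x and at most
  1/x, the hypothesis makes either the sum of the mu <= 1 or the sum of 1/mu over the mu > 1
  diverge. In the second case only targets nu < 1, below all nodes used, are reached directly. Among
  them are the numbers 1 / (j + 2), whose sum diverges, so the construction for small exponents
  applied to these yields every other power.\<close>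

lemma powr_weighted_convex:
  fixes u v A B p :: real
  assumes p: "1 \<le> p" and u: "0 \<le> u" and v: "0 \<le> v" and A: "0 < A" and B: "0 < B"
  shows "(u + v) powr p \<le> (A + B) powr (p - 1) * (A powr (1 - p) * u powr p + B powr (1 - p) * v powr p)"
proof -
  have conv: "convex_on {0..} (\<lambda>x::real. x powr p)"
  proof (rule convex_onI)
    fix t x y :: real assume t: "0 < t" "t < 1" and xy: "x \<in> {0..}" "y \<in> {0..}"
    \<comment> \<open>With one endpoint equal to 0 the convexity claim reduces to this inequality
      for the weight \<open>s\<close> of the other endpoint.\<close>
    have s: "s powr p \<le> s" if "0 < s" "s < 1" for s :: real
      using powr_mono'[of 1 p s] p that by simp
    consider "x > 0" "y > 0" | "x = 0" | "y = 0" using xy by force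
    then show "((1 - t) *\<^sub>R x + t *\<^sub>R y) powr p \<le> (1 - t) * x powr p + t * y powr p"
    proof cases
      case 1
      then show ?thesis using convex_onD[OF powr_convex[OF p], of t x y] t by simp
    next
      case 2
      then show ?thesis using s[OF t] t xy by (simp add: powr_mult mult_right_mono)
    next
      case 3
      have "(1 - t) powr p \<le> 1 - t" using s[of "1 - t"] t by simp
      then show ?thesis using 3 t xy by (simp add: powr_mult mult_right_mono)
    qed
  qed simp
  \<comment> \<open>\<open>u + v\<close> is \<open>A + B\<close> times the average of
    \<open>u / A\<close> and \<open>v / B\<close> with weights proportional to \<open>A\<close> and
    \<open>B\<close>; the resulting bound is sharp when \<open>u\<close> and \<open>v\<close> are in
    the ratio of \<open>A\<close> to \<open>B\<close>.\<close>
  define t where "t = B / (A + B)"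
  have t: "0 \<le> t" "t \<le> 1" "1 - t = A / (A + B)" using A B by (auto simp: t_def field_simps)
  have "((1 - t) *\<^sub>R (u / A) + t *\<^sub>R (v / B)) powr p \<le> (1 - t) * (u / A) powr p + t * (v / B) powr p"
    using convex_onD[OF conv t(1,2), of "u / A" "v / B"] u v A B by simp
  also have "(1 - t) *\<^sub>R (u / A) + t *\<^sub>R (v / B) = (u + v) / (A + B)"
    unfolding t(3) using A B by (simp add: t_def add_divide_distrib)
  finally have "(A + B) powr p * ((u + v) / (A + B)) powr p
      \<le> (A + B) powr p * ((1 - t) * (u / A) powr p + t * (v / B) powr p)"
    by (rule mult_left_mono) simp
  also have "(A + B) powr p * ((u + v) / (A + B)) powr p = (u + v) powr p"
    using A B u v by (simp add: powr_divide)
  also have "(A + B) powr p * ((1 - t) * (u / A) powr p + t * (v / B) powr p)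
     = ((A + B) powr p / (A + B)) * (A / A powr p * u powr p + B / B powr p * v powr p)"
    unfolding t(3) using A B u v by (simp add: t_def powr_divide distrib_left)
  finally show ?thesis
    using A B by (simp add: powr_diff)
qed

lemma Lp_norm_nonneg: "0 \<le> Lp_norm p f"
  by (simp add: Lp_norm_def)

lemma Lp_norm_powr:
  assumes "1 \<le> p" shows "Lp_norm p f powr p = (\<integral>x. \<bar>f x\<bar> powr p \<partial>I01)"
  using assms by (simp add: Lp_norm_def powr_powr)

lemma in_Lp_nn_integral:
  assumes "1 \<le> p" "in_Lp p f"
  shows "(\<integral>\<^sup>+x. ennreal (\<bar>f x\<bar> powr p) \<partial>I01) = ennreal (Lp_norm p f powr p)"
  using assms by (simp add: Lp_norm_powr nn_integral_eq_integral in_Lp_def)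

lemma in_Lp_measurable: "in_Lp p f \<Longrightarrow> f \<in> borel_measurable I01"
  by (simp add: in_Lp_def)

text \<open>One bound on the extended integral gives membership and norm estimate together, so later
  estimates can be made in \<open>ennreal\<close> without a prior proof of integrability.\<close>

lemma
  assumes p: "1 \<le> p" and f: "f \<in> borel_measurable I01" and B: "0 \<le> B"
    and le: "(\<integral>\<^sup>+x. ennreal (\<bar>f x\<bar> powr p) \<partial>I01) \<le> ennreal (B powr p)"
  shows in_LpI: "in_Lp p f" and Lp_norm_le: "Lp_norm p f \<le> B"
proof -
  show L: "in_Lp p f"
    using f le unfolding in_Lp_def
    by (auto intro!: integrableI_bounded intro: le_less_trans)
  have "Lp_norm p f powr p \<le> B powr p"
    using in_Lp_nn_integral[OF p L] le by simp
  then show "Lp_norm p f \<le> B"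
    using p B Lp_norm_nonneg[of p f] by (metis linorder_not_le powr_less_mono2 zero_less_one order_less_le_trans)
qed

lemma
  assumes p: "1 \<le> p" and f: "f \<in> borel_measurable I01" and g: "in_Lp p g"
    and le: "AE x in I01. \<bar>f x\<bar> \<le> \<bar>g x\<bar>"
  shows in_Lp_mono: "in_Lp p f" and Lp_norm_mono: "Lp_norm p f \<le> Lp_norm p g"
proof -
  have "(\<integral>\<^sup>+x. ennreal (\<bar>f x\<bar> powr p) \<partial>I01) \<le> (\<integral>\<^sup>+x. ennreal (\<bar>g x\<bar> powr p) \<partial>I01)"
    using le p by (intro nn_integral_mono_AE) (auto elim!: eventually_mono intro!: powr_mono2)
  then have *: "(\<integral>\<^sup>+x. ennreal (\<bar>f x\<bar> powr p) \<partial>I01) \<le> ennreal (Lp_norm p g powr p)"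
    using in_Lp_nn_integral[OF p g] by simp
  show "in_Lp p f" "Lp_norm p f \<le> Lp_norm p g"
    using in_LpI[OF p f Lp_norm_nonneg *] Lp_norm_le[OF p f Lp_norm_nonneg *] by auto
qed

text \<open>Minkowski by convexity: \<open>powr_weighted_convex\<close> is integrated with
  \<open>A\<close> and \<open>B\<close> strictly above the two norms, which keeps them positive even
  for null functions. The constants collapse to \<open>(A + B) powr p\<close>, and then
  \<open>A\<close> and \<open>B\<close> descend to the norms.\<close>

lemma
  assumes p: "1 \<le> p" and f: "in_Lp p f" and g: "in_Lp p g"
  shows in_Lp_add: "in_Lp p (\<lambda>x. f x + g x)"
    and Lp_norm_triangle: "Lp_norm p (\<lambda>x. f x + g x) \<le> Lp_norm p f + Lp_norm p g"
proof -
  note [measurable] = in_Lp_measurable[OF f] in_Lp_measurable[OF g]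
  have key: "in_Lp p (\<lambda>x. f x + g x) \<and> Lp_norm p (\<lambda>x. f x + g x) \<le> A + B"
    if A: "Lp_norm p f < A" and B: "Lp_norm p g < B" for A B
  proof -
    have pos: "0 < A" "0 < B" using A B Lp_norm_nonneg[of p f] Lp_norm_nonneg[of p g] by linarith+
    define ca where "ca = (A + B) powr (p - 1) * A powr (1 - p)"
    define cb where "cb = (A + B) powr (p - 1) * B powr (1 - p)"
    have nn: "0 \<le> ca" "0 \<le> cb" by (auto simp: ca_def cb_def)
    have "(\<integral>\<^sup>+x. ennreal (\<bar>f x + g x\<bar> powr p) \<partial>I01)
        \<le> (\<integral>\<^sup>+x. ennreal ca * ennreal (\<bar>f x\<bar> powr p) + ennreal cb * ennreal (\<bar>g x\<bar> powr p) \<partial>I01)"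
    proof (rule nn_integral_mono)
      fix x
      have "\<bar>f x + g x\<bar> powr p \<le> (\<bar>f x\<bar> + \<bar>g x\<bar>) powr p" using p by (intro powr_mono2) auto
      also have "\<dots> \<le> ca * \<bar>f x\<bar> powr p + cb * \<bar>g x\<bar> powr p"
        using powr_weighted_convex[OF p abs_ge_zero abs_ge_zero pos, of "f x" "g x"]
        by (simp add: ca_def cb_def algebra_simps)
      finally show "ennreal (\<bar>f x + g x\<bar> powr p) \<le> ennreal ca * ennreal (\<bar>f x\<bar> powr p) + ennreal cb * ennreal (\<bar>g x\<bar> powr p)"
        using nn by (simp flip: ennreal_mult ennreal_plus)
    qed
    also have "\<dots> = ennreal (ca * Lp_norm p f powr p + cb * Lp_norm p g powr p)"
      using nn by (simp add: nn_integral_add nn_integral_cmult in_Lp_nn_integral[OF p f] in_Lp_nn_integral[OF p g] ennreal_mult)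
    also have "\<dots> \<le> ennreal ((A + B) powr p)"
    proof (rule ennreal_leI)
      have "ca * Lp_norm p f powr p + cb * Lp_norm p g powr p \<le> ca * A powr p + cb * B powr p"
        using A B p nn Lp_norm_nonneg[of p f] Lp_norm_nonneg[of p g]
        by (intro add_mono mult_left_mono powr_mono2) auto
      also have "ca * A powr p + cb * B powr p = (A + B) powr (p - 1) * (A powr (1 - p) * A powr p + B powr (1 - p) * B powr p)"
        by (simp add: ca_def cb_def algebra_simps)
      also have "\<dots> = (A + B) powr (p - 1) * (A + B)"
        using pos by (simp flip: powr_add)
      also have "\<dots> = (A + B) powr p"
        using pos powr_add[of "A + B" "p - 1" 1] by simp
      finally show "ca * Lp_norm p f powr p + cb * Lp_norm p g powr p \<le> (A + B) powr p" .
    qed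
    finally have le: "(\<integral>\<^sup>+x. ennreal (\<bar>f x + g x\<bar> powr p) \<partial>I01) \<le> ennreal ((A + B) powr p)" .
    have "(\<lambda>x. f x + g x) \<in> borel_measurable I01" "0 \<le> A + B" using pos by auto
    from in_LpI[OF p this le] Lp_norm_le[OF p this le] show ?thesis by blast
  qed
  show "in_Lp p (\<lambda>x. f x + g x)"
    using key[of "Lp_norm p f + 1" "Lp_norm p g + 1"] by simp
  show "Lp_norm p (\<lambda>x. f x + g x) \<le> Lp_norm p f + Lp_norm p g"
  proof (rule field_le_epsilon)
    fix e :: real assume "0 < e"
    then show "Lp_norm p (\<lambda>x. f x + g x) \<le> Lp_norm p f + Lp_norm p g + e"
      using key[of "Lp_norm p f + e/2" "Lp_norm p g + e/2"] by simp
  qed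
qed

lemma in_Lp_cmult: 
  assumes "1 \<le> p" "in_Lp p f" shows "in_Lp p (\<lambda>x. c * f x)"
  using assms by (auto simp: in_Lp_def abs_mult powr_mult)

lemma Lp_norm_cmult:
  assumes "1 \<le> p" shows "Lp_norm p (\<lambda>x. c * f x) = \<bar>c\<bar> * Lp_norm p f"
  using assms by (simp add: Lp_norm_def abs_mult powr_mult powr_powr)

lemma in_Lp_diff:
  assumes p: "1 \<le> p" and f: "in_Lp p f" and g: "in_Lp p g"
  shows "in_Lp p (\<lambda>x. f x - g x)"
  using in_Lp_add[OF p f in_Lp_cmult[OF p g, of "-1"]] by simp

lemma Lp_norm_triangle_diff:
  assumes p: "1 \<le> p" and f: "in_Lp p f" and g: "in_Lp p g"
  shows "Lp_norm p (\<lambda>x. f x - g x) \<le> Lp_norm p f + Lp_norm p g"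
  using Lp_norm_triangle[OF p f in_Lp_cmult[OF p g, of "-1"]] Lp_norm_cmult[OF p, of "-1" g] by simp

lemma Lp_norm_diff_trans:
  assumes p: "1 \<le> p" and f: "in_Lp p f" and g: "in_Lp p g" and h: "in_Lp p h"
  shows "Lp_norm p (\<lambda>x. f x - h x) \<le> Lp_norm p (\<lambda>x. f x - g x) + Lp_norm p (\<lambda>x. g x - h x)"
  using Lp_norm_triangle[OF p in_Lp_diff[OF p f g] in_Lp_diff[OF p g h]] by simp

lemma Lp_norm_0: "1 \<le> p \<Longrightarrow> Lp_norm p (\<lambda>x. 0) = 0"
  by (simp add: Lp_norm_def)

lemma in_Lp_0: "in_Lp p (\<lambda>x. 0)"
  by (simp add: in_Lp_def)

lemma
  assumes p: "1 \<le> p" and f: "\<And>i. i \<in> A \<Longrightarrow> in_Lp p (f i)"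
  shows in_Lp_sum: "in_Lp p (\<lambda>x. \<Sum>i\<in>A. f i x)"
    and Lp_norm_sum: "Lp_norm p (\<lambda>x. \<Sum>i\<in>A. f i x) \<le> (\<Sum>i\<in>A. Lp_norm p (f i))"
proof -
  have "in_Lp p (\<lambda>x. \<Sum>i\<in>A. f i x) \<and> Lp_norm p (\<lambda>x. \<Sum>i\<in>A. f i x) \<le> (\<Sum>i\<in>A. Lp_norm p (f i))"
    using f
  proof (induction A rule: infinite_finite_induct)
    case (insert a A)
    then show ?case
      using in_Lp_add[OF p, of "f a" "\<lambda>x. \<Sum>i\<in>A. f i x"] Lp_norm_triangle[OF p, of "f a" "\<lambda>x. \<Sum>i\<in>A. f i x"] by fastforce
  qed (auto simp: in_Lp_0 Lp_norm_0[OF p])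
  then show "in_Lp p (\<lambda>x. \<Sum>i\<in>A. f i x)" "Lp_norm p (\<lambda>x. \<Sum>i\<in>A. f i x) \<le> (\<Sum>i\<in>A. Lp_norm p (f i))" by auto
qed

lemma in_Lp_const: "1 \<le> p \<Longrightarrow> in_Lp p (\<lambda>x. c)"
  by (simp add: in_Lp_def finite_measure.integrable_const finite_measure_lebesgue_on)

lemma
  assumes p: "1 \<le> p" and f: "f \<in> borel_measurable I01" and B: "0 \<le> B" 
    and le: "\<And>x. x \<in> {0..1} \<Longrightarrow> \<bar>f x\<bar> \<le> B"
  shows in_Lp_bounded: "in_Lp p f" and Lp_norm_bounded: "Lp_norm p f \<le> B"
proof -
  have AE: "AE x in I01. \<bar>f x\<bar> \<le> \<bar>(\<lambda>x. B) x\<bar>" using le B by (intro AE_I2) auto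
  show "in_Lp p f" by (rule in_Lp_mono[OF p f in_Lp_const[OF p] AE])
  have "Lp_norm p f \<le> Lp_norm p (\<lambda>x. B * 1)" using Lp_norm_mono[OF p f in_Lp_const[OF p] AE] by simp
  also have "\<dots> = B"
    using B by (subst Lp_norm_cmult[OF p]) (simp add: Lp_norm_def measure_restrict_space)
  finally show "Lp_norm p f \<le> B" .
qed

lemma continuous_in_Lp:
  assumes "1 \<le> p" "continuous_on {0..1} f" shows "in_Lp p f"
proof -
  obtain B where "\<And>x. x \<in> {0..1} \<Longrightarrow> \<bar>f x\<bar> \<le> B"
    using compact_imp_bounded[OF compact_continuous_image[OF assms(2)]] unfolding bounded_iff by force
  then show ?thesis
    using assms by (intro in_Lp_bounded[of p f "\<bar>B\<bar>"] continuous_imp_measurable_on_sets_lebesgue) force+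
qed

section \<open>Density of continuous functions and of polynomials\<close>

lemma LIMSEQ_0_less:
  fixes X :: "nat \<Rightarrow> real"
  assumes "X \<longlonglongrightarrow> 0" "0 < e" shows "\<exists>n. X n < e"
  using eventually_happens'[OF trivial_limit_sequentially order_tendstoD(2)[OF assms]] .

lemma Lp_dominated_convergence:
  assumes p: "1 \<le> p" and f: "f \<in> borel_measurable I01" and g: "\<And>n. g n \<in> borel_measurable I01"
    and w: "in_Lp p w"
    and lim: "AE x in I01. (\<lambda>n. g n x) \<longlonglongrightarrow> f x"
    and bd: "\<And>n. AE x in I01. \<bar>f x - g n x\<bar> \<le> w x"
  shows "(\<lambda>n. Lp_norm p (\<lambda>x. f x - g n x)) \<longlonglongrightarrow> 0"
proof -
  note [measurable] = f g
  have "(\<lambda>n. \<integral>x. \<bar>f x - g n x\<bar> powr p \<partial>I01) \<longlonglongrightarrow> (\<integral>x. 0 \<partial>I01)"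
  proof (rule integral_dominated_convergence)
    show "integrable I01 (\<lambda>x. \<bar>w x\<bar> powr p)" using w by (simp add: in_Lp_def)
    show "AE x in I01. (\<lambda>n. \<bar>f x - g n x\<bar> powr p) \<longlonglongrightarrow> 0"
      using lim
    proof (rule AE_mp, intro AE_I2 impI)
      fix x assume "(\<lambda>n. g n x) \<longlonglongrightarrow> f x"
      then have "(\<lambda>n. \<bar>f x - g n x\<bar>) \<longlonglongrightarrow> 0"
        using tendsto_diff[OF tendsto_const[of "f x"]] tendsto_rabs_zero by fastforce
      then show "(\<lambda>n. \<bar>f x - g n x\<bar> powr p) \<longlonglongrightarrow> 0"
        using p tendsto_powr'[OF _ tendsto_const, of "\<lambda>n. \<bar>f x - g n x\<bar>" 0 sequentially p] by auto
    qed
    show "AE x in I01. norm (\<bar>f x - g n x\<bar> powr p) \<le> \<bar>w x\<bar> powr p" for n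
      using bd[of n] p by (auto elim!: eventually_mono intro!: powr_mono2)
  qed auto
  then have "(\<lambda>n. \<integral>x. \<bar>f x - g n x\<bar> powr p \<partial>I01) \<longlonglongrightarrow> 0" by simp
  then show ?thesis
    unfolding Lp_norm_def
    using p tendsto_powr'[OF _ tendsto_const, of "\<lambda>n. \<integral>x. \<bar>f x - g n x\<bar> powr p \<partial>I01" 0 sequentially "1/p"] by auto
qed

text \<open>Truncation at height \<open>M\<close> comes first; the truncated function is an a.e.
  limit of continuous functions, and clipping these at \<open>M\<close> as well supplies a constant
  dominating function.\<close>

lemma continuous_dense_Lp:
  assumes p: "1 \<le> p" and f: "in_Lp p f" and e: "0 < e"
  shows "\<exists>g. continuous_on UNIV g \<and> Lp_norm p (\<lambda>x. f x - g x) < e"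
proof -
  note fm[measurable] = in_Lp_measurable[OF f]
  define cl where "cl = (\<lambda>(n::nat) y::real. max (- real n) (min (real n) y))"
  have clm[measurable]: "(\<lambda>x. cl n (f x)) \<in> borel_measurable I01" for n
    unfolding cl_def by measurable
  have "(\<lambda>n. Lp_norm p (\<lambda>x. f x - cl n (f x))) \<longlonglongrightarrow> 0"
  proof (rule Lp_dominated_convergence[OF p fm clm])
    show "in_Lp p (\<lambda>x. \<bar>f x\<bar>)" using f by (auto simp: in_Lp_def)
    show "AE x in I01. (\<lambda>n. cl n (f x)) \<longlonglongrightarrow> f x"
    proof (intro AE_I2)
      fix x
      obtain N :: nat where "\<bar>f x\<bar> \<le> real N" using real_arch_simple by blast
      then have "eventually (\<lambda>n. cl n (f x) = f x) sequentially"
        by (intro eventually_sequentiallyI[of N]) (auto simp: cl_def)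
      then show "(\<lambda>n. cl n (f x)) \<longlonglongrightarrow> f x" by (rule tendsto_eventually)
    qed
    show "AE x in I01. \<bar>f x - cl n (f x)\<bar> \<le> \<bar>f x\<bar>" for n
      by (intro AE_I2) (auto simp: cl_def max_def min_def)
  qed
  then obtain M where M: "Lp_norm p (\<lambda>x. f x - cl M (f x)) < e/2"
    using LIMSEQ_0_less[of _ "e/2"] e half_gt_zero by auto
  have "(\<lambda>x. cl M (f x)) measurable_on {0..1}"
    by (subst measurable_on_iff_borel_measurable) auto
  then obtain N g where N: "negligible N" and g: "\<And>n. continuous_on UNIV (g n)"
    and lim: "\<And>x. x \<notin> N \<Longrightarrow> (\<lambda>n. g n x) \<longlonglongrightarrow> (if x \<in> {0..1} then cl M (f x) else 0)"
    unfolding measurable_on_def by blast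
  have gc: "continuous_on UNIV (\<lambda>x. cl M (g n x))" for n
    unfolding cl_def by (intro continuous_intros g)
  have "(\<lambda>n. Lp_norm p (\<lambda>x. cl M (f x) - cl M (g n x))) \<longlonglongrightarrow> 0"
  proof (rule Lp_dominated_convergence[OF p clm])
    show "(\<lambda>x. cl M (g n x)) \<in> borel_measurable I01" for n
      using gc by (intro continuous_imp_measurable_on_sets_lebesgue continuous_on_subset[OF gc]) auto
    show "in_Lp p (\<lambda>x. 2 * real M)" by (rule in_Lp_const[OF p])
    have "AE x in lebesgue. x \<notin> N"
      using N by (simp add: negligible_iff_null_sets AE_not_in)
    then have "AE x in I01. x \<notin> N" by (subst AE_restrict_space_iff) auto
    then show "AE x in I01. (\<lambda>n. cl M (g n x)) \<longlonglongrightarrow> cl M (f x)"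
    proof (rule AE_mp, intro AE_I2 impI)
      fix x assume "x \<in> space I01" "x \<notin> N"
      then have "(\<lambda>n. g n x) \<longlonglongrightarrow> cl M (f x)" using lim[of x] by simp
      then have "(\<lambda>n. cl M (g n x)) \<longlonglongrightarrow> cl M (cl M (f x))"
        unfolding cl_def by (intro tendsto_intros)
      moreover have "cl M (cl M (f x)) = cl M (f x)" by (auto simp: cl_def)
      ultimately show "(\<lambda>n. cl M (g n x)) \<longlonglongrightarrow> cl M (f x)" by simp
    qed
    show "AE x in I01. \<bar>cl M (f x) - cl M (g n x)\<bar> \<le> 2 * real M" for n
      by (intro AE_I2) (auto simp: cl_def max_def min_def)
  qed
  then obtain n where n: "Lp_norm p (\<lambda>x. cl M (f x) - cl M (g n x)) < e/2"
    using LIMSEQ_0_less[of _ "e/2"] e half_gt_zero by auto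
  have "in_Lp p (\<lambda>x. cl M (f x))"
    by (rule in_Lp_mono[OF p clm f]) (auto simp: cl_def max_def min_def)
  from Lp_norm_diff_trans[OF p f this continuous_in_Lp[OF p continuous_on_subset[OF gc subset_UNIV]], of n]
  show ?thesis using M n gc by (intro exI[of _ "\<lambda>x. cl M (g n x)"]) auto
qed

lemma polynomials_dense_Lp:
  assumes p: "1 \<le> p" and f: "in_Lp p f" and e: "0 < e"
  shows "\<exists>(a :: nat \<Rightarrow> real) d. Lp_norm p (\<lambda>x. f x - (\<Sum>k\<le>d. a k * x ^ k)) < e"
proof -
  obtain g where g: "continuous_on UNIV g" "Lp_norm p (\<lambda>x. f x - g x) < e/2"
    using continuous_dense_Lp[OF p f, of "e/2"] e by auto
  obtain q where q: "real_polynomial_function q" "\<And>x. x \<in> {0..1} \<Longrightarrow> \<bar>g x - q x\<bar> < e/2"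
    using Stone_Weierstrass_real_polynomial_function[of "{0..1::real}" g "e/2"] e continuous_on_subset[OF g(1)] by auto
  obtain a d where q': "q = (\<lambda>x. \<Sum>k\<le>d. a k * x ^ k)"
    using q(1) real_polynomial_function_iff_sum by blast
  have gc: "continuous_on {0..1} g" "continuous_on {0..1} q"
    using continuous_on_subset[OF g(1)] by (auto simp: q' intro!: continuous_intros)
  have "Lp_norm p (\<lambda>x. g x - q x) \<le> e/2"
    using q(2) e gc by (intro Lp_norm_bounded[OF p] continuous_imp_measurable_on_sets_lebesgue continuous_intros) (auto intro: less_imp_le)
  then have "Lp_norm p (\<lambda>x. f x - q x) < e"
    using Lp_norm_diff_trans[OF p f continuous_in_Lp[OF p gc(1)] continuous_in_Lp[OF p gc(2)]] g(2) by simp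
  then show ?thesis unfolding q' by blast
qed

section \<open>Approximation by exponential sums\<close>

text \<open>If \<open>Q\<close> is the error for \<open>F\<close>, the error after adding
  \<open>m\<close> is \<open>exp (- m * t) * W t\<close> with \<open>W 0 = 0\<close> and derivative
  \<open>(m - \<nu>) * exp (m * t) * Q t\<close>. The bound on \<open>Q\<close> dominates this by
  the derivative of \<open>\<Phi>\<close>, and multiplying \<open>\<Phi>\<close> by
  \<open>exp (- m * t)\<close> produces exactly one more factor of the product. The gap between
  \<open>c\<close> and \<open>\<nu>\<close> makes each factor less than 1.\<close>

lemma exp_sum_approx_large:
  fixes \<nu> c :: real and F :: "real set"
  assumes F: "finite F" "\<And>\<mu>. \<mu> \<in> F \<Longrightarrow> \<nu> < \<mu>" and c: "c < \<nu>"
  shows "\<exists>k :: real \<Rightarrow> real. \<forall>t\<ge>0. \<bar>exp (- \<nu> * t) - (\<Sum>\<mu>\<in>F. k \<mu> * exp (- \<mu> * t))\<bar>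
           \<le> (\<Prod>\<mu>\<in>F. (\<mu> - \<nu>) / (\<mu> - c)) * exp (- c * t)"
  using F
proof (induction F rule: finite_induct)
  case empty
  then show ?case using c by (auto intro!: mult_right_mono)
next
  case (insert m F)
  obtain k where k: "\<And>t. 0 \<le> t \<Longrightarrow> \<bar>exp (- \<nu> * t) - (\<Sum>\<mu>\<in>F. k \<mu> * exp (- \<mu> * t))\<bar>
           \<le> (\<Prod>\<mu>\<in>F. (\<mu> - \<nu>) / (\<mu> - c)) * exp (- c * t)"
    using insert.IH[OF insert.prems[OF insertI2]] by blast
  have m: "\<nu> < m" "c < m" using insert.prems[of m] c by auto
  have ne: "\<mu> \<noteq> m" if "\<mu> \<in> F" for \<mu> using insert.hyps that by auto
  define K where "K = (\<Prod>\<mu>\<in>F. (\<mu> - \<nu>) / (\<mu> - c))"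
  have K: "0 \<le> K" unfolding K_def using insert.prems c by (intro prod_nonneg) fastforce
  \<comment> \<open>Integrating \<open>exp ((m - \<mu>) * s)\<close> divides by
    \<open>m - \<mu>\<close>; the constants of integration gather in the coefficient of the new node
    \<open>m\<close>.\<close>
  define q where "q \<mu> = k \<mu> * (m - \<nu>) / (m - \<mu>)" for \<mu>
  define k' where "k' \<mu> = (if \<mu> = m then 1 - (\<Sum>\<mu>\<in>F. q \<mu>) else q \<mu>)" for \<mu>
  define Q where "Q t = exp (- \<nu> * t) - (\<Sum>\<mu>\<in>F. k \<mu> * exp (- \<mu> * t))" for t
  define W where "W t = exp ((m - \<nu>) * t) - 1 - (\<Sum>\<mu>\<in>F. q \<mu> * (exp ((m - \<mu>) * t) - 1))" for t
  define \<Phi> where "\<Phi> t = K * ((m - \<nu>) / (m - c)) * exp ((m - c) * t)" for t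
  have E: "exp ((m - x) * t) = exp (m * t) * exp (- x * t)" for x t
    by (simp flip: exp_add add: left_diff_distrib)
  have dW: "(W has_real_derivative (m - \<nu>) * exp (m * t) * Q t) (at t)" for t
  proof -
    have "(W has_real_derivative (m - \<nu>) * exp ((m - \<nu>) * t) - (\<Sum>\<mu>\<in>F. q \<mu> * ((m - \<mu>) * exp ((m - \<mu>) * t)))) (at t)"
      unfolding W_def by (auto intro!: derivative_eq_intros sum.cong)
    also have "(\<Sum>\<mu>\<in>F. q \<mu> * ((m - \<mu>) * exp ((m - \<mu>) * t))) = (\<Sum>\<mu>\<in>F. (m - \<nu>) * exp (m * t) * (k \<mu> * exp (- \<mu> * t)))"
      using ne by (intro sum.cong) (auto simp: q_def E)
    also have "(m - \<nu>) * exp ((m - \<nu>) * t) - \<dots> = (m - \<nu>) * exp (m * t) * Q t"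
      unfolding Q_def E by (simp only: right_diff_distrib sum_distrib_left mult.assoc)
    finally show ?thesis .
  qed
  have d\<Phi>: "(\<Phi> has_real_derivative K * (m - \<nu>) * exp ((m - c) * t)) (at t)" for t
    unfolding \<Phi>_def using m by (auto intro!: derivative_eq_intros)
  have bd: "\<bar>(m - \<nu>) * exp (m * t) * Q t\<bar> \<le> K * (m - \<nu>) * exp ((m - c) * t)" if "0 \<le> t" for t
  proof -
    have "\<bar>(m - \<nu>) * exp (m * t) * Q t\<bar> = (m - \<nu>) * exp (m * t) * \<bar>Q t\<bar>" using m by (simp add: abs_mult)
    also have "\<dots> \<le> (m - \<nu>) * exp (m * t) * (K * exp (- c * t))"
      using k[OF that] m by (intro mult_left_mono) (auto simp: Q_def K_def)
    also have "\<dots> = K * (m - \<nu>) * exp ((m - c) * t)"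
      unfolding E by simp
    finally show ?thesis .
  qed
  \<comment> \<open>Both \<open>\<Phi> - W\<close> and \<open>\<Phi> + W\<close> are nondecreasing
    on the half-line; the starting value \<open>\<Phi> 0\<close> is nonnegative and is
    discarded.\<close>
  have "\<bar>W t\<bar> \<le> \<Phi> t" if t: "0 \<le> t" for t
  proof -
    have "\<Phi> 0 - W 0 \<le> \<Phi> t - W t"
      using t bd by (intro DERIV_nonneg_imp_nondecreasing[OF t]) (force intro!: derivative_eq_intros dW d\<Phi> simp: abs_le_iff)
    moreover have "\<Phi> 0 + W 0 \<le> \<Phi> t + W t"
      using t bd by (intro DERIV_nonneg_imp_nondecreasing[OF t]) (force intro!: derivative_eq_intros dW d\<Phi> simp: abs_le_iff)
    moreover have "W 0 = 0" "0 \<le> \<Phi> 0" using K m by (auto simp: W_def \<Phi>_def)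
    ultimately show ?thesis by linarith
  qed
  moreover have "exp (- \<nu> * t) - (\<Sum>\<mu>\<in>insert m F. k' \<mu> * exp (- \<mu> * t)) = exp (- m * t) * W t" for t
  proof -
    have "exp (- m * t) * W t = exp (- \<nu> * t) - exp (- m * t) - (\<Sum>\<mu>\<in>F. q \<mu> * (exp (- \<mu> * t) - exp (- m * t)))"
    proof -
      have i: "exp (- m * t) * exp (m * t) = 1" by (simp flip: exp_add)
      have j: "exp (- m * t) * (exp (m * t) * x) = x" for x using i by (metis mult.assoc mult_1)
      show ?thesis
        unfolding W_def E right_diff_distrib sum_distrib_left
        by (simp only: j mult.left_commute[of "exp (- m * t)" "q _"] mult_1_right mult.commute[of "exp (- m * t)" "q _"])
    qed
    also have "(\<Sum>\<mu>\<in>F. q \<mu> * (exp (- \<mu> * t) - exp (- m * t))) = (\<Sum>\<mu>\<in>F. k' \<mu> * exp (- \<mu> * t)) - (\<Sum>\<mu>\<in>F. q \<mu>) * exp (- m * t)"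
      using ne by (simp add: right_diff_distrib sum_subtractf sum_distrib_right k'_def cong: sum.cong)
    finally show ?thesis using insert.hyps by (simp add: k'_def left_diff_distrib)
  qed
  moreover have "exp (- m * t) * \<Phi> t = (\<Prod>\<mu>\<in>insert m F. (\<mu> - \<nu>) / (\<mu> - c)) * exp (- c * t)" for t
    using insert.hyps unfolding \<Phi>_def K_def E by (simp add: exp_minus)
  ultimately show ?case
    by (intro exI[of _ k'] allI impI) (metis abs_exp_cancel abs_mult exp_ge_zero mult_left_mono)
qed

text \<open>Only the coefficient at \<open>\<nu>\<close> has to be explicit, being the residue that
  is later divided out. Those at \<open>F\<close> turn into the free coefficients of an exponential
  sum, for which existence is enough.\<close>

lemma partial_fractions:
  fixes \<nu> :: complex
  assumes "finite F" "\<nu> \<notin> F"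
  shows "\<exists>c. \<forall>z. z \<noteq> \<nu> \<longrightarrow> z \<notin> F \<longrightarrow>
     1 / ((z - \<nu>) * (\<Prod>w\<in>F. z - w)) = (1 / (\<Prod>w\<in>F. \<nu> - w)) / (z - \<nu>) + (\<Sum>w\<in>F. c w / (z - w))"
  using assms
proof (induction F rule: finite_induct)
  case empty
  then show ?case by simp
next
  case (insert m F)
  then obtain c where c: "\<And>z. z \<noteq> \<nu> \<Longrightarrow> z \<notin> F \<Longrightarrow>
     1 / ((z - \<nu>) * (\<Prod>w\<in>F. z - w)) = (1 / (\<Prod>w\<in>F. \<nu> - w)) / (z - \<nu>) + (\<Sum>w\<in>F. c w / (z - w))"
    by auto
  have split: "1 / ((z - w) * (z - m)) = (1 / (w - m)) / (z - w) - (1 / (w - m)) / (z - m)"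
    if "z \<noteq> w" "z \<noteq> m" "w \<noteq> m" for z w
    using that by (simp add: divide_simps)
  define A where "A = 1 / (\<Prod>w\<in>F. \<nu> - w)"
  \<comment> \<open>Splitting each old fraction against the new pole leaves a term over
    \<open>z - m\<close>; all of these add up in \<open>c' m\<close>.\<close>
  define c' where "c' w = (if w = m then - A / (\<nu> - m) - (\<Sum>w\<in>F. c w / (w - m)) else c w / (w - m))" for w
  have "1 / ((z - \<nu>) * (\<Prod>w\<in>insert m F. z - w)) = (1 / (\<Prod>w\<in>insert m F. \<nu> - w)) / (z - \<nu>) + (\<Sum>w\<in>insert m F. c' w / (z - w))"
    if z: "z \<noteq> \<nu>" "z \<notin> insert m F" for z
  proof -
    have "1 / ((z - \<nu>) * (\<Prod>w\<in>insert m F. z - w)) = (1 / ((z - \<nu>) * (\<Prod>w\<in>F. z - w))) * (1 / (z - m))"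
      using insert.hyps by simp
    also have "\<dots> = A * (1 / ((z - \<nu>) * (z - m))) + (\<Sum>w\<in>F. c w * (1 / ((z - w) * (z - m))))"
      using z by (subst c) (auto simp: A_def add_divide_distrib sum_divide_distrib)
    also have "(\<Sum>w\<in>F. c w * (1 / ((z - w) * (z - m)))) = (\<Sum>w\<in>F. c' w / (z - w) - (c w / (w - m)) / (z - m))"
    proof (rule sum.cong[OF refl])
      fix w assume "w \<in> F"
      then have "z \<noteq> w" "w \<noteq> m" "z \<noteq> m" using z insert.hyps by auto
      then show "c w * (1 / ((z - w) * (z - m))) = c' w / (z - w) - (c w / (w - m)) / (z - m)"
        by (subst split) (auto simp: c'_def right_diff_distrib)
    qed
    also have "A * (1 / ((z - \<nu>) * (z - m))) = (A / (\<nu> - m)) / (z - \<nu>) - (A / (\<nu> - m)) / (z - m)"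
      using z insert.prems by (subst split) (auto simp: right_diff_distrib)
    finally show ?thesis
      using insert.hyps
      by (simp add: sum_subtractf A_def c'_def diff_divide_distrib sum_divide_distrib)
  qed
  then show ?case by blast
qed

text \<open>\<open>c\<close> is fixed before \<open>f\<close>: later \<open>f\<close> carries
  \<open>exp (- z * t)\<close>, and the coefficients of the exponential sum must not depend on
  \<open>t\<close>.\<close>

lemma circle_integral_simple_poles:
  fixes \<nu> :: complex
  assumes F: "finite F" "\<nu> \<notin> F" and inside: "\<And>w. w \<in> insert \<nu> F \<Longrightarrow> norm (w - z0) < r"
  shows "\<exists>c. \<forall>f. f holomorphic_on UNIV \<longrightarrow>
     ((\<lambda>z. f z / ((z - \<nu>) * (\<Prod>w\<in>F. z - w))) has_contour_integral
        2 * pi * \<i> * (f \<nu> / (\<Prod>w\<in>F. \<nu> - w) + (\<Sum>w\<in>F. c w * f w))) (circlepath z0 r)"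
proof -
  obtain c where c: "\<And>z. z \<noteq> \<nu> \<Longrightarrow> z \<notin> F \<Longrightarrow>
     1 / ((z - \<nu>) * (\<Prod>w\<in>F. z - w)) = (1 / (\<Prod>w\<in>F. \<nu> - w)) / (z - \<nu>) + (\<Sum>w\<in>F. c w / (z - w))"
    using partial_fractions[OF F] by blast
  have r: "0 < r" using inside[of \<nu>] by (metis insertI1 norm_ge_zero order_le_less_trans)
  have "((\<lambda>z. f z / ((z - \<nu>) * (\<Prod>w\<in>F. z - w))) has_contour_integral
        2 * pi * \<i> * (f \<nu> / (\<Prod>w\<in>F. \<nu> - w) + (\<Sum>w\<in>F. c w * f w))) (circlepath z0 r)"
    if f: "f holomorphic_on UNIV" for f
  proof -
    have *: "((\<lambda>z. f z / (z - w)) has_contour_integral (2 * of_real pi * \<i> * f w)) (circlepath z0 r)"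
      if "w \<in> insert \<nu> F" for w
      using f inside[OF that] by (intro Cauchy_integral_circlepath_simple) (auto intro: holomorphic_on_subset)
    have "((\<lambda>z. (1 / (\<Prod>w\<in>F. \<nu> - w)) * (f z / (z - \<nu>)) + (\<Sum>w\<in>F. c w * (f z / (z - w)))) has_contour_integral
        ((1 / (\<Prod>w\<in>F. \<nu> - w)) * (2 * of_real pi * \<i> * f \<nu>) + (\<Sum>w\<in>F. c w * (2 * of_real pi * \<i> * f w)))) (circlepath z0 r)"
      using F by (intro has_contour_integral_add has_contour_integral_sum has_contour_integral_lmul *) auto
    also have "(1 / (\<Prod>w\<in>F. \<nu> - w)) * (2 * of_real pi * \<i> * f \<nu>) + (\<Sum>w\<in>F. c w * (2 * of_real pi * \<i> * f w))
       = 2 * pi * \<i> * (f \<nu> / (\<Prod>w\<in>F. \<nu> - w) + (\<Sum>w\<in>F. c w * f w))"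
      by (simp add: distrib_left sum_distrib_left mult_ac)
    finally show ?thesis
    proof (rule has_contour_integral_eq)
      fix z assume "z \<in> path_image (circlepath z0 r)"
      then have "norm (z - z0) = r" using r by (simp add: dist_norm norm_minus_commute)
      then have z: "z \<noteq> \<nu>" "z \<notin> F" using inside by fastforce+
      have "f z / ((z - \<nu>) * (\<Prod>w\<in>F. z - w)) = f z * (1 / ((z - \<nu>) * (\<Prod>w\<in>F. z - w)))" by simp
      also have "\<dots> = (1 / (\<Prod>w\<in>F. \<nu> - w)) * (f z / (z - \<nu>)) + (\<Sum>w\<in>F. c w * (f z / (z - w)))"
        by (subst c[OF z]) (simp add: distrib_left sum_distrib_left mult_ac)
      finally show "(1 / (\<Prod>w\<in>F. \<nu> - w)) * (f z / (z - \<nu>)) + (\<Sum>w\<in>F. c w * (f z / (z - w))) = f z / ((z - \<nu>) * (\<Prod>w\<in>F. z - w))" by simp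
    qed
  qed
  then show ?thesis by blast
qed

text \<open>On the circle \<open>\<zeta> = z - R\<close> satisfies
  \<open>R * R = \<zeta> * cnj \<zeta>\<close>, which factors the left-hand polynomial as
  \<open>\<zeta> * cnj (z - m)\<close>. Divided by \<open>R * (z - m)\<close> it is the reciprocal
  of the Blaschke factor with zero \<open>m\<close>.\<close>

lemma norm_blaschke_circle:
  fixes R m :: real and z :: complex
  assumes z: "norm (z - of_real R) = R"
  shows "norm (R * m + R * z - m * z) = R * norm (z - of_real m)"
proof -
  define \<zeta> where "\<zeta> = z - of_real R"
  have "of_real R * of_real R = \<zeta> * cnj \<zeta>"
    using z complex_norm_square[of \<zeta>] by (simp add: \<zeta>_def power2_eq_square)
  then have "R * m + R * z - m * z = \<zeta> * cnj (z - of_real m)"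
    by (simp add: \<zeta>_def algebra_simps)
  then show ?thesis using z by (simp add: norm_mult \<zeta>_def del: complex_cnj_diff)
qed

text \<open>Combines \<open>exp y \<ge> y^2 / 2\<close> at \<open>y = c * t\<close> with
  \<open>(1 + t)^2 \<le> 2 + 2 * t^2\<close>.\<close>

lemma exp_le_inverse_square:
  fixes c t :: real
  assumes c: "0 < c" and t: "0 \<le> t"
  shows "exp (- c * t) \<le> (2 + 4 / c\<^sup>2) / (1 + t)\<^sup>2"
proof -
  have "0 \<le> c * t" using c t by simp
  then have "c\<^sup>2 * t\<^sup>2 \<le> 2 * exp (c * t)"
    using exp_lower_Taylor_quadratic[of "c * t"] by (simp add: power_mult_distrib)
  then have 1: "t\<^sup>2 \<le> 2 / c\<^sup>2 * exp (c * t)" using c by (simp add: field_simps)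
  have 2: "1 \<le> exp (c * t)" using c t by simp
  have "(1 + t)\<^sup>2 \<le> 2 + 2 * t\<^sup>2"
    using zero_le_power2[of "1 - t"] by (simp add: power2_eq_square algebra_simps)
  also have "\<dots> \<le> (2 + 4 / c\<^sup>2) * exp (c * t)" 
  proof -
    have "2 * t\<^sup>2 \<le> 4 / c\<^sup>2 * exp (c * t)" using 1 by simp
    moreover have "2 * 1 \<le> 2 * exp (c * t)" using 2 by (rule mult_left_mono) simp
    ultimately show ?thesis unfolding distrib_right by linarith
  qed
  finally show ?thesis
    using t by (simp add: pos_le_divide_eq exp_minus field_simps)
qed

text \<open>Uniform in \<open>s\<close> down to 0, unlike the preceding bound in \<open>c\<close>.
  Here \<open>s\<close> will be \<open>Re z\<close> on a circle touching the imaginary axis, and the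
  factor \<open>s^2\<close> makes up for the missing exponential decay.\<close>

lemma square_mult_exp_bound:
  fixes s t b :: real
  assumes s: "0 \<le> s" "s \<le> b" and t: "0 \<le> t"
  shows "s\<^sup>2 * exp (- s * t) \<le> (2 * b\<^sup>2 + 4) / (1 + t)\<^sup>2"
proof -
  have "(s * t)\<^sup>2 \<le> 2 * exp (s * t)"
    using exp_lower_Taylor_quadratic[of "s * t"] s t by (simp add: field_simps) (smt (verit) mult_nonneg_nonneg)
  then have 1: "(s * t)\<^sup>2 * exp (- s * t) \<le> 2"
    by (simp add: exp_minus field_simps)
  have "s\<^sup>2 \<le> b\<^sup>2" using s by (intro power_mono) auto
  then have 2: "s\<^sup>2 * exp (- s * t) \<le> b\<^sup>2"
    using s t by (intro order_trans[OF mult_right_le_one_le]) auto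
  have "(1 + t)\<^sup>2 \<le> 2 + 2 * t\<^sup>2"
    using zero_le_power2[of "1 - t"] by (simp add: power2_eq_square algebra_simps)
  then have "s\<^sup>2 * exp (- s * t) * (1 + t)\<^sup>2 \<le> s\<^sup>2 * exp (- s * t) * (2 + 2 * t\<^sup>2)"
    by (intro mult_left_mono) auto
  also have "\<dots> = 2 * (s\<^sup>2 * exp (- s * t)) + 2 * ((s * t)\<^sup>2 * exp (- s * t))"
    by (simp add: power_mult_distrib algebra_simps)
  also have "\<dots> \<le> 2 * b\<^sup>2 + 4" using 1 2 by simp
  finally show ?thesis using t by (simp add: pos_le_divide_eq)
qed

text \<open>The constant records the steps: \<open>4 * R^2\<close> is from \<open>|z|^4\<close> on
  the circle, \<open>8 * R^2 + 4\<close> from \<open>square_mult_exp_bound\<close> with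
  \<open>b = 2 * R\<close>, one further \<open>R\<close> from the length of the circle,
  \<open>\<nu>^4\<close> from \<open>z^4\<close> at \<open>\<nu>\<close>, and the fifth
  \<open>\<nu>\<close> from the distance of \<open>\<nu>\<close> to the circle. The product is the
  modulus of the Blaschke product at \<open>\<nu>\<close>.\<close>

lemma exp_sum_approx_small:
  fixes \<nu> R :: real and F :: "real set"
  assumes F: "finite F" "\<And>\<mu>. \<mu> \<in> F \<Longrightarrow> 0 < \<mu> \<and> \<mu> \<le> 1" and \<nu>: "0 < \<nu>" "\<nu> \<notin> F" and R: "R = 1 + \<nu>"
  shows "\<exists>k :: real \<Rightarrow> real. \<forall>t\<ge>0. \<bar>exp (- \<nu> * t) - (\<Sum>\<mu>\<in>F. k \<mu> * exp (- \<mu> * t))\<bar>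
           \<le> 4 * R ^ 3 * (8 * R\<^sup>2 + 4) / \<nu> ^ 5 * (\<Prod>\<mu>\<in>F. R * \<bar>\<nu> - \<mu>\<bar> / (R * \<mu> + R * \<nu> - \<mu> * \<nu>)) / (1 + t)\<^sup>2"
proof -
  have R0: "0 < R" using R \<nu> by simp
  \<comment> \<open>The denominator of the Blaschke product. As a factor of \<open>f\<close> it
    keeps \<open>f\<close> entire, so the integrand has its poles only at \<open>\<nu>\<close> and
    \<open>F\<close>.\<close>
  define d :: "complex \<Rightarrow> complex" where "d z = (\<Prod>\<mu>\<in>F. R * \<mu> + R * z - \<mu> * z)" for z :: complex
  \<comment> \<open>\<open>\<nu>\<close> has distance 1 from the centre
    \<open>R = 1 + \<nu>\<close>, and (0, 1] is contained in (0, 2 R).\<close>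
  have "norm (complex_of_real w - R) < R" if "w \<in> insert \<nu> F" for w
    using that F(2)[of w] \<nu> R unfolding of_real_diff[symmetric] norm_of_real by auto
  then have inside: "norm (w - R) < R" if "w \<in> insert (complex_of_real \<nu>) (of_real ` F)" for w
    using that by auto
  have "complex_of_real \<nu> \<notin> of_real ` F" using \<nu>(2) by auto
  from circle_integral_simple_poles[OF finite_imageI[OF F(1)] this inside]
  obtain c where c: "\<And>f. f holomorphic_on UNIV \<Longrightarrow>
     ((\<lambda>z. f z / ((z - \<nu>) * (\<Prod>w\<in>of_real ` F. z - w))) has_contour_integral
        2 * pi * \<i> * (f \<nu> / (\<Prod>w\<in>of_real ` F. of_real \<nu> - w) + (\<Sum>w\<in>of_real ` F. c w * f w))) (circlepath R R)"
    by blast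
  have re: "(\<Prod>w\<in>complex_of_real ` F. g w) = (\<Prod>\<mu>\<in>F. g (of_real \<mu>))" for g :: "complex \<Rightarrow> complex"
    by (subst prod.reindex) (auto simp: inj_on_def)
  have re': "(\<Sum>w\<in>complex_of_real ` F. g w) = (\<Sum>\<mu>\<in>F. g (of_real \<mu>))" for g :: "complex \<Rightarrow> complex"
    by (subst sum.reindex) (auto simp: inj_on_def)
  define K where "K = 4 * R\<^sup>2 * (8 * R\<^sup>2 + 4) / \<nu>"
  \<comment> \<open>The residue at \<open>\<nu>\<close> without its factor
    \<open>exp (- \<nu> * t)\<close>. Dividing by it normalises the coefficient of that exponential
    to 1 and brings in the small product \<open>B\<close>.\<close>
  define A where "A = \<nu> ^ 4 * (\<Prod>\<mu>\<in>F. (R * \<mu> + R * \<nu> - \<mu> * \<nu>) / (\<nu> - \<mu>))"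
  have dpos: "0 < R * \<mu> + R * \<nu> - \<mu> * \<nu>" if "\<mu> \<in> F" for \<mu>
    using F(2)[OF that] \<nu> by (simp add: R algebra_simps add_pos_pos)
  have A0: "A \<noteq> 0" unfolding A_def using dpos \<nu> F(1) by (auto simp: less_le)
  define B where "B = (\<Prod>\<mu>\<in>F. R * \<bar>\<nu> - \<mu>\<bar> / (R * \<mu> + R * \<nu> - \<mu> * \<nu>))"
  have AB: "R ^ card F / \<bar>A\<bar> = B / \<nu> ^ 4"
  proof -
    have "\<bar>A\<bar> = \<nu> ^ 4 * (\<Prod>\<mu>\<in>F. (R * \<mu> + R * \<nu> - \<mu> * \<nu>) / \<bar>\<nu> - \<mu>\<bar>)"
      unfolding A_def abs_mult abs_prod using \<nu> dpos by (auto simp: abs_divide less_imp_le intro!: prod.cong)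
    moreover have "B = R ^ card F / (\<Prod>\<mu>\<in>F. (R * \<mu> + R * \<nu> - \<mu> * \<nu>) / \<bar>\<nu> - \<mu>\<bar>)"
      unfolding B_def by (simp add: prod_dividef prod.distrib)
    ultimately show ?thesis by simp
  qed
  \<comment> \<open>The target and the exponentials are real, so taking real parts of the complex
    coefficients does not increase the error.\<close>
  define k where "k \<mu> = - Re (c (of_real \<mu>) * of_real \<mu> ^ 4 * d (of_real \<mu>) / of_real A)" for \<mu> :: real
  have "\<bar>exp (- \<nu> * t) - (\<Sum>\<mu>\<in>F. k \<mu> * exp (- \<mu> * t))\<bar> \<le> K * R * R ^ card F / \<bar>A\<bar> / (1 + t)\<^sup>2" if t: "0 \<le> t" for t
  proof -
    define f :: "complex \<Rightarrow> complex" where "f z = exp (- z * t) * z ^ 4 * d z" for z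
    define J where "J = of_real A * exp (- of_real \<nu> * of_real t) + (\<Sum>\<mu>\<in>F. c (of_real \<mu>) * f (of_real \<mu>))"
    have hol: "f holomorphic_on UNIV" unfolding f_def d_def by (intro holomorphic_intros)
    have fv: "f \<nu> / (\<Prod>\<mu>\<in>F. of_real \<nu> - of_real \<mu>) = of_real A * exp (- of_real \<nu> * of_real t)"
      by (simp add: f_def d_def A_def prod_dividef)
    have int: "((\<lambda>z. f z / ((z - \<nu>) * (\<Prod>\<mu>\<in>F. z - of_real \<mu>))) has_contour_integral 2 * pi * \<i> * J) (circlepath R R)"
      using c[OF hol] unfolding re re' fv J_def by simp
    have "norm (2 * pi * \<i> * J) \<le> (K * R ^ card F / (1 + t)\<^sup>2) * (2 * pi * R)"
    proof (rule has_contour_integral_bound_circlepath[OF int])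
      show "0 \<le> K * R ^ card F / (1 + t)\<^sup>2" using R0 \<nu> by (simp add: K_def)
      fix z :: complex assume z: "norm (z - of_real R) = R"
      \<comment> \<open>The circle passes through 0, so its equation becomes
        \<open>|z|^2 = 2 * R * Re z\<close>; squaring makes \<open>|z|^4\<close> a multiple of
        \<open>(Re z)^2\<close>.\<close>
      have "(Re z - R)\<^sup>2 + (Im z)\<^sup>2 = R\<^sup>2" using z by (metis cmod_power2 Re_complex_of_real Im_complex_of_real minus_complex.simps diff_zero)
      then have nz: "(norm z)\<^sup>2 = 2 * R * Re z" unfolding cmod_power2 by (simp add: power2_eq_square algebra_simps)
      then have Rez: "0 \<le> Re z" using R0 by (metis zero_le_mult_iff zero_le_power2 mult_pos_pos zero_less_numeral not_less)
      have Rez2: "Re z \<le> 2 * R" using abs_Re_le_cmod[of "z - of_real R"] z by simp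
      have "norm z ^ 4 = ((norm z)\<^sup>2)\<^sup>2" by simp
      then have z4: "norm z ^ 4 = 4 * R\<^sup>2 * (Re z)\<^sup>2" unfolding nz by (simp add: power_mult_distrib)
      have nd: "norm (d z) = R ^ card F * (\<Prod>\<mu>\<in>F. norm (z - of_real \<mu>))"
        unfolding d_def prod_norm[symmetric] norm_blaschke_circle[OF z] by (simp add: prod.distrib)
      have "z \<noteq> of_real \<mu>" if "\<mu> \<in> F" for \<mu>
      proof
        assume "z = of_real \<mu>"
        then have "\<bar>\<mu> - R\<bar> = R" using z by (metis norm_of_real of_real_diff)
        then show False using F(2)[OF that] R \<nu> by linarith
      qed
      then have p0: "(\<Prod>\<mu>\<in>F. norm (z - of_real \<mu>)) \<noteq> 0" using F(1) by auto
      \<comment> \<open>The circle keeps distance at least \<open>R - 1 = \<nu>\<close> from the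
        pole \<open>\<nu>\<close>.\<close>
      have "R \<le> norm (z - of_real \<nu>) + norm (of_real \<nu> - complex_of_real R)" using z by (metis norm_triangle_ineq diff_add_cancel add_diff_eq)
      moreover have "norm (of_real \<nu> - complex_of_real R) = 1" using R by (simp flip: of_real_diff)
      ultimately have nz\<nu>: "\<nu> \<le> norm (z - of_real \<nu>)" using R by linarith
      have "norm (f z / ((z - \<nu>) * (\<Prod>\<mu>\<in>F. z - of_real \<mu>))) = exp (- Re z * t) * norm z ^ 4 * R ^ card F / norm (z - \<nu>)"
        using p0 by (simp add: f_def norm_mult norm_divide norm_power nd prod_norm)
      also have "\<dots> \<le> exp (- Re z * t) * norm z ^ 4 * R ^ card F / \<nu>"
        using nz\<nu> R0 \<nu> by (intro divide_left_mono) (auto intro!: mult_pos_pos mult_nonneg_nonneg)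
      also have "\<dots> = (Re z)\<^sup>2 * exp (- Re z * t) * (4 * R\<^sup>2 * R ^ card F / \<nu>)" by (simp add: z4)
      also have "\<dots> \<le> (2 * (2 * R)\<^sup>2 + 4) / (1 + t)\<^sup>2 * (4 * R\<^sup>2 * R ^ card F / \<nu>)"
        using R0 \<nu> square_mult_exp_bound[OF Rez Rez2 t] by (intro mult_right_mono) auto
      also have "\<dots> = K * R ^ card F / (1 + t)\<^sup>2" by (simp add: K_def power_mult_distrib mult_ac)
      finally show "norm (f z / ((z - \<nu>) * (\<Prod>\<mu>\<in>F. z - of_real \<mu>))) \<le> K * R ^ card F / (1 + t)\<^sup>2" .
    qed (use R0 in auto)
    then have "(2 * pi) * norm J \<le> (2 * pi) * (K * R ^ card F / (1 + t)\<^sup>2 * R)" by (simp add: norm_mult mult_ac)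
    then have J: "norm J \<le> K * R ^ card F / (1 + t)\<^sup>2 * R" by (rule mult_left_le_imp_le) simp
    have "exp (- \<nu> * t) - (\<Sum>\<mu>\<in>F. k \<mu> * exp (- \<mu> * t)) = Re (J / of_real A)"
    proof -
      have "J / of_real A = of_real (exp (- \<nu> * t)) + (\<Sum>\<mu>\<in>F. (c (of_real \<mu>) * of_real \<mu> ^ 4 * d (of_real \<mu>) / of_real A) * of_real (exp (- \<mu> * t)))"
        unfolding J_def f_def using A0 by (simp add: add_divide_distrib sum_divide_distrib exp_of_real[symmetric] mult_ac)
      also have "Re \<dots> = exp (- \<nu> * t) + (\<Sum>\<mu>\<in>F. - k \<mu> * exp (- \<mu> * t))"
      proof -
        have "Re (z * of_real r) = Re z * r" for z r by simp
        then show ?thesis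
          unfolding plus_complex.simps Re_sum Re_complex_of_real k_def by (simp only: minus_minus)
      qed
      finally show ?thesis by (simp add: sum_negf)
    qed
    then have "\<bar>exp (- \<nu> * t) - (\<Sum>\<mu>\<in>F. k \<mu> * exp (- \<mu> * t))\<bar> \<le> norm J / \<bar>A\<bar>"
      using abs_Re_le_cmod[of "J / of_real A"] by (simp add: norm_divide)
    also have "\<dots> \<le> (K * R ^ card F / (1 + t)\<^sup>2 * R) / \<bar>A\<bar>" using J by (intro divide_right_mono) auto
    finally show ?thesis by (simp add: mult_ac)
  qed
  moreover have "K * R * R ^ card F / \<bar>A\<bar> = 4 * R ^ 3 * (8 * R\<^sup>2 + 4) / \<nu> ^ 5 * B"
  proof -
    have "K * R * R ^ card F / \<bar>A\<bar> = K * R * (B / \<nu> ^ 4)"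
      unfolding AB[symmetric] by simp
    then show ?thesis using \<nu> by (simp add: K_def power2_eq_square eval_nat_numeral)
  qed
  ultimately show ?thesis unfolding B_def by (intro exI[of _ k]) auto
qed

text \<open>The squared factor is
  \<open>1 - \<mu> * (2 * R - \<mu>) * \<nu> * (2 * R - \<nu>) / D^2\<close>. Both brackets are at
  least \<open>R\<close> and \<open>D \<le> R^2\<close>, which leaves
  \<open>1 - \<nu> * \<mu> / R^2\<close>; the square root halves the rate of the
  exponential.\<close>

lemma blaschke_factor_le:
  fixes \<nu> R :: real
  assumes \<nu>: "0 < \<nu>" and R: "R = 1 + \<nu>" and m: "0 < \<mu>" "\<mu> \<le> 1"
  shows "R * \<bar>\<nu> - \<mu>\<bar> / (R * \<mu> + R * \<nu> - \<mu> * \<nu>) \<le> exp (- (\<nu> / (2 * R\<^sup>2)) * \<mu>)"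
proof -
  define D where "D = R * \<mu> + R * \<nu> - \<mu> * \<nu>"
  have R0: "0 < R" using R \<nu> by simp
  have Deq: "D = \<mu> + R * \<nu>" by (simp add: D_def R algebra_simps)
  have D0: "0 < D" using m \<nu> R0 by (simp add: Deq add_pos_pos)
  have DR: "D \<le> R\<^sup>2" using m \<nu> unfolding Deq R by (simp add: power2_eq_square algebra_simps)
  have "(R * \<bar>\<nu> - \<mu>\<bar>)\<^sup>2 = D\<^sup>2 - \<mu> * (2 * R - \<mu>) * \<nu> * (2 * R - \<nu>)"
    unfolding D_def power_mult_distrib power2_abs by algebra
  moreover have "\<mu> * R * \<nu> * R \<le> \<mu> * (2 * R - \<mu>) * \<nu> * (2 * R - \<nu>)"
    using m \<nu> R R0 by (intro mult_mono) auto
  moreover have "\<mu> * R * \<nu> * R = \<mu> * \<nu> * R\<^sup>2" by (simp add: power2_eq_square)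
  ultimately have "(R * \<bar>\<nu> - \<mu>\<bar>)\<^sup>2 \<le> D\<^sup>2 - \<mu> * \<nu> * R\<^sup>2" by linarith
  then have "(R * \<bar>\<nu> - \<mu>\<bar> / D)\<^sup>2 \<le> 1 - \<mu> * \<nu> * R\<^sup>2 / D\<^sup>2"
    using D0 by (simp add: power_divide field_simps)
  also have "\<dots> \<le> 1 - \<mu> * \<nu> * R\<^sup>2 / (R\<^sup>2)\<^sup>2"
    using D0 DR m \<nu> R0 by (intro diff_left_mono divide_left_mono mult_nonneg_nonneg power_mono mult_pos_pos) auto
  also have "\<dots> = 1 + - (\<nu> / R\<^sup>2) * \<mu>" using R0 by (simp add: power2_eq_square)
  also have "\<dots> \<le> exp (- (\<nu> / R\<^sup>2) * \<mu>)" using exp_ge_add_one_self .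
  also have "\<dots> = (exp (- (\<nu> / (2 * R\<^sup>2)) * \<mu>))\<^sup>2" by (simp flip: exp_double add: field_simps)
  finally show ?thesis unfolding D_def[symmetric] by (rule power2_le_imp_le) simp
qed

section \<open>The full Muntz theorem\<close>

text \<open>In the variable \<open>t = - ln x\<close> this is \<open>x powr (- 1 / p) / (1 + t)\<^sup>2\<close>, so a bound
  \<open>D / (1 + t)\<^sup>2\<close> on an exponential sum becomes a bound by \<open>D * log_envelope p\<close>.\<close>
definition log_envelope :: "real \<Rightarrow> real \<Rightarrow> real" where
  "log_envelope p x = x powr (- 1 / p) / (1 - ln x)\<^sup>2"

text \<open>On (0, 1] the \<open>p\<close>-th power of the envelope is at most
  \<open>1 / (x * (1 - ln x)^2)\<close>, the derivative of \<open>1 / (1 - ln x)\<close>, which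
  stays bounded and tends to 0 at 0.\<close>

lemma in_Lp_log_envelope:
  assumes p: "1 \<le> p" shows "in_Lp p (log_envelope p)"
proof -
  \<comment> \<open>The value 0 at 0 is the limit from the right; it makes \<open>G\<close>
    continuous on the closed interval, so the fundamental theorem applies with derivatives in the
    interior only.\<close>
  define G where "G x = (if x \<le> 0 then 0 else inverse (1 - ln x))" for x :: real
  define G' where "G' x = (if x \<le> 0 then 0 else inverse x * (inverse (1 - ln x))\<^sup>2)" for x :: real
  have "continuous_on {0..1} G"
  proof (rule continuous_on_IccI)
    have "filterlim (\<lambda>x::real. - ln x) at_top (at_right 0)"
      using ln_at_0 by (simp add: filterlim_uminus_at_top)
    then have "filterlim (\<lambda>x::real. 1 + - ln x) at_top (at_right 0)"
      by (intro filterlim_tendsto_add_at_top[OF tendsto_const]) simp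
    then have "((\<lambda>x::real. inverse (1 - ln x)) \<longlongrightarrow> 0) (at_right 0)"
      using tendsto_inverse_0_at_top[of "\<lambda>x::real. 1 - ln x"] by simp
    moreover have "eventually (\<lambda>x. inverse (1 - ln x) = G x) (at_right 0)"
      unfolding eventually_at_right_field by (auto simp: G_def intro!: exI[of _ 1])
    ultimately show "(G \<longlongrightarrow> G 0) (at_right 0)"
      by (simp add: G_def[of 0] Lim_transform_eventually)
    have cont: "isCont G x" if "0 < x" "x \<le> 1" for x
    proof -
      have "isCont (\<lambda>x. inverse (1 - ln x)) x" using that ln_le_zero_iff[of x] by (intro continuous_intros) linarith+
      moreover have "eventually (\<lambda>x. inverse (1 - ln x) = G x) (nhds x)"
        using eventually_nhds_in_open[of "{0<..}" x] that by (auto simp: G_def elim!: eventually_mono)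
      ultimately show ?thesis using isCont_cong by fast
    qed
    show "(G \<longlongrightarrow> G 1) (at_left 1)"
      using cont[of 1] by (simp add: isCont_def filterlim_at_split)
    show "G \<midarrow>x\<rightarrow> G x" if "0 < x" "x < 1" for x
      using cont[of x] that by (simp add: isCont_def)
  qed simp
  moreover have "(G has_vector_derivative G' x) (at x)" if "x \<in> {0<..<1}" for x
  proof -
    have "ln x < 0" using that by simp
    then have "1 - ln x \<noteq> 0" by linarith
    then have "((\<lambda>x. inverse (1 - ln x)) has_real_derivative G' x) (at x)"
      using that by (auto intro!: derivative_eq_intros simp: G'_def power2_eq_square divide_inverse)
    then have "(G has_real_derivative G' x) (at x)"
      by (rule has_field_derivative_transform_within_open[of _ _ _ "{0<..}"]) (use that in \<open>auto simp: G_def\<close>)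
    then show ?thesis by (simp add: has_real_derivative_iff_has_vector_derivative)
  qed
  ultimately have "(G' has_integral (G 1 - G 0)) {0..1}"
    by (intro fundamental_theorem_of_calculus_interior) auto
  then have int: "(\<integral>\<^sup>+x. ennreal (indicator {0..1} x * G' x) \<partial>lborel) = ennreal (G 1 - G 0)"
    by (rule nn_integral_has_integral_lebesgue[rotated]) (simp add: G'_def)
  have meas: "log_envelope p \<in> borel_measurable borel"
    unfolding log_envelope_def by measurable
  have "(\<integral>\<^sup>+x. ennreal (\<bar>log_envelope p x\<bar> powr p) \<partial>I01) = (\<integral>\<^sup>+x. ennreal (\<bar>log_envelope p x\<bar> powr p) * indicator {0..1} x \<partial>lborel)"
    by (simp add: nn_integral_restrict_space nn_integral_completion)
  also have "\<dots> \<le> (\<integral>\<^sup>+x. ennreal (indicator {0..1} x * G' x) \<partial>lborel)"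
  proof (rule nn_integral_mono)
    fix x :: real
    have "\<bar>log_envelope p x\<bar> powr p \<le> G' x" if x: "0 \<le> x" "x \<le> 1"
    proof (cases "x = 0")
      case False
      then have ln: "1 \<le> 1 - ln x" using x by simp
      have "\<bar>log_envelope p x\<bar> powr p = x powr (-1) / ((1 - ln x)\<^sup>2) powr p"
        using x p False by (simp add: log_envelope_def powr_divide powr_powr)
      \<comment> \<open>Here \<open>1 \<le> p\<close> enters: since \<open>1 - ln x \<ge> 1\<close>,
        lowering the exponent of the denominator enlarges the quotient.\<close>
      also have "\<dots> \<le> x powr (-1) / ((1 - ln x)\<^sup>2) powr 1"
        using p ln by (intro divide_left_mono powr_mono mult_pos_pos) (auto intro: one_le_power)
      also have "\<dots> = G' x" using x ln False by (simp add: G'_def powr_minus power_inverse divide_inverse)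
      finally show ?thesis .
    qed (use p in \<open>simp add: log_envelope_def G'_def\<close>)
    then show "ennreal (\<bar>log_envelope p x\<bar> powr p) * indicator {0..1} x \<le> ennreal (indicator {0..1} x * G' x)"
      by (auto simp: indicator_def intro: ennreal_leI)
  qed
  finally have "(\<integral>\<^sup>+x. ennreal (\<bar>log_envelope p x\<bar> powr p) \<partial>I01) < \<infinity>"
    unfolding int by (auto intro: le_less_trans)
  then show ?thesis
    using meas unfolding in_Lp_def
    by (auto intro!: integrableI_bounded measurable_restrict_space1 measurable_completion)
qed

section \<open>Passing from pointwise bounds in \<open>t = - ln x\<close> to norms in
  \<open>x\<close>\<close>

lemma AE_I01_pos: "AE x in I01. 0 < x \<and> x \<le> 1"
proof -
  have "AE x in lebesgue. x \<noteq> (0::real)" by (rule AE_completion) (rule AE_lborel_singleton)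
  then show ?thesis by (subst AE_restrict_space_iff) (auto elim!: eventually_mono)
qed

lemma borel_measurable_I01:
  "f \<in> borel_measurable borel \<Longrightarrow> f \<in> borel_measurable I01"
  by (intro measurable_restrict_space1 measurable_completion) simp

lemma powr_eq_exp_ln:
  fixes x :: real assumes "0 < x"
  shows "x powr (\<mu> - 1 / p) = x powr (- 1 / p) * exp (- \<mu> * (- ln x))"
  using assms by (simp add: powr_def left_diff_distrib exp_diff exp_minus field_simps)

lemma Lp_norm_le_log_envelope:
  assumes p: "1 \<le> p" and f: "f \<in> borel_measurable I01"
    and le: "\<And>x. 0 < x \<Longrightarrow> x \<le> 1 \<Longrightarrow> \<bar>f x\<bar> \<le> D * log_envelope p x"
  shows "in_Lp p f" "Lp_norm p f \<le> \<bar>D\<bar> * Lp_norm p (log_envelope p)"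
proof -
  have "AE x in I01. \<bar>f x\<bar> \<le> \<bar>D * log_envelope p x\<bar>"
    using AE_I01_pos by (rule AE_mp) (auto intro!: AE_I2 dest!: le)
  with in_Lp_cmult[OF p in_Lp_log_envelope[OF p], of D] f
  show "in_Lp p f" "Lp_norm p f \<le> \<bar>D\<bar> * Lp_norm p (log_envelope p)"
    using in_Lp_mono[OF p] Lp_norm_mono[OF p] Lp_norm_cmult[OF p, of D "log_envelope p"] by metis+
qed

lemma in_Lp_powr:
  assumes p: "1 \<le> p" and m: "0 < \<mu>"
  shows "in_Lp p (\<lambda>x. x powr (\<mu> - 1 / p))"
proof (rule Lp_norm_le_log_envelope(1)[OF p, where D = "2 + 4 / \<mu>\<^sup>2"])
  fix x :: real assume x: "0 < x" "x \<le> 1"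
  define t where "t = - ln x"
  have t: "0 \<le> t" using x by (simp add: t_def)
  have "exp (- \<mu> * t) \<le> (2 + 4 / \<mu>\<^sup>2) / (1 + t)\<^sup>2"
    using exp_le_inverse_square[OF m t] .
  then have "x powr (- 1 / p) * exp (- \<mu> * t) \<le> x powr (- 1 / p) * ((2 + 4 / \<mu>\<^sup>2) / (1 + t)\<^sup>2)"
    by (rule mult_left_mono) simp
  then show "\<bar>x powr (\<mu> - 1 / p)\<bar> \<le> (2 + 4 / \<mu>\<^sup>2) * log_envelope p x"
    using x by (simp add: powr_eq_exp_ln log_envelope_def t_def mult.commute)
qed (intro borel_measurable_I01, measurable)

lemma Lp_norm_exp_sum:
  assumes p: "1 \<le> p"
    and le: "\<And>t. 0 \<le> t \<Longrightarrow> \<bar>exp (- \<nu> * t) - (\<Sum>\<mu>\<in>F. k \<mu> * exp (- \<mu> * t))\<bar> \<le> D / (1 + t)\<^sup>2"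
  shows "Lp_norm p (\<lambda>x. x powr (\<nu> - 1 / p) - (\<Sum>\<mu>\<in>F. k \<mu> * x powr (\<mu> - 1 / p))) \<le> \<bar>D\<bar> * Lp_norm p (log_envelope p)"
proof (rule Lp_norm_le_log_envelope(2)[OF p])
  fix x :: real assume x: "0 < x" "x \<le> 1"
  have "x powr (\<nu> - 1 / p) - (\<Sum>\<mu>\<in>F. k \<mu> * x powr (\<mu> - 1 / p))
    = x powr (- 1 / p) * (exp (- \<nu> * (- ln x)) - (\<Sum>\<mu>\<in>F. k \<mu> * exp (- \<mu> * (- ln x))))"
    unfolding powr_eq_exp_ln[OF x(1)] right_diff_distrib sum_distrib_left by (simp only: mult.left_commute)
  then have "\<bar>x powr (\<nu> - 1 / p) - (\<Sum>\<mu>\<in>F. k \<mu> * x powr (\<mu> - 1 / p))\<bar>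
    = x powr (- 1 / p) * \<bar>exp (- \<nu> * (- ln x)) - (\<Sum>\<mu>\<in>F. k \<mu> * exp (- \<mu> * (- ln x)))\<bar>"
    by (simp add: abs_mult)
  also have "\<dots> \<le> x powr (- 1 / p) * (D / (1 + - ln x)\<^sup>2)"
    using x by (intro mult_left_mono le) auto
  finally show "\<bar>x powr (\<nu> - 1 / p) - (\<Sum>\<mu>\<in>F. k \<mu> * x powr (\<mu> - 1 / p))\<bar> \<le> D * log_envelope p x"
    by (simp add: log_envelope_def mult_ac)
qed (intro borel_measurable_I01, measurable)

text \<open>The closed span of the powers, indexed by \<open>\<mu> = \<lambda> + 1 / p\<close>. As a
  set of functions it allows approximability to be shown for one power at a time and then
  chained.\<close>

definition Muntz_closure :: "real \<Rightarrow> real set \<Rightarrow> (real \<Rightarrow> real) set" where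
  "Muntz_closure p M = {g. in_Lp p g \<and> (\<forall>e>0. \<exists>F k. finite F \<and> F \<subseteq> M \<and>
     Lp_norm p (\<lambda>x. g x - (\<Sum>\<mu>\<in>F. k \<mu> * x powr (\<mu> - 1 / p))) < e)}"

lemma in_Lp_powr_sum:
  assumes "1 \<le> p" "F \<subseteq> {0<..}"
  shows "in_Lp p (\<lambda>x. \<Sum>\<mu>\<in>F. k \<mu> * x powr (\<mu> - 1 / p))"
  using assms by (intro in_Lp_sum in_Lp_cmult in_Lp_powr) auto

context
  fixes p :: real and M :: "real set"
  assumes p: "1 \<le> p" and M: "M \<subseteq> {0<..}"
begin

lemma Muntz_closure_base:
  assumes "\<mu> \<in> M" shows "(\<lambda>x. x powr (\<mu> - 1 / p)) \<in> Muntz_closure p M"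
proof -
  have "Lp_norm p (\<lambda>x. x powr (\<mu> - 1 / p) - (\<Sum>\<mu>\<in>{\<mu>}. 1 * x powr (\<mu> - 1 / p))) = 0"
    using Lp_norm_0[OF p] by simp
  moreover have "in_Lp p (\<lambda>x. x powr (\<mu> - 1 / p))" using assms M by (intro in_Lp_powr[OF p]) auto
  ultimately show ?thesis unfolding Muntz_closure_def
    using assms by (auto intro!: exI[of _ "{\<mu>}"] exI[of _ "\<lambda>_. 1"])
qed

lemma Muntz_closure_add:
  assumes "f \<in> Muntz_closure p M" "g \<in> Muntz_closure p M"
  shows "(\<lambda>x. f x + g x) \<in> Muntz_closure p M"
  unfolding Muntz_closure_def mem_Collect_eq
proof (intro conjI allI impI)
  have fg: "in_Lp p f" "in_Lp p g" using assms by (auto simp: Muntz_closure_def)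
  show "in_Lp p (\<lambda>x. f x + g x)" using in_Lp_add[OF p fg] .
  fix e :: real assume "0 < e"
  then obtain F k H l where F: "finite F" "F \<subseteq> M" and H: "finite H" "H \<subseteq> M"
    and nF: "Lp_norm p (\<lambda>x. f x - (\<Sum>\<mu>\<in>F. k \<mu> * x powr (\<mu> - 1 / p))) < e/2"
    and nH: "Lp_norm p (\<lambda>x. g x - (\<Sum>\<mu>\<in>H. l \<mu> * x powr (\<mu> - 1 / p))) < e/2"
    using assms half_gt_zero[of e] unfolding Muntz_closure_def by blast
  define c where "c \<mu> = (if \<mu> \<in> F then k \<mu> else 0) + (if \<mu> \<in> H then l \<mu> else 0)" for \<mu>
  have "(\<Sum>\<mu>\<in>F \<union> H. c \<mu> * x powr (\<mu> - 1 / p)) = (\<Sum>\<mu>\<in>F. k \<mu> * x powr (\<mu> - 1 / p)) + (\<Sum>\<mu>\<in>H. l \<mu> * x powr (\<mu> - 1 / p))" for x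
  proof -
    have "(\<Sum>\<mu>\<in>F. k \<mu> * x powr (\<mu> - 1 / p)) = (\<Sum>\<mu>\<in>F \<union> H. (if \<mu> \<in> F then k \<mu> else 0) * x powr (\<mu> - 1 / p))"
      using F H by (intro sum.mono_neutral_cong_left) auto
    moreover have "(\<Sum>\<mu>\<in>H. l \<mu> * x powr (\<mu> - 1 / p)) = (\<Sum>\<mu>\<in>F \<union> H. (if \<mu> \<in> H then l \<mu> else 0) * x powr (\<mu> - 1 / p))"
      using F H by (intro sum.mono_neutral_cong_left) auto
    ultimately show ?thesis by (simp add: c_def distrib_right sum.distrib)
  qed
  then have "(\<lambda>x. f x + g x - (\<Sum>\<mu>\<in>F \<union> H. c \<mu> * x powr (\<mu> - 1 / p)))
    = (\<lambda>x. (f x - (\<Sum>\<mu>\<in>F. k \<mu> * x powr (\<mu> - 1 / p))) + (g x - (\<Sum>\<mu>\<in>H. l \<mu> * x powr (\<mu> - 1 / p))))" by auto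
  moreover have "Lp_norm p \<dots> < e"
  proof -
    have "F \<subseteq> {0<..}" "H \<subseteq> {0<..}" using F H M by auto
    with fg Lp_norm_triangle[OF p in_Lp_diff[OF p fg(1) in_Lp_powr_sum[OF p]] in_Lp_diff[OF p fg(2) in_Lp_powr_sum[OF p]], of F H k l]
    show ?thesis using nF nH by linarith
  qed
  ultimately show "\<exists>F k. finite F \<and> F \<subseteq> M \<and> Lp_norm p (\<lambda>x. f x + g x - (\<Sum>\<mu>\<in>F. k \<mu> * x powr (\<mu> - 1 / p))) < e"
    using F H by (intro exI[of _ "F \<union> H"] exI[of _ c]) auto
qed

lemma Muntz_closure_cmult:
  assumes "f \<in> Muntz_closure p M" shows "(\<lambda>x. c * f x) \<in> Muntz_closure p M"
  unfolding Muntz_closure_def mem_Collect_eq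
proof (intro conjI allI impI)
  have f: "in_Lp p f" using assms by (auto simp: Muntz_closure_def)
  show "in_Lp p (\<lambda>x. c * f x)" using in_Lp_cmult[OF p f] .
  fix e :: real assume "0 < e"
  then have "0 < e / (\<bar>c\<bar> + 1)" by (auto intro!: divide_pos_pos)
  then obtain F k where F: "finite F" "F \<subseteq> M"
    and nF: "Lp_norm p (\<lambda>x. f x - (\<Sum>\<mu>\<in>F. k \<mu> * x powr (\<mu> - 1 / p))) < e / (\<bar>c\<bar> + 1)"
    using assms unfolding Muntz_closure_def by blast
  have "Lp_norm p (\<lambda>x. c * f x - (\<Sum>\<mu>\<in>F. c * k \<mu> * x powr (\<mu> - 1 / p)))
      = \<bar>c\<bar> * Lp_norm p (\<lambda>x. f x - (\<Sum>\<mu>\<in>F. k \<mu> * x powr (\<mu> - 1 / p)))"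
    by (subst Lp_norm_cmult[OF p, symmetric]) (simp add: right_diff_distrib sum_distrib_left mult.assoc)
  also have "\<dots> \<le> \<bar>c\<bar> * (e / (\<bar>c\<bar> + 1))" using nF by (intro mult_left_mono) auto
  also have "\<dots> < e" using \<open>0 < e\<close> by (simp add: field_simps add_pos_nonneg)
  finally show "\<exists>F k. finite F \<and> F \<subseteq> M \<and> Lp_norm p (\<lambda>x. c * f x - (\<Sum>\<mu>\<in>F. k \<mu> * x powr (\<mu> - 1 / p))) < e"
    using F by (intro exI[of _ F] exI[of _ "\<lambda>\<mu>. c * k \<mu>"]) auto
qed

lemma Muntz_closure_sum:
  assumes "finite A" "\<And>i. i \<in> A \<Longrightarrow> f i \<in> Muntz_closure p M"
  shows "(\<lambda>x. \<Sum>i\<in>A. c i * f i x) \<in> Muntz_closure p M"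
  using assms
proof (induction A rule: finite_induct)
  case empty
  have "Lp_norm p (\<lambda>x. 0 - (\<Sum>\<mu>\<in>{}. 0 * x powr (\<mu> - 1 / p))) = 0" using Lp_norm_0[OF p] by simp
  then show ?case by (auto simp: Muntz_closure_def in_Lp_0 intro!: exI[of _ "{}"])
next
  case (insert a A)
  then show ?case
    using Muntz_closure_add[OF Muntz_closure_cmult[of "f a" "c a"], of "\<lambda>x. \<Sum>i\<in>A. c i * f i x"] by simp
qed

lemma Muntz_closure_closed:
  assumes g: "in_Lp p g" and ap: "\<And>e. 0 < e \<Longrightarrow> \<exists>h \<in> Muntz_closure p M. Lp_norm p (\<lambda>x. g x - h x) < e"
  shows "g \<in> Muntz_closure p M"
  unfolding Muntz_closure_def mem_Collect_eq
proof (intro conjI allI impI g)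
  fix e :: real assume "0 < e"
  then obtain h where h: "h \<in> Muntz_closure p M" "Lp_norm p (\<lambda>x. g x - h x) < e/2" using ap[of "e/2"] by auto
  then obtain F k where F: "finite F" "F \<subseteq> M"
    and nF: "Lp_norm p (\<lambda>x. h x - (\<Sum>\<mu>\<in>F. k \<mu> * x powr (\<mu> - 1 / p))) < e/2"
    using \<open>0 < e\<close> half_gt_zero[of e] unfolding Muntz_closure_def by blast
  have "in_Lp p h" using h by (simp add: Muntz_closure_def)
  moreover have "F \<subseteq> {0<..}" using F M by auto
  ultimately have "Lp_norm p (\<lambda>x. g x - (\<Sum>\<mu>\<in>F. k \<mu> * x powr (\<mu> - 1 / p))) < e"
    using Lp_norm_diff_trans[OF p g _ in_Lp_powr_sum[OF p], of h F k] h(2) nF by linarith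
  then show "\<exists>F k. finite F \<and> F \<subseteq> M \<and> Lp_norm p (\<lambda>x. g x - (\<Sum>\<mu>\<in>F. k \<mu> * x powr (\<mu> - 1 / p))) < e"
    using F by blast
qed

text \<open>Transitivity of approximation: exponents that are themselves only approximable from
  \<open>M\<close> may serve as new nodes. This is what joins the two regimes of exponents.\<close>

lemma Muntz_closure_subset:
  assumes M': "M' \<subseteq> {\<nu>. (\<lambda>x. x powr (\<nu> - 1 / p)) \<in> Muntz_closure p M}"
  shows "Muntz_closure p M' \<subseteq> Muntz_closure p M"
proof
  fix g assume g: "g \<in> Muntz_closure p M'"
  show "g \<in> Muntz_closure p M"
  proof (rule Muntz_closure_closed)
    show "in_Lp p g" using g by (simp add: Muntz_closure_def)
    fix e :: real assume "0 < e"
    then obtain F k where F: "finite F" "F \<subseteq> M'" "Lp_norm p (\<lambda>x. g x - (\<Sum>\<mu>\<in>F. k \<mu> * x powr (\<mu> - 1 / p))) < e"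
      using g unfolding Muntz_closure_def by blast
    then show "\<exists>h \<in> Muntz_closure p M. Lp_norm p (\<lambda>x. g x - h x) < e"
      using M' by (intro bexI[of _ "\<lambda>x. \<Sum>\<mu>\<in>F. k \<mu> * x powr (\<mu> - 1 / p)"] Muntz_closure_sum) auto
  qed
qed

end

lemma exp_prod_sum: "finite F \<Longrightarrow> (\<Prod>\<mu>\<in>F. exp (c * f \<mu>)) = exp (c * (\<Sum>\<mu>\<in>F. f \<mu>))" for c :: real
  by (simp add: exp_sum sum_distrib_left)

text \<open>Turns divergence of a nonnegative series into smallness of a product bound: the partial
  sums exceed every threshold.\<close>

lemma exists_small_exp:
  fixes C \<kappa> e :: real and P :: "nat \<Rightarrow> bool"
  assumes ns: "\<not> summable (\<lambda>i. if P i then f i else 0)" and nonneg: "\<And>i. P i \<Longrightarrow> 0 \<le> f i"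
    and \<kappa>: "0 < \<kappa>" and e: "0 < e"
  shows "\<exists>n. C * exp (- \<kappa> * (\<Sum>i\<in>{i. i < n \<and> P i}. f i)) < e"
proof -
  have eq: "(\<Sum>i<n. if P i then f i else 0) = (\<Sum>i\<in>{i. i < n \<and> P i}. f i)" for n
    by (subst sum.inter_filter[symmetric]) (auto intro!: sum.cong)
  \<comment> \<open>Chosen so that \<open>exp (- \<kappa> * B) = e / (\<bar>C\<bar> + 1)\<close>;
    the added 1 covers \<open>C = 0\<close>.\<close>
  define B where "B = ln ((\<bar>C\<bar> + 1) / e) / \<kappa>"
  have "\<exists>n. B < (\<Sum>i<n. if P i then f i else 0)"
  proof (rule ccontr)
    assume "\<not> ?thesis"
    then have "summable (\<lambda>i. if P i then f i else 0)"
      using nonneg by (intro summableI_nonneg_bounded[where x = B]) (auto simp: not_less)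
    with ns show False by simp
  qed
  then obtain n where n: "B < (\<Sum>i\<in>{i. i < n \<and> P i}. f i)" unfolding eq by blast
  have "- \<kappa> * (\<Sum>i\<in>{i. i < n \<and> P i}. f i) < - \<kappa> * B" using n \<kappa> by simp
  then have "exp (- \<kappa> * (\<Sum>i\<in>{i. i < n \<and> P i}. f i)) < exp (- \<kappa> * B)" by simp
  also have "exp (- \<kappa> * B) = e / (\<bar>C\<bar> + 1)" using \<kappa> e by (simp add: B_def exp_minus)
  finally have "(\<bar>C\<bar> + 1) * exp (- \<kappa> * (\<Sum>i\<in>{i. i < n \<and> P i}. f i)) < e" by (simp add: pos_less_divide_eq mult.commute)
  moreover have "C * exp (- \<kappa> * (\<Sum>i\<in>{i. i < n \<and> P i}. f i)) \<le> (\<bar>C\<bar> + 1) * exp (- \<kappa> * (\<Sum>i\<in>{i. i < n \<and> P i}. f i))"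
    by (intro mult_right_mono) auto
  ultimately show ?thesis by (intro exI[of _ n]) linarith
qed

text \<open>The Blaschke product over the exponents at most 1 is bounded by \<open>exp\<close> of
  \<open>- \<kappa>\<close> times their sum, so divergence drives the error to 0. The target may be
  any positive \<open>\<nu>\<close>, below or above the nodes.\<close>

lemma Muntz_closure_small_exponents:
  assumes p: "1 \<le> p" and pos: "\<And>i. 0 < \<mu> i" and inj: "inj \<mu>"
    and ns: "\<not> summable (\<lambda>i. if \<mu> i \<le> 1 then \<mu> i else 0)" and \<nu>: "0 < \<nu>"
  shows "(\<lambda>x. x powr (\<nu> - 1 / p)) \<in> Muntz_closure p (range \<mu>)"
proof (cases "\<nu> \<in> range \<mu>")
  case True
  then show ?thesis using pos by (intro Muntz_closure_base[OF p]) auto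
next
  case False
  define R where "R = 1 + \<nu>"
  define C where "C = 4 * R ^ 3 * (8 * R\<^sup>2 + 4) / \<nu> ^ 5"
  define \<kappa> where "\<kappa> = \<nu> / (2 * R\<^sup>2)"
  have C: "0 \<le> C" "0 < \<kappa>" using \<nu> by (auto simp: C_def R_def \<kappa>_def)
  have "\<exists>F k. finite F \<and> F \<subseteq> range \<mu> \<and> Lp_norm p (\<lambda>x. x powr (\<nu> - 1 / p) - (\<Sum>\<mu>\<in>F. k \<mu> * x powr (\<mu> - 1 / p))) < e"
    if e: "0 < e" for e
  proof -
    obtain n where n: "C * Lp_norm p (log_envelope p) * exp (- \<kappa> * (\<Sum>i\<in>{i. i < n \<and> \<mu> i \<le> 1}. \<mu> i)) < e"
      using exists_small_exp[of "\<lambda>i. \<mu> i \<le> 1" \<mu> \<kappa> e "C * Lp_norm p (log_envelope p)"] ns less_imp_le[OF pos] C e by force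
    define F where "F = \<mu> ` {i. i < n \<and> \<mu> i \<le> 1}"
    have sF: "(\<Sum>\<mu>\<in>F. \<mu>) = (\<Sum>i\<in>{i. i < n \<and> \<mu> i \<le> 1}. \<mu> i)"
      unfolding F_def by (subst sum.reindex) (auto intro: inj_on_subset[OF inj])
    have F: "finite F" "F \<subseteq> range \<mu>" "\<And>\<mu>. \<mu> \<in> F \<Longrightarrow> 0 < \<mu> \<and> \<mu> \<le> 1" "\<nu> \<notin> F"
      using pos False by (auto simp: F_def)
    from exp_sum_approx_small[OF F(1,3) \<nu> F(4) R_def]
    obtain k where k: "\<And>t. 0 \<le> t \<Longrightarrow> \<bar>exp (- \<nu> * t) - (\<Sum>\<mu>\<in>F. k \<mu> * exp (- \<mu> * t))\<bar>
       \<le> C * (\<Prod>\<mu>\<in>F. R * \<bar>\<nu> - \<mu>\<bar> / (R * \<mu> + R * \<nu> - \<mu> * \<nu>)) / (1 + t)\<^sup>2"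
      unfolding C_def by blast
    define B where "B = (\<Prod>\<mu>\<in>F. R * \<bar>\<nu> - \<mu>\<bar> / (R * \<mu> + R * \<nu> - \<mu> * \<nu>))"
    have den: "0 \<le> R * \<mu> + R * \<nu> - \<mu> * \<nu>" if "\<mu> \<in> F" for \<mu>
      using F(3)[OF that] \<nu> by (simp add: R_def algebra_simps)
    have "0 \<le> B" unfolding B_def using den \<nu> by (intro prod_nonneg divide_nonneg_nonneg) (auto simp: R_def)
    have "B \<le> (\<Prod>\<mu>\<in>F. exp (- \<kappa> * \<mu>))"
      unfolding B_def using blaschke_factor_le[OF \<nu> R_def] F(3) den \<nu>
      by (intro prod_mono conjI divide_nonneg_nonneg) (auto simp: R_def \<kappa>_def)
    also have "\<dots> = exp (- \<kappa> * (\<Sum>\<mu>\<in>F. \<mu>))" using exp_prod_sum[OF F(1), of "- \<kappa>" "\<lambda>x. x"] by simp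
    finally have B: "B \<le> exp (- \<kappa> * (\<Sum>\<mu>\<in>F. \<mu>))" .
    have "Lp_norm p (\<lambda>x. x powr (\<nu> - 1 / p) - (\<Sum>\<mu>\<in>F. k \<mu> * x powr (\<mu> - 1 / p))) \<le> \<bar>C * B\<bar> * Lp_norm p (log_envelope p)"
      by (rule Lp_norm_exp_sum[OF p]) (use k in \<open>simp add: B_def\<close>)
    also have "\<dots> = C * Lp_norm p (log_envelope p) * B" using C \<open>0 \<le> B\<close> by simp
    also have "\<dots> \<le> C * Lp_norm p (log_envelope p) * exp (- \<kappa> * (\<Sum>\<mu>\<in>F. \<mu>))"
      using B C by (intro mult_left_mono mult_nonneg_nonneg) (auto simp: Lp_norm_nonneg)
    finally show ?thesis using n F(1,2) unfolding sF by (intro exI[of _ F] exI[of _ k]) auto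
  qed
  then show ?thesis using in_Lp_powr[OF p \<nu>] by (simp add: Muntz_closure_def)
qed

text \<open>\<open>\<nu> < 1\<close> puts the target below every node greater than 1, as
  \<open>exp_sum_approx_large\<close> demands. Each factor equals
  \<open>1 - (\<nu> - c) / (\<mu> - c)\<close> and is at most
  \<open>exp (- (\<nu> - c) / \<mu>)\<close>, so divergence of the sum of \<open>1 / \<mu>\<close>
  makes the product small.\<close>

lemma Muntz_closure_large_exponents:
  assumes p: "1 \<le> p" and pos: "\<And>i. 0 < \<mu> i" and inj: "inj \<mu>"
    and ns: "\<not> summable (\<lambda>i. if 1 < \<mu> i then 1 / \<mu> i else 0)" and \<nu>: "0 < \<nu>" "\<nu> < 1"
  shows "(\<lambda>x. x powr (\<nu> - 1 / p)) \<in> Muntz_closure p (range \<mu>)"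
proof -
  \<comment> \<open>Any value strictly between 0 and \<open>\<nu>\<close> would do:
    \<open>c > 0\<close> keeps the error integrable, \<open>c < \<nu>\<close> makes the product
    small.\<close>
  define c where "c = \<nu> / 2"
  have c: "0 < c" "c < \<nu>" using \<nu> by (auto simp: c_def)
  define C where "C = 2 + 4 / c\<^sup>2"
  have C: "0 \<le> C" by (simp add: C_def)
  have env: "exp (- c * t) \<le> C / (1 + t)\<^sup>2" if t: "0 \<le> t" for t
    using exp_le_inverse_square[OF c(1) t] unfolding C_def .
  have "\<exists>F k. finite F \<and> F \<subseteq> range \<mu> \<and> Lp_norm p (\<lambda>x. x powr (\<nu> - 1 / p) - (\<Sum>\<mu>\<in>F. k \<mu> * x powr (\<mu> - 1 / p))) < e"
    if e: "0 < e" for e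
  proof -
    obtain n where n: "C * Lp_norm p (log_envelope p) * exp (- (\<nu> - c) * (\<Sum>i\<in>{i. i < n \<and> 1 < \<mu> i}. 1 / \<mu> i)) < e"
      using exists_small_exp[of "\<lambda>i. 1 < \<mu> i" "\<lambda>i. 1 / \<mu> i" "\<nu> - c" e "C * Lp_norm p (log_envelope p)"] ns c e by force
    define F where "F = \<mu> ` {i. i < n \<and> 1 < \<mu> i}"
    have sF: "(\<Sum>\<mu>\<in>F. 1 / \<mu>) = (\<Sum>i\<in>{i. i < n \<and> 1 < \<mu> i}. 1 / \<mu> i)"
      unfolding F_def by (subst sum.reindex) (auto intro: inj_on_subset[OF inj])
    have F: "finite F" "F \<subseteq> range \<mu>" "\<And>\<mu>. \<mu> \<in> F \<Longrightarrow> \<nu> < \<mu>"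
      using \<nu> by (auto simp: F_def)
    from exp_sum_approx_large[OF F(1,3) c(2)]
    obtain k where k: "\<And>t. 0 \<le> t \<Longrightarrow> \<bar>exp (- \<nu> * t) - (\<Sum>\<mu>\<in>F. k \<mu> * exp (- \<mu> * t))\<bar>
       \<le> (\<Prod>\<mu>\<in>F. (\<mu> - \<nu>) / (\<mu> - c)) * exp (- c * t)" by blast
    define B where "B = (\<Prod>\<mu>\<in>F. (\<mu> - \<nu>) / (\<mu> - c))"
    have factor: "0 \<le> (\<mu> - \<nu>) / (\<mu> - c) \<and> (\<mu> - \<nu>) / (\<mu> - c) \<le> exp (- (\<nu> - c) * (1 / \<mu>))" if "\<mu> \<in> F" for \<mu>
    proof -
      have m: "\<nu> < \<mu>" using F(3)[OF that] .
      have "(\<mu> - \<nu>) / (\<mu> - c) = 1 - (\<nu> - c) / (\<mu> - c)" using m c by (simp add: field_simps)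
      also have "\<dots> \<le> 1 - (\<nu> - c) / \<mu>" using m c by (intro diff_left_mono divide_left_mono) auto
      also have "\<dots> \<le> exp (- (\<nu> - c) * (1 / \<mu>))" 
      proof -
        have "1 - (\<nu> - c) / \<mu> = 1 + - (\<nu> - c) * (1 / \<mu>)"
          using minus_divide_left[of "\<nu> - c" \<mu>] by simp
        then show ?thesis using exp_ge_add_one_self by (simp only:)
      qed
      finally show ?thesis using m c by auto
    qed
    have B0: "0 \<le> B" unfolding B_def using factor by (intro prod_nonneg) auto
    have "B \<le> (\<Prod>\<mu>\<in>F. exp (- (\<nu> - c) * (1 / \<mu>)))"
      unfolding B_def using factor by (intro prod_mono) auto
    also have "\<dots> = exp (- (\<nu> - c) * (\<Sum>\<mu>\<in>F. 1 / \<mu>))" using exp_prod_sum[OF F(1)] .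
    finally have B: "B \<le> exp (- (\<nu> - c) * (\<Sum>\<mu>\<in>F. 1 / \<mu>))" .
    have "Lp_norm p (\<lambda>x. x powr (\<nu> - 1 / p) - (\<Sum>\<mu>\<in>F. k \<mu> * x powr (\<mu> - 1 / p))) \<le> \<bar>C * B\<bar> * Lp_norm p (log_envelope p)"
    proof (rule Lp_norm_exp_sum[OF p])
      fix t :: real assume t: "0 \<le> t"
      have "B * exp (- c * t) \<le> B * (C / (1 + t)\<^sup>2)" using env[OF t] B0 by (rule mult_left_mono)
      with k[OF t] show "\<bar>exp (- \<nu> * t) - (\<Sum>\<mu>\<in>F. k \<mu> * exp (- \<mu> * t))\<bar> \<le> C * B / (1 + t)\<^sup>2"
        by (simp add: B_def mult_ac)
    qed
    also have "\<dots> = C * Lp_norm p (log_envelope p) * B" using C B0 by simp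
    also have "\<dots> \<le> C * Lp_norm p (log_envelope p) * exp (- (\<nu> - c) * (\<Sum>\<mu>\<in>F. 1 / \<mu>))"
      using B C by (intro mult_left_mono mult_nonneg_nonneg) (auto simp: Lp_norm_nonneg)
    finally show ?thesis using n F(1,2) unfolding sF by (intro exI[of _ F] exI[of _ k]) auto
  qed
  then show ?thesis using in_Lp_powr[OF p \<nu>(1)] by (simp add: Muntz_closure_def)
qed

theorem full_Muntz_Lp:
  assumes p: "1 \<le> p" and pos: "\<And>i. 0 < \<mu> i" and inj: "inj \<mu>"
    and ns: "\<not> summable (\<lambda>i. \<mu> i / ((\<mu> i)\<^sup>2 + 1))" and f: "in_Lp p f"
  shows "f \<in> Muntz_closure p (range \<mu>)"
proof -
  have M: "range \<mu> \<subseteq> {0<..}" using pos by auto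
  have powers: "(\<lambda>x. x powr (\<nu> - 1 / p)) \<in> Muntz_closure p (range \<mu>)" if \<nu>: "0 < \<nu>" for \<nu>
  proof (cases "summable (\<lambda>i. if \<mu> i \<le> 1 then \<mu> i else 0)")
    case False
    then show ?thesis using Muntz_closure_small_exponents[OF p pos inj _ \<nu>] by blast
  next
    case True
    have ns': "\<not> summable (\<lambda>i. if 1 < \<mu> i then 1 / \<mu> i else 0)"
    proof
      assume "summable (\<lambda>i. if 1 < \<mu> i then 1 / \<mu> i else 0)"
      with True have "summable (\<lambda>i. (if \<mu> i \<le> 1 then \<mu> i else 0) + (if 1 < \<mu> i then 1 / \<mu> i else 0))"
        by (rule summable_add)
      then have "summable (\<lambda>i. \<mu> i / ((\<mu> i)\<^sup>2 + 1))"
      proof (rule summable_comparison_test_ev[rotated], intro always_eventually allI)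
        fix i
        have m: "0 < \<mu> i" by (rule pos)
        have "\<mu> i / ((\<mu> i)\<^sup>2 + 1) \<le> \<mu> i / 1" using m by (intro divide_left_mono) (auto intro: add_pos_pos)
        moreover have "\<mu> i / ((\<mu> i)\<^sup>2 + 1) \<le> \<mu> i / (\<mu> i)\<^sup>2" using m by (intro divide_left_mono) (auto intro!: mult_pos_pos add_pos_pos)
        ultimately show "norm (\<mu> i / ((\<mu> i)\<^sup>2 + 1)) \<le> (if \<mu> i \<le> 1 then \<mu> i else 0) + (if 1 < \<mu> i then 1 / \<mu> i else 0)"
          using m by (auto simp: power2_eq_square)
      qed
      with ns show False by simp
    qed
    \<comment> \<open>The shift by 2 keeps all these exponents strictly below 1, within reach of the
      large nodes, while their sum remains a tail of the harmonic series.\<close>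
    define \<mu>' where "\<mu>' j = 1 / (real j + 2)" for j :: nat
    have \<mu>': "0 < \<mu>' j" "\<mu>' j < 1" for j by (auto simp: \<mu>'_def)
    have "inj \<mu>'" by (auto simp: inj_def \<mu>'_def field_simps)
    moreover have "\<not> summable (\<lambda>i. if \<mu>' i \<le> 1 then \<mu>' i else 0)"
    proof -
      have "\<not> summable (\<lambda>i. inverse (real (i + 2)))"
        using not_summable_harmonic[where ?'a = real] summable_iff_shift[of "\<lambda>i. inverse (real i)" 2] by (simp add: add_ac)
      moreover have "(\<lambda>i. if \<mu>' i \<le> 1 then \<mu>' i else 0) = (\<lambda>i. inverse (real (i + 2)))"
        using \<mu>'(2) by (auto simp: less_imp_le) (simp add: \<mu>'_def inverse_eq_divide add.commute)
      ultimately show ?thesis by simp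
    qed
    ultimately have "(\<lambda>x. x powr (\<nu> - 1 / p)) \<in> Muntz_closure p (range \<mu>')"
      by (rule Muntz_closure_small_exponents[OF p \<mu>'(1) _ _ \<nu>])
    moreover have "Muntz_closure p (range \<mu>') \<subseteq> Muntz_closure p (range \<mu>)"
      using Muntz_closure_large_exponents[OF p pos inj ns' \<mu>'] by (intro Muntz_closure_subset[OF p M]) auto
    ultimately show ?thesis by blast
  qed
  show ?thesis
  proof (rule Muntz_closure_closed[OF p M f])
    fix e :: real assume "0 < e"
    then obtain a d where ad: "Lp_norm p (\<lambda>x. f x - (\<Sum>k\<le>d::nat. a k * x ^ k)) < e"
      using polynomials_dense_Lp[OF p f] by blast
    \<comment> \<open>\<open>h\<close> agrees with the polynomial for positive \<open>x\<close>
      only: at 0 the constant term differs, since \<open>0 powr 0 = 0\<close> but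
      \<open>0 ^ 0 = 1\<close>.\<close>
    define h where "h x = (\<Sum>k\<le>d. a k * x powr ((real k + 1 / p) - 1 / p))" for x
    have eq: "AE x in I01. f x - h x = f x - (\<Sum>k\<le>d. a k * x ^ k)"
      using AE_I01_pos by (rule AE_mp) (auto intro!: AE_I2 simp: h_def powr_realpow)
    have hm: "h \<in> Muntz_closure p (range \<mu>)"
      unfolding h_def using p by (intro Muntz_closure_sum[OF p M] powers) (auto intro!: add_nonneg_pos)
    then have "in_Lp p (\<lambda>x. f x - h x)" using in_Lp_diff[OF p f] by (simp add: Muntz_closure_def)
    then have "(\<lambda>x. f x - h x) \<in> borel_measurable I01" by (rule in_Lp_measurable)
    moreover have "in_Lp p (\<lambda>x. f x - (\<Sum>k\<le>d. a k * x ^ k))"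
      by (intro in_Lp_diff[OF p f] continuous_in_Lp[OF p] continuous_intros)
    ultimately have "Lp_norm p (\<lambda>x. f x - h x) \<le> Lp_norm p (\<lambda>x. f x - (\<Sum>k\<le>d. a k * x ^ k))"
      using eq by (intro Lp_norm_mono[OF p]) auto
    with ad hm show "\<exists>h\<in>Muntz_closure p (range \<mu>). Lp_norm p (\<lambda>x. f x - h x) < e"
      by (intro bexI[of _ h]) auto
  qed
qed

section \<open>The integral MKZ operators\<close>

lemma sums_choose_power:
  fixes x :: real
  assumes "0 \<le> x" "x < 1"
  shows "(\<lambda>k. real ((k + m) choose k) * x ^ k * (1 - x) ^ Suc m) sums 1"
proof -
  have "(\<lambda>k. ((- real (Suc m)) gchoose k) * (- x) ^ k) sums (1 + - x) powr (- real (Suc m))"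
    using assms by (intro gen_binomial_real) auto
  also have "(\<lambda>k. ((- real (Suc m)) gchoose k) * (- x) ^ k) = (\<lambda>k. real ((k + m) choose k) * x ^ k)"
  proof
    fix k
    have "(- real (Suc m)) gchoose k = (- 1) ^ k * (real (k + m) gchoose k)"
      using gbinomial_minus[of "real (Suc m)" k] by (simp add: add_ac)
    moreover have "(- x) ^ k = (- 1) ^ k * x ^ k" by (simp flip: power_mult_distrib)
    ultimately show "((- real (Suc m)) gchoose k) * (- x) ^ k = real ((k + m) choose k) * x ^ k"
      by (simp add: binomial_gbinomial mult_ac flip: power_mult_distrib power_add)
  qed
  also have "(1 + - x) powr (- real (Suc m)) = inverse ((1 - x) ^ Suc m)"
    using assms by (simp add: powr_minus powr_realpow flip: of_nat_Suc)
  finally have "(\<lambda>k. real ((k + m) choose k) * x ^ k * (1 - x) ^ Suc m) sums (inverse ((1 - x) ^ Suc m) * (1 - x) ^ Suc m)"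
    by (rule sums_mult2)
  moreover have "(1 - x) ^ Suc m \<noteq> 0" using assms by simp
  ultimately show ?thesis using left_inverse[of "(1 - x) ^ Suc m"] by metis
qed

text \<open>The probability of \<open>k\<close> successes before failure number
  \<open>m + 1\<close>, with success probability \<open>x\<close>. The operator of index
  \<open>n\<close> uses \<open>m = n - 1\<close>.\<close>

definition neg_binom :: "nat \<Rightarrow> real \<Rightarrow> nat \<Rightarrow> real" where
  "neg_binom m x k = real ((k + m) choose k) * x ^ k * (1 - x) ^ Suc m"

lemma neg_binom_sums: "0 \<le> x \<Longrightarrow> x < 1 \<Longrightarrow> neg_binom m x sums 1"
  unfolding neg_binom_def by (rule sums_choose_power)

lemma neg_binom_nonneg: "0 \<le> x \<Longrightarrow> x \<le> 1 \<Longrightarrow> 0 \<le> neg_binom m x k"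
  by (simp add: neg_binom_def)

text \<open>Weighting by the count shifts the parameter from \<open>m\<close> to
  \<open>m + 1\<close>, so the factorial moments reduce to total mass.\<close>

lemma neg_binom_Suc:
  "real (Suc m) * x * neg_binom (Suc m) x k = real (Suc k) * (1 - x) * neg_binom m x (Suc k)"
proof -
  have "Suc k * ((Suc k + m) choose Suc k) = Suc m * ((k + Suc m) choose k)"
    using Suc_times_binomial_add[of k m] by (simp add: add_ac)
  then have "real (Suc k) * real ((Suc k + m) choose Suc k) = real (Suc m) * real ((k + Suc m) choose k)"
    by (metis of_nat_mult)
  then show ?thesis
    unfolding neg_binom_def by (simp add: mult_ac del: of_nat_Suc binomial_Suc_Suc)
qed

lemma neg_binom_first_moment_sums:
  assumes "0 \<le> x" "x < 1"
  shows "(\<lambda>k. real k * (1 - x) * neg_binom m x k) sums (real (Suc m) * x)"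
proof -
  have "(\<lambda>k. real (Suc m) * x * neg_binom (Suc m) x k) sums (real (Suc m) * x * 1)"
    by (intro sums_mult neg_binom_sums assms)
  also have "(\<lambda>k. real (Suc m) * x * neg_binom (Suc m) x k) = (\<lambda>k. real (Suc k) * (1 - x) * neg_binom m x (Suc k))"
    by (simp only: neg_binom_Suc)
  \<comment> \<open>The shifted series starts at index 1; the missing term at index 0 carries the
    factor 0.\<close>
  finally show ?thesis by (subst (asm) sums_Suc_iff) simp
qed

lemma neg_binom_second_moment_sums:
  assumes "0 \<le> x" "x < 1"
  shows "(\<lambda>k. real k * (real k - 1) * (1 - x)\<^sup>2 * neg_binom m x k) sums (real (Suc m) * (real (Suc m) + 1) * x\<^sup>2)"
proof -
  have "(\<lambda>k. real (Suc m) * x * (real k * (1 - x) * neg_binom (Suc m) x k)) sums (real (Suc m) * x * (real (Suc (Suc m)) * x))"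
    by (intro sums_mult neg_binom_first_moment_sums assms)
  also have "(\<lambda>k. real (Suc m) * x * (real k * (1 - x) * neg_binom (Suc m) x k))
     = (\<lambda>k. real (Suc k) * (real (Suc k) - 1) * (1 - x)\<^sup>2 * neg_binom m x (Suc k))"
  proof
    fix k
    have "(real (Suc m) * x * neg_binom (Suc m) x k) * (real k * (1 - x)) = (real (Suc k) * (1 - x) * neg_binom m x (Suc k)) * (real k * (1 - x))"
      by (simp only: neg_binom_Suc)
    then show "real (Suc m) * x * (real k * (1 - x) * neg_binom (Suc m) x k) = real (Suc k) * (real (Suc k) - 1) * (1 - x)\<^sup>2 * neg_binom m x (Suc k)"
      by (simp add: power2_eq_square mult_ac)
  qed
  finally show ?thesis by (subst (asm) sums_Suc_iff) (simp add: power2_eq_square mult_ac)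
qed

text \<open>With \<open>n = Suc m\<close> the count has mean \<open>n * x / (1 - x)\<close> and
  variance \<open>n * x / (1 - x)^2\<close>; multiplying the count by \<open>1 - x\<close> clears
  both denominators. The square is expanded in factorial moments.\<close>

lemma neg_binom_variance_sums:
  assumes "0 \<le> x" "x < 1"
  shows "(\<lambda>k. (real k * (1 - x) - real (Suc m) * x)\<^sup>2 * neg_binom m x k) sums (real (Suc m) * x)"
proof -
  let ?n = "real (Suc m)"
  have "(\<lambda>k. real k * (real k - 1) * (1 - x)\<^sup>2 * neg_binom m x k + (1 - x - 2 * ?n * x) * (real k * (1 - x) * neg_binom m x k) + ?n\<^sup>2 * x\<^sup>2 * neg_binom m x k)
     sums (?n * (?n + 1) * x\<^sup>2 + (1 - x - 2 * ?n * x) * (?n * x) + ?n\<^sup>2 * x\<^sup>2 * 1)"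
    by (intro sums_add sums_mult neg_binom_sums neg_binom_first_moment_sums neg_binom_second_moment_sums assms)
  also have "?n * (?n + 1) * x\<^sup>2 + (1 - x - 2 * ?n * x) * (?n * x) + ?n\<^sup>2 * x\<^sup>2 * 1 = ?n * x"
    by (simp add: power2_eq_square algebra_simps)
  also have "(\<lambda>k. real k * (real k - 1) * (1 - x)\<^sup>2 * neg_binom m x k + (1 - x - 2 * ?n * x) * (real k * (1 - x) * neg_binom m x k) + ?n\<^sup>2 * x\<^sup>2 * neg_binom m x k)
     = (\<lambda>k. (real k * (1 - x) - ?n * x)\<^sup>2 * neg_binom m x k)"
    by (intro ext) (simp add: power2_eq_square algebra_simps del: of_nat_Suc)
  finally show ?thesis .
qed

section \<open>The partition into intervals and the two marginals of the kernel\<close>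

definition mkz_node :: "nat \<Rightarrow> nat \<Rightarrow> real" where
  "mkz_node n k = real k / real (k + n)"

definition mkz_len :: "nat \<Rightarrow> nat \<Rightarrow> real" where
  "mkz_len n k = mkz_node n (Suc k) - mkz_node n k"

lemma mkz_interval_eq: "mkz_interval n k = {mkz_node n k .. mkz_node n (Suc k)}"
  by (simp add: mkz_interval_def mkz_node_def)

lemma mkz_len_eq:
  assumes "1 \<le> n" shows "mkz_len n k = real n / (real (k + n) * real (k + n + 1))"
  using assms by (simp add: mkz_len_def mkz_node_def divide_simps) (simp add: algebra_simps)

lemma mkz_len_pos: "1 \<le> n \<Longrightarrow> 0 < mkz_len n k"
  by (simp add: mkz_len_eq)

lemma mkz_len_le:
  assumes "1 \<le> n" shows "mkz_len n k \<le> 1 / real n"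
proof -
  have "mkz_len n k \<le> real n / (real n * real n)"
    unfolding mkz_len_eq[OF assms] using assms by (intro divide_left_mono mult_mono mult_pos_pos) auto
  then show ?thesis using assms by simp
qed

lemma mkz_node_strict_mono:
  assumes "1 \<le> n" shows "strict_mono (mkz_node n)"
  using mkz_len_pos[OF assms] by (intro strict_mono_Suc_iff[THEN iffD2]) (simp add: mkz_len_def)

lemma mkz_node_bounds: "1 \<le> n \<Longrightarrow> 0 \<le> mkz_node n k \<and> mkz_node n k < 1"
  by (simp add: mkz_node_def)

lemma mkz_interval_subset: "1 \<le> n \<Longrightarrow> mkz_interval n k \<subseteq> {0..1}"
  using mkz_node_bounds[of n k] mkz_node_bounds[of n "Suc k"] by (auto simp: mkz_interval_eq)

lemma mkz_basis_nonneg: "0 \<le> x \<Longrightarrow> x \<le> 1 \<Longrightarrow> 0 \<le> mkz_basis n k x"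
  by (simp add: mkz_basis_def)

text \<open>This is the marginal in \<open>s\<close>. For \<open>n = m + 1\<close> the length is
  \<open>(m + 1) / ((k + m + 1) * (k + m + 2))\<close>; with the prefactor \<open>m + 2\<close> it
  turns \<open>(k + m + 2) choose k\<close> into \<open>(k + m) choose k\<close>.\<close>

lemma mkz_basis_len: "mkz_basis (Suc m) k x * mkz_len (Suc m) k = neg_binom m x k"
proof -
  define a where "a = real ((k + m + 2) choose k)"
  define b where "b = real ((k + m) choose k)"
  have "fact k * fact (m + 2) * a = fact (k + m + 2)"
    using binomial_fact_lemma[of k "k + m + 2"] unfolding a_def
    by (metis (mono_tags) add.assoc add_diff_cancel_left' le_add1 of_nat_fact of_nat_mult)
  moreover have "fact k * fact m * b = fact (k + m)"
    using binomial_fact_lemma[of k "k + m"] unfolding b_def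
    by (metis (mono_tags) add_diff_cancel_left' le_add1 of_nat_fact of_nat_mult)
  moreover have "fact (k + m + 2) = fact (k + m) * ((real k + real m + 1) * (real k + real m + 2))"
    by (simp add: numeral_2_eq_2 algebra_simps)
  moreover have "fact (m + 2) = fact m * ((real m + 1) * (real m + 2))"
    by (simp add: numeral_2_eq_2 algebra_simps)
  ultimately have "(fact k * fact m) * ((real m + 1) * (real m + 2) * a) = (fact k * fact m) * (b * ((real k + real m + 1) * (real k + real m + 2)))"
    by (simp add: mult_ac)
  then have ab: "(real m + 1) * (real m + 2) * a = b * ((real k + real m + 1) * (real k + real m + 2))"
    by simp
  have "real (Suc m + 1) * a * mkz_len (Suc m) k = ((real m + 1) * (real m + 2) * a) / ((real k + real m + 1) * (real k + real m + 2))"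
    by (simp add: mkz_len_eq add_ac mult_ac)
  also have "\<dots> = b" unfolding ab by (rule nonzero_mult_div_cancel_right) (auto simp: add_nonneg_eq_0_iff)
  finally have "real (Suc m + 1) * real ((k + Suc m + 1) choose k) * mkz_len (Suc m) k = real ((k + m) choose k)"
    by (simp add: a_def b_def)
  then show ?thesis
    unfolding neg_binom_def mkz_basis_def by (metis mult.assoc mult.commute)
qed

lemma summable_mkz_basis:
  assumes "0 \<le> x" "x < 1" shows "summable (\<lambda>k. mkz_basis n k x)"
proof -
  \<comment> \<open>The coefficient \<open>(k + n + 1) choose k\<close> belongs to parameter
    \<open>n + 1\<close>, whose power of \<open>1 - x\<close> is higher by two.\<close>
  have "summable (\<lambda>k. real (n + 1) / (1 - x)\<^sup>2 * neg_binom (Suc n) x k)"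
    using sums_summable[OF neg_binom_sums[OF assms]] by (rule summable_mult)
  also have "(\<lambda>k. real (n + 1) / (1 - x)\<^sup>2 * neg_binom (Suc n) x k) = (\<lambda>k. mkz_basis n k x)"
  proof
    fix k
    have "(1 - x) ^ Suc (Suc n) = (1 - x)\<^sup>2 * (1 - x) ^ n" by (simp add: power2_eq_square)
    moreover have "(1 - x)\<^sup>2 \<noteq> 0" using assms by simp
    ultimately show "real (n + 1) / (1 - x)\<^sup>2 * neg_binom (Suc n) x k = mkz_basis n k x"
      by (simp add: neg_binom_def mkz_basis_def del: power_Suc)
  qed
  finally show ?thesis .
qed

text \<open>The marginal in \<open>x\<close>, a Beta integral: \<open>Beta (k + 1) (n + 1)\<close>
  is the reciprocal of \<open>(n + 1) * ((k + n + 1) choose k)\<close>.\<close>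

lemma nn_integral_mkz_basis:
  "(\<integral>\<^sup>+x. ennreal (mkz_basis n k x) * indicator {0..1} x \<partial>lborel) = 1"
proof -
  have "((\<lambda>t::real. t powr (real k + 1 - 1) * (1 - t) powr (real n + 1 - 1)) has_integral Beta (real k + 1) (real n + 1)) {0..1}"
    by (intro has_integral_Beta_real) auto
  \<comment> \<open>The integrands may differ at 0 and 1, because \<open>0 powr 0 = 0\<close> but
    \<open>0 ^ 0 = 1\<close>.\<close>
  then have "((\<lambda>t::real. t ^ k * (1 - t) ^ n) has_integral Beta (real k + 1) (real n + 1)) {0..1}"
    by (rule has_integral_spike_finite[rotated 2, of _ _ _ "{0,1}"]) (auto simp: powr_realpow)
  then have "((\<lambda>t. real (n + 1) * real ((k + n + 1) choose k) * (t ^ k * (1 - t) ^ n)) has_integral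
     real (n + 1) * real ((k + n + 1) choose k) * Beta (real k + 1) (real n + 1)) {0..1}"
    by (rule has_integral_mult_right)
  also have "real (n + 1) * real ((k + n + 1) choose k) * Beta (real k + 1) (real n + 1) = 1"
  proof -
    have "Gamma (real k + 1) = fact k" "Gamma (real n + 1) = fact n" using Gamma_fact[of k, where ?'a = real] Gamma_fact[of n, where ?'a = real] by (auto simp: add_ac)
    moreover have "Gamma ((real k + 1) + (real n + 1)) = fact (k + n + 1)"
      using Gamma_fact[of "k + n + 1", where ?'a = real] by (simp add: add_ac)
    moreover have "(k + n + 1) choose k = fact (k + n + 1) / (fact k * fact (n + 1) :: real)"
      by (subst binomial_fact) auto
    ultimately show ?thesis by (simp add: Beta_def)
  qed
  finally have "((\<lambda>t. mkz_basis n k t) has_integral 1) {0..1}"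
    by (simp add: mkz_basis_def mult_ac)
  then have "integral\<^sup>N lborel (\<lambda>x. ennreal (indicator {0..1} x * mkz_basis n k x)) = ennreal 1"
    by (rule nn_integral_has_integral_lebesgue[rotated]) (auto intro: mkz_basis_nonneg)
  moreover have "(\<lambda>x. ennreal (indicator {0..1} x * mkz_basis n k x)) = (\<lambda>x. ennreal (mkz_basis n k x) * indicator {0..1} x)"
    by (auto simp: indicator_def)
  ultimately show ?thesis by simp
qed

text \<open>Neighbouring intervals share an endpoint; the half-open versions \<open>J k\<close>
  change them by null sets and are pairwise disjoint.\<close>

lemma suminf_nn_integral_mkz_interval_le:
  fixes g :: "real \<Rightarrow> ennreal"
  assumes n: "1 \<le> n" and [measurable]: "g \<in> borel_measurable borel"
  shows "(\<Sum>k. \<integral>\<^sup>+s. g s * indicator (mkz_interval n k) s \<partial>lborel) \<le> (\<integral>\<^sup>+s. g s * indicator {0..1} s \<partial>lborel)"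
proof -
  define J where "J k = {mkz_node n k ..< mkz_node n (Suc k)}" for k
  have [measurable]: "J k \<in> sets borel" for k by (simp add: J_def)
  have "(\<integral>\<^sup>+s. g s * indicator (mkz_interval n k) s \<partial>lborel) = (\<integral>\<^sup>+s. g s * indicator (J k) s \<partial>lborel)" for k
  proof (rule nn_integral_cong_AE)
    show "AE s in lborel. g s * indicator (mkz_interval n k) s = g s * indicator (J k) s"
      using AE_lborel_singleton[of "mkz_node n (Suc k)"]
      by eventually_elim (auto simp: J_def mkz_interval_eq indicator_def)
  qed
  then have "(\<Sum>k. \<integral>\<^sup>+s. g s * indicator (mkz_interval n k) s \<partial>lborel) = (\<Sum>k. \<integral>\<^sup>+s. g s * indicator (J k) s \<partial>lborel)"
    by simp
  also have "\<dots> = (\<integral>\<^sup>+s. (\<Sum>k. g s * indicator (J k) s) \<partial>lborel)"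
    by (rule nn_integral_suminf[symmetric]) measurable
  also have "\<dots> = (\<integral>\<^sup>+s. g s * indicator (\<Union>k. J k) s \<partial>lborel)"
  proof -
    have "J i \<inter> J j = {}" if "i < j" for i j
    proof -
      have "mkz_node n (Suc i) \<le> mkz_node n j"
        using strict_mono_mono[OF mkz_node_strict_mono[OF n]] that by (auto simp: mono_def)
      then show ?thesis by (auto simp: J_def)
    qed
    then have "disjoint_family J"
      unfolding disjoint_family_on_def by (metis Int_commute nat_neq_iff)
    from suminf_indicator[OF this] show ?thesis by (simp add: ennreal_suminf_cmult)
  qed
  also have "\<dots> \<le> (\<integral>\<^sup>+s. g s * indicator {0..1} s \<partial>lborel)"
  proof (rule nn_integral_mono)
    fix s
    have "s \<in> {0..1}" if "s \<in> J k" for k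
      using that mkz_node_bounds[OF n, of k] mkz_node_bounds[OF n, of "Suc k"] by (auto simp: J_def)
    then show "g s * indicator (\<Union>k. J k) s \<le> g s * indicator {0..1} s"
      by (auto simp: indicator_def)
  qed
  finally show ?thesis .
qed

text \<open>The tangent to \<open>u powr p\<close> at \<open>u = a\<close> lies below the graph;
  this is that inequality solved for \<open>u\<close>, with equality at \<open>u = a\<close>. It is
  the form of Jensen's inequality that can be integrated and summed term by term.\<close>

lemma powr_tangent:
  fixes u a p :: real
  assumes p: "1 \<le> p" and a: "0 < a" and u: "0 \<le> u"
  shows "u \<le> a powr (1 - p) / p * u powr p + a * (1 - 1 / p)"
proof (cases "u = 0")
  case False
  define t where "t = u / a"
  have t: "0 < t" using False u a by (simp add: t_def)
  have "exp ((1 - 1 / p) *\<^sub>R 0 + (1 / p) *\<^sub>R (p * ln t)) \<le> (1 - 1 / p) * exp 0 + 1 / p * exp (p * ln t)"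
    using p by (intro convex_onD[OF exp_convex]) auto
  then have "t \<le> (1 - 1 / p) + 1 / p * t powr p"
    using t p by (simp add: powr_def)
  then have "a * t \<le> a * ((1 - 1 / p) + 1 / p * t powr p)" using a by (intro mult_left_mono) auto
  also have "\<dots> = a powr (1 - p) / p * u powr p + a * (1 - 1 / p)"
    using a u by (simp add: t_def powr_divide powr_diff algebra_simps)
  finally show ?thesis using a by (simp add: t_def)
qed (use p a in auto)

lemma ennreal_abs_suminf_le:
  fixes f :: "nat \<Rightarrow> real"
  shows "ennreal \<bar>\<Sum>k. f k\<bar> \<le> (\<Sum>k. ennreal \<bar>f k\<bar>)"
proof (cases "(\<Sum>k. ennreal \<bar>f k\<bar>) = top")
  case False
  then have s: "summable (\<lambda>k. \<bar>f k\<bar>)" by (intro summable_suminf_not_top) auto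
  then have "ennreal \<bar>\<Sum>k. f k\<bar> \<le> ennreal (\<Sum>k. \<bar>f k\<bar>)" by (intro ennreal_leI summable_rabs)
  also have "\<dots> = (\<Sum>k. ennreal \<bar>f k\<bar>)" using s by (intro suminf_ennreal2[symmetric]) auto
  finally show ?thesis .
qed simp

text \<open>A non-integrable integrand has integral 0 by convention, which makes that case
  trivial.\<close>

lemma ennreal_abs_set_integral_le:
  fixes h :: "real \<Rightarrow> real"
  shows "ennreal \<bar>LINT s : A | lborel. h s\<bar> \<le> (\<integral>\<^sup>+s. ennreal \<bar>h s\<bar> * indicator A s \<partial>lborel)"
proof (cases "integrable lborel (\<lambda>s. indicator A s *\<^sub>R h s)")
  case True
  from integral_norm_bound_ennreal[OF this] show ?thesis
    by (simp add: set_lebesgue_integral_def abs_mult ennreal_mult' mult.commute ennreal_indicator)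
qed (simp add: set_lebesgue_integral_def not_integrable_integral_eq)

text \<open>Jensen for the probability density \<open>H_n(x, s)\<close> in \<open>s\<close>. The
  tangent is taken at \<open>Y = \<bar>MKZ n h x\<bar>\<close> itself; as the weights sum to 1 this
  gives \<open>Y \<le> c * \<rho> + Y * (1 - 1 / p)\<close>, and cancelling leaves
  \<open>Y powr p \<le> \<rho>\<close>.\<close>

lemma MKZ_powr_le:
  assumes p: "1 \<le> p" and n: "1 \<le> n" and [measurable]: "h \<in> borel_measurable borel" and x: "0 \<le> x" "x < 1"
  shows "ennreal (\<bar>MKZ n h x\<bar> powr p) \<le>
     (\<Sum>k. ennreal (mkz_basis n k x) * (\<integral>\<^sup>+s. ennreal (\<bar>h s\<bar> powr p) * indicator (mkz_interval n k) s \<partial>lborel))"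
    (is "_ \<le> ?r")
proof (cases "MKZ n h x = 0 \<or> ?r = top")
  case False
  obtain m where m: "n = Suc m" using n by (cases n) auto
  define J where "J k = (\<integral>\<^sup>+s. ennreal (\<bar>h s\<bar> powr p) * indicator (mkz_interval n k) s \<partial>lborel)" for k
  define Y where "Y = \<bar>MKZ n h x\<bar>"
  have Y: "0 < Y" using False by (simp add: Y_def)
  obtain \<rho> where \<rho>: "?r = ennreal \<rho>" "0 \<le> \<rho>" using False by (cases ?r rule: ennreal_cases) auto
  have [measurable]: "mkz_interval n k \<in> sets borel" for k by (simp add: mkz_interval_eq)
  define c where "c = Y powr (1 - p) / p"
  define d where "d = Y * (1 - 1 / p)"
  have cd: "0 \<le> c" "0 \<le> d" using p Y by (auto simp: c_def d_def)
  have w: "0 \<le> mkz_basis n k x" for k using x by (intro mkz_basis_nonneg) auto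
  have len: "(\<integral>\<^sup>+s. indicator (mkz_interval n k) s \<partial>lborel) = ennreal (mkz_len n k)" for k
    using mkz_len_pos[OF n, of k] by (simp add: mkz_interval_eq mkz_len_def)
  have "ennreal Y \<le> (\<Sum>k. ennreal \<bar>mkz_basis n k x * (LINT s : mkz_interval n k | lborel. h s)\<bar>)"
    unfolding Y_def MKZ_def by (rule ennreal_abs_suminf_le)
  also have "\<dots> \<le> (\<Sum>k. ennreal c * (ennreal (mkz_basis n k x) * J k) + ennreal d * ennreal (neg_binom m x k))"
  proof (intro suminf_le summableI)
    fix k
    have "ennreal \<bar>mkz_basis n k x * (LINT s : mkz_interval n k | lborel. h s)\<bar>
       = ennreal (mkz_basis n k x) * ennreal \<bar>LINT s : mkz_interval n k | lborel. h s\<bar>"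
      using w by (simp add: abs_mult ennreal_mult)
    also have "\<dots> \<le> ennreal (mkz_basis n k x) * (\<integral>\<^sup>+s. ennreal \<bar>h s\<bar> * indicator (mkz_interval n k) s \<partial>lborel)"
      by (intro mult_left_mono ennreal_abs_set_integral_le) auto
    also have "\<dots> \<le> ennreal (mkz_basis n k x) * (\<integral>\<^sup>+s. ennreal c * (ennreal (\<bar>h s\<bar> powr p) * indicator (mkz_interval n k) s)
         + ennreal d * indicator (mkz_interval n k) s \<partial>lborel)"
    proof (intro mult_left_mono nn_integral_mono)
      fix s
      have "ennreal \<bar>h s\<bar> \<le> ennreal (c * \<bar>h s\<bar> powr p + d)"
        using powr_tangent[OF p Y, of "\<bar>h s\<bar>"] by (intro ennreal_leI) (simp add: c_def d_def)
      then show "ennreal \<bar>h s\<bar> * indicator (mkz_interval n k) s \<le> ennreal c * (ennreal (\<bar>h s\<bar> powr p) * indicator (mkz_interval n k) s) + ennreal d * indicator (mkz_interval n k) s"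
        using cd by (auto simp: indicator_def ennreal_mult ennreal_plus)
    qed simp
    also have "\<dots> = ennreal (mkz_basis n k x) * (ennreal c * J k + ennreal d * ennreal (mkz_len n k))"
      by (simp add: nn_integral_add nn_integral_cmult J_def len)
    also have "\<dots> = ennreal c * (ennreal (mkz_basis n k x) * J k) + ennreal d * (ennreal (mkz_basis n k x) * ennreal (mkz_len n k))"
      by (simp add: distrib_left mult_ac)
    also have "ennreal (mkz_basis n k x) * ennreal (mkz_len n k) = ennreal (neg_binom m x k)"
      using w mkz_len_pos[OF n, of k] mkz_basis_len[of m k x] by (simp add: m flip: ennreal_mult'')
    finally show "ennreal \<bar>mkz_basis n k x * (LINT s : mkz_interval n k | lborel. h s)\<bar>
       \<le> ennreal c * (ennreal (mkz_basis n k x) * J k) + ennreal d * ennreal (neg_binom m x k)" .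
  qed
  also have "\<dots> = ennreal c * ?r + ennreal d * (\<Sum>k. ennreal (neg_binom m x k))"
    by (simp add: J_def ennreal_suminf_cmult flip: suminf_add)
  also have "(\<Sum>k. ennreal (neg_binom m x k)) = 1"
  proof -
    have "(\<Sum>k. ennreal (neg_binom m x k)) = ennreal (\<Sum>k. neg_binom m x k)"
      using x by (intro suminf_ennreal2 neg_binom_nonneg sums_summable[OF neg_binom_sums[OF x]]) auto
    then show ?thesis by (simp add: sums_unique[OF neg_binom_sums[OF x], symmetric])
  qed
  also have "ennreal c * ?r + ennreal d * 1 = ennreal (c * \<rho> + d)"
    using cd \<rho> by (simp add: ennreal_mult ennreal_plus)
  finally have "ennreal Y \<le> ennreal (c * \<rho> + d)" .
  moreover have "0 \<le> c * \<rho> + d" using cd \<rho>(2) by simp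
  ultimately have "Y \<le> c * \<rho> + d" using ennreal_le_iff by blast
  then have "Y / p \<le> Y powr (1 - p) / p * \<rho>" using p by (simp add: c_def d_def algebra_simps)
  then have "Y \<le> Y powr (1 - p) * \<rho>" using p by (simp add: field_simps)
  then have "Y powr (p - 1) * Y \<le> Y powr (p - 1) * (Y powr (1 - p) * \<rho>)" by (intro mult_left_mono) auto
  also have "\<dots> = \<rho>" using Y by (simp add: mult.assoc[symmetric] flip: powr_add)
  also have "Y powr (p - 1) * Y = Y powr p" using Y powr_add[of Y "p - 1" 1] by simp
  finally have "ennreal (Y powr p) \<le> ennreal \<rho>" by (rule ennreal_leI)
  then show ?thesis unfolding \<rho>(1) Y_def .
qed (use p in auto)

text \<open>Jensen used the marginal in \<open>s\<close>; integrating its bound over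
  \<open>x\<close> uses the other one, so each interval contributes just its own integral of
  \<open>\<bar>h\<bar> powr p\<close>.\<close>

lemma MKZ_contraction:
  assumes p: "1 \<le> p" and n: "1 \<le> n" and h[measurable]: "h \<in> borel_measurable borel" and hp: "in_Lp p h"
  shows "in_Lp p (MKZ n h)" and "Lp_norm p (MKZ n h) \<le> Lp_norm p h"
proof -
  have [measurable]: "(\<lambda>x. mkz_basis n k x) \<in> borel_measurable borel" for k
    unfolding mkz_basis_def by measurable
  have meas: "MKZ n h \<in> borel_measurable borel" unfolding MKZ_def by measurable
  define J where "J k = (\<integral>\<^sup>+s. ennreal (\<bar>h s\<bar> powr p) * indicator (mkz_interval n k) s \<partial>lborel)" for k
  have lb: "(\<integral>\<^sup>+x. f x \<partial>I01) = (\<integral>\<^sup>+x. f x * indicator {0..1} x \<partial>lborel)" for f :: "real \<Rightarrow> ennreal"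
    by (simp add: nn_integral_restrict_space nn_integral_completion)
  have "(\<integral>\<^sup>+x. ennreal (\<bar>MKZ n h x\<bar> powr p) \<partial>I01) \<le> (\<integral>\<^sup>+x. (\<Sum>k. ennreal (mkz_basis n k x) * indicator {0..1} x * J k) \<partial>lborel)"
    unfolding lb
  proof (rule nn_integral_mono_AE)
    show "AE x in lborel. ennreal (\<bar>MKZ n h x\<bar> powr p) * indicator {0..1} x \<le> (\<Sum>k. ennreal (mkz_basis n k x) * indicator {0..1} x * J k)"
      using AE_lborel_singleton[of "1::real"]
    proof eventually_elim
      case (elim x)
      then show ?case using MKZ_powr_le[OF p n h, of x] by (auto simp: indicator_def J_def)
    qed
  qed
  also have "\<dots> = (\<Sum>k. \<integral>\<^sup>+x. ennreal (mkz_basis n k x) * indicator {0..1} x * J k \<partial>lborel)"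
    by (rule nn_integral_suminf) measurable
  also have "\<dots> = (\<Sum>k. J k)"
    by (subst nn_integral_multc) (auto simp: nn_integral_mkz_basis)
  also have "\<dots> \<le> (\<integral>\<^sup>+s. ennreal (\<bar>h s\<bar> powr p) * indicator {0..1} s \<partial>lborel)"
    unfolding J_def by (rule suminf_nn_integral_mkz_interval_le[OF n]) measurable
  also have "\<dots> = ennreal (Lp_norm p h powr p)"
    using in_Lp_nn_integral[OF p hp] by (simp add: lb)
  finally have le: "(\<integral>\<^sup>+x. ennreal (\<bar>MKZ n h x\<bar> powr p) \<partial>I01) \<le> ennreal (Lp_norm p h powr p)" .
  have "MKZ n h \<in> borel_measurable I01"
    using meas by (intro measurable_restrict_space1 measurable_completion) simp
  from in_LpI[OF p this Lp_norm_nonneg le] Lp_norm_le[OF p this Lp_norm_nonneg le]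
  show "in_Lp p (MKZ n h)" "Lp_norm p (MKZ n h) \<le> Lp_norm p h" .
qed

text \<open>Links the norm, taken over Lebesgue measure, with \<open>MKZ\<close>, which integrates
  against \<open>lborel\<close>. Integrability itself follows from
  \<open>u \<le> 1 + u powr p\<close> on a bounded interval.\<close>

lemma in_Lp_set_integrable:
  assumes p: "1 \<le> p" and [measurable]: "h \<in> borel_measurable borel" and hp: "in_Lp p h"
  shows "set_integrable lborel {0..1} h"
proof -
  have "integrable I01 h"
  proof (rule Bochner_Integration.integrable_bound)
    show "integrable I01 (\<lambda>x. 1 + \<bar>h x\<bar> powr p)"
      using hp by (intro Bochner_Integration.integrable_add) (auto simp: in_Lp_def finite_measure.integrable_const finite_measure_lebesgue_on)
    have "u \<le> 1 + u powr p" if "0 \<le> u" for u :: real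
    proof (cases "u \<le> 1")
      case True
      then show ?thesis using powr_ge_zero[of u p] by linarith
    next
      case False
      then show ?thesis using powr_mono[of 1 p u] p by simp
    qed
    then show "AE x in I01. norm (h x) \<le> norm (1 + \<bar>h x\<bar> powr p)" by (intro AE_I2) auto
  qed (use in_Lp_measurable[OF hp] in auto)
  then have "integrable lebesgue (\<lambda>x. indicator {0..1} x *\<^sub>R h x)"
    by (subst (asm) integrable_restrict_space) auto
  then show ?thesis unfolding set_integrable_def
    by (subst (asm) integrable_completion) auto
qed

lemma summable_MKZ:
  assumes n: "1 \<le> n" and h: "set_integrable lborel {0..1} h" and x: "0 \<le> x" "x < 1"
  shows "summable (\<lambda>k. mkz_basis n k x * (LINT s : mkz_interval n k | lborel. h s))"
proof -
  define B where "B = (LINT s : {0..1} | lborel. \<bar>h s\<bar>)"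
  show ?thesis
  proof (rule summable_comparison_test'[where N = 0])
  show "summable (\<lambda>k. mkz_basis n k x * B)"
    using summable_mkz_basis[OF x] by (rule summable_mult2)
  fix k
  have w: "0 \<le> mkz_basis n k x" using x by (intro mkz_basis_nonneg) auto
  have hk: "set_integrable lborel (mkz_interval n k) h"
    by (rule set_integrable_subset[OF h _ mkz_interval_subset[OF n]]) (simp add: mkz_interval_eq)
  have "\<bar>LINT s : mkz_interval n k | lborel. h s\<bar> \<le> (LINT s : mkz_interval n k | lborel. \<bar>h s\<bar>)"
    using set_integral_norm_bound[OF hk] by simp
  also have "\<dots> \<le> B" unfolding B_def set_lebesgue_integral_def
    using set_integrable_abs[OF hk] set_integrable_abs[OF h] mkz_interval_subset[OF n, of k]
    by (intro integral_mono) (auto simp: set_integrable_def indicator_def)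
  finally show "norm (mkz_basis n k x * (LINT s : mkz_interval n k | lborel. h s)) \<le> mkz_basis n k x * B"
    using w by (simp add: abs_mult mult_left_mono)
  qed
qed

lemma MKZ_diff:
  assumes n: "1 \<le> n" and f: "set_integrable lborel {0..1} f" and g: "set_integrable lborel {0..1} g"
    and x: "0 \<le> x" "x < 1"
  shows "MKZ n (\<lambda>s. f s - g s) x = MKZ n f x - MKZ n g x"
proof -
  have "set_integrable lborel (mkz_interval n k) f" "set_integrable lborel (mkz_interval n k) g" for k
    using set_integrable_subset[OF f _ mkz_interval_subset[OF n]] set_integrable_subset[OF g _ mkz_interval_subset[OF n]]
    by (simp_all add: mkz_interval_eq)
  then show ?thesis
    unfolding MKZ_def
    by (simp add: set_integral_diff right_diff_distrib suminf_diff summable_MKZ[OF n f x] summable_MKZ[OF n g x])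
qed

text \<open>On interval \<open>k\<close> the deviation of \<open>g\<close> from \<open>g x\<close>
  is at most \<open>L\<close> times distance of the node plus interval length. The distance is at
  most \<open>\<bar>k * (1 - x) - n * x\<bar> / n\<close>, whose mean is controlled by the variance
  \<open>n * x\<close>, hence the rate.\<close>

lemma MKZ_Lipschitz_approx:
  assumes n: "1 \<le> n" and x: "0 \<le> x" "x < 1"
    and L: "0 \<le> L" and lip: "\<And>s t. s \<in> {0..1} \<Longrightarrow> t \<in> {0..1} \<Longrightarrow> \<bar>g s - g t\<bar> \<le> L * \<bar>s - t\<bar>"
    and g: "set_integrable lborel {0..1} g"
  shows "\<bar>MKZ n g x - g x\<bar> \<le> 2 * L / sqrt (real n)"
proof -
  obtain m where m: "n = Suc m" using n by (cases n) auto
  define \<delta> where "\<delta> = sqrt (real n)"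
  have \<delta>: "0 < \<delta>" "\<delta>\<^sup>2 = real n" using n by (auto simp: \<delta>_def)
  define A where "A k = (LINT s : mkz_interval n k | lborel. g s)" for k
  \<comment> \<open>The termwise majorant, split into a multiple of the probability, summed by total
    mass, and a multiple of the squared deviation, summed by the variance.\<close>
  define c where "c k = neg_binom m x k * (L / real n + L * \<delta> / (2 * real n)) + L / (2 * real n * \<delta>) * ((real k * (1 - x) - real n * x)\<^sup>2 * neg_binom m x k)" for k
  have cs: "c sums (1 * (L / real n + L * \<delta> / (2 * real n)) + L / (2 * real n * \<delta>) * (real n * x))"
    unfolding c_def m by (intro sums_add sums_mult sums_mult2 neg_binom_sums neg_binom_variance_sums x)
  have le: "\<bar>mkz_basis n k x * A k - neg_binom m x k * g x\<bar> \<le> c k" for k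
  proof -
    have w: "0 \<le> mkz_basis n k x" using x by (intro mkz_basis_nonneg) auto
    have nbeq: "neg_binom m x k = mkz_basis n k x * mkz_len n k" using mkz_basis_len[of m k x] by (simp add: m)
    define D where "D = L * (\<bar>mkz_node n k - x\<bar> + mkz_len n k)"
    have lp: "0 < mkz_len n k" using mkz_len_pos[OF n] .
    have gk: "set_integrable lborel (mkz_interval n k) g"
      by (rule set_integrable_subset[OF g _ mkz_interval_subset[OF n]]) (simp add: mkz_interval_eq)
    have const: "set_integrable lborel (mkz_interval n k) (\<lambda>s. u)" for u :: real
      unfolding mkz_interval_eq by (intro borel_integrable_atLeastAtMost' continuous_on_const)
    have constI: "(LINT s : mkz_interval n k | lborel. u) = u * mkz_len n k" for u :: real
      using lp by (simp add: mkz_interval_eq set_lebesgue_integral_def mkz_len_def)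
    have gx: "set_integrable lborel (mkz_interval n k) (\<lambda>s. g s - g x)" using gk const by (rule set_integral_diff)
    have "\<bar>A k - g x * mkz_len n k\<bar> = \<bar>LINT s : mkz_interval n k | lborel. g s - g x\<bar>"
      by (simp add: A_def set_integral_diff gk const constI)
    also have "\<dots> \<le> (LINT s : mkz_interval n k | lborel. \<bar>g s - g x\<bar>)"
      using set_integral_norm_bound[OF gx] by simp
    also have "\<dots> \<le> (LINT s : mkz_interval n k | lborel. D)"
    proof (rule set_integral_mono[OF set_integrable_abs[OF gx] const])
      fix s assume s: "s \<in> mkz_interval n k"
      then have "s \<in> {0..1}" using mkz_interval_subset[OF n, of k] by auto
      then have "\<bar>g s - g x\<bar> \<le> L * \<bar>s - x\<bar>" using lip x by auto
      also have "\<dots> \<le> D" unfolding D_def using s L by (intro mult_left_mono) (auto simp: mkz_interval_eq mkz_len_def)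
      finally show "\<bar>g s - g x\<bar> \<le> D" .
    qed
    finally have "\<bar>A k - g x * mkz_len n k\<bar> \<le> D * mkz_len n k" by (simp add: constI)
    then have "mkz_basis n k x * \<bar>A k - g x * mkz_len n k\<bar> \<le> mkz_basis n k x * (D * mkz_len n k)"
      using w by (intro mult_left_mono)
    also have "mkz_basis n k x * \<bar>A k - g x * mkz_len n k\<bar> = \<bar>mkz_basis n k x * A k - neg_binom m x k * g x\<bar>"
    proof -
      have "mkz_basis n k x * \<bar>A k - g x * mkz_len n k\<bar> = \<bar>mkz_basis n k x * (A k - g x * mkz_len n k)\<bar>"
        using w by (simp add: abs_mult)
      then show ?thesis unfolding nbeq right_diff_distrib by (simp only: mult_ac)
    qed
    also have "mkz_basis n k x * (D * mkz_len n k) = neg_binom m x k * D" unfolding nbeq by simp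
    also have "\<dots> \<le> neg_binom m x k * (L * (\<delta> / (2 * real n) + (real k * (1 - x) - real n * x)\<^sup>2 / (2 * real n * \<delta>) + 1 / real n))"
    proof (intro mult_left_mono)
      define v where "v = \<bar>real k * (1 - x) - real n * x\<bar>"
      have "mkz_node n k - x = (real k * (1 - x) - real n * x) / real (k + n)"
        using n by (simp add: mkz_node_def field_simps)
      then have "\<bar>mkz_node n k - x\<bar> = v / real (k + n)" by (simp add: v_def)
      also have "\<dots> \<le> v / real n" using n by (intro divide_left_mono mult_pos_pos) (auto simp: v_def)
      \<comment> \<open>Trades the first absolute moment for the second;
        \<open>\<delta> = sqrt n\<close> balances the two halves.\<close>
      also have "v \<le> (\<delta> + v\<^sup>2 / \<delta>) / 2"
        using \<delta>(1) sum_squares_bound[of \<delta> v] by (simp add: field_simps power2_eq_square)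
      then have "v / real n \<le> (\<delta> + v\<^sup>2 / \<delta>) / 2 / real n" by (rule divide_right_mono) simp
      also have "\<dots> = \<delta> / (2 * real n) + (real k * (1 - x) - real n * x)\<^sup>2 / (2 * real n * \<delta>)"
        using \<delta>(1) n by (simp add: v_def field_simps)
      finally show "D \<le> L * (\<delta> / (2 * real n) + (real k * (1 - x) - real n * x)\<^sup>2 / (2 * real n * \<delta>) + 1 / real n)"
        unfolding D_def using L mkz_len_le[OF n, of k] by (intro mult_left_mono) auto
    qed (use x in \<open>auto intro: neg_binom_nonneg\<close>)
    also have "\<dots> = c k" by (simp add: c_def algebra_simps)
    finally show ?thesis .
  qed
  have s1: "summable (\<lambda>k. mkz_basis n k x * A k)" unfolding A_def by (rule summable_MKZ[OF n g x])
  have s2: "(\<lambda>k. neg_binom m x k * g x) sums (1 * g x)" by (intro sums_mult2 neg_binom_sums x)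
  have sc: "summable (\<lambda>k. \<bar>mkz_basis n k x * A k - neg_binom m x k * g x\<bar>)"
    using le by (intro summable_comparison_test'[OF sums_summable[OF cs], where N = 0]) auto
  have "MKZ n g x - g x = (\<Sum>k. mkz_basis n k x * A k - neg_binom m x k * g x)"
    using s1 s2 by (simp add: MKZ_def A_def suminf_diff[symmetric] sums_iff)
  also have "\<bar>\<dots>\<bar> \<le> (\<Sum>k. \<bar>mkz_basis n k x * A k - neg_binom m x k * g x\<bar>)" using sc by (rule summable_rabs)
  also have "\<dots> \<le> (\<Sum>k. c k)" using le sc sums_summable[OF cs] by (intro suminf_le) auto
  also have "\<dots> = L / real n + L * \<delta> / (2 * real n) + L / (2 * real n * \<delta>) * (real n * x)"
    using cs by (simp add: sums_iff)
  also have "\<dots> \<le> L / \<delta> + L / (2 * \<delta>) + L / (2 * \<delta>)"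
  proof (intro add_mono)
    have "\<delta> \<le> real n" using n real_sqrt_le_iff[of "real n" "(real n)\<^sup>2"] by (simp add: \<delta>_def real_le_lsqrt power2_eq_square)
    then show "L / real n \<le> L / \<delta>" using L \<delta>(1) n by (intro divide_left_mono) auto
    show "L * \<delta> / (2 * real n) \<le> L / (2 * \<delta>)" using \<delta> by (simp add: power2_eq_square flip: \<delta>(2))
    have "L / (2 * real n * \<delta>) * (real n * x) = L / (2 * \<delta>) * x" using n by simp
    also have "\<dots> \<le> L / (2 * \<delta>)" using L \<delta>(1) x by (intro mult_right_le_one_le) auto
    finally show "L / (2 * real n * \<delta>) * (real n * x) \<le> L / (2 * \<delta>)" .
  qed
  also have "\<dots> = 2 * L / \<delta>" by simp
  finally show ?thesis by (simp add: \<delta>_def)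
qed

lemma polynomial_Lipschitz:
  fixes a :: "nat \<Rightarrow> real"
  shows "\<exists>L\<ge>0. \<forall>s\<in>{0..1}. \<forall>t\<in>{0..1}. \<bar>(\<Sum>k\<le>d. a k * s ^ k) - (\<Sum>k\<le>d. a k * t ^ k)\<bar> \<le> L * \<bar>s - t\<bar>"
proof (intro exI[of _ "\<Sum>k\<le>d. \<bar>a k\<bar> * real k"] conjI ballI)
  fix s t :: real assume st: "s \<in> {0..1}" "t \<in> {0..1}"
  have pw: "\<bar>s ^ k - t ^ k\<bar> \<le> real k * \<bar>s - t\<bar>" for k
    using norm_power_diff[of s t k] st by simp
  have "(\<Sum>k\<le>d. a k * s ^ k) - (\<Sum>k\<le>d. a k * t ^ k) = (\<Sum>k\<le>d. a k * (s ^ k - t ^ k))"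
    by (simp add: sum_subtractf right_diff_distrib)
  also have "\<bar>\<dots>\<bar> \<le> (\<Sum>k\<le>d. \<bar>a k * (s ^ k - t ^ k)\<bar>)" by (rule sum_abs)
  also have "\<dots> \<le> (\<Sum>k\<le>d. \<bar>a k\<bar> * (real k * \<bar>s - t\<bar>))"
    unfolding abs_mult using pw by (intro sum_mono mult_left_mono) auto
  finally show "\<bar>(\<Sum>k\<le>d. a k * s ^ k) - (\<Sum>k\<le>d. a k * t ^ k)\<bar> \<le> (\<Sum>k\<le>d. \<bar>a k\<bar> * real k) * \<bar>s - t\<bar>"
    by (simp add: sum_distrib_right mult.assoc)
qed (auto intro: sum_nonneg)

text \<open>With \<open>g\<close> a polynomial near \<open>h\<close>, the part \<open>h - g\<close>
  costs at most twice its norm by contraction, uniformly in \<open>n\<close>, and the Lipschitz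
  function \<open>g\<close> costs at most \<open>2 * L / sqrt n\<close>.\<close>

theorem MKZ_converges_Lp:
  assumes p: "1 \<le> p" and h[measurable]: "h \<in> borel_measurable borel" and hp: "in_Lp p h"
  shows "(\<lambda>n. Lp_norm p (\<lambda>x. h x - MKZ n h x)) \<longlonglongrightarrow> 0"
proof (rule LIMSEQ_I)
  fix e :: real assume e: "0 < e"
  obtain a d where ad: "Lp_norm p (\<lambda>x. h x - (\<Sum>k\<le>d::nat. a k * x ^ k)) < e / 3"
    using polynomials_dense_Lp[OF p hp, of "e / 3"] e by auto
  define g where "g x = (\<Sum>k\<le>d. a k * x ^ k)" for x :: real
  have gc: "continuous_on A g" for A unfolding g_def by (intro continuous_intros)
  have [measurable]: "g \<in> borel_measurable borel" by (intro borel_measurable_continuous_onI gc)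
  have gp: "in_Lp p g" by (rule continuous_in_Lp[OF p gc])
  obtain L where L: "0 \<le> L" "\<And>s t. s \<in> {0..1} \<Longrightarrow> t \<in> {0..1} \<Longrightarrow> \<bar>g s - g t\<bar> \<le> L * \<bar>s - t\<bar>"
    using polynomial_Lipschitz[where a = a and d = d] unfolding g_def by blast
  have hi: "set_integrable lborel {0..1} h" and gi: "set_integrable lborel {0..1} g"
    using in_Lp_set_integrable[OF p] hp gp by auto
  define hg where "hg x = h x - g x" for x
  have hgm: "hg \<in> borel_measurable borel" unfolding hg_def by measurable
  have hgp: "in_Lp p hg" unfolding hg_def by (rule in_Lp_diff[OF p hp gp])
  have hge: "Lp_norm p hg < e / 3" using ad by (simp add: hg_def[abs_def] g_def)
  \<comment> \<open>Ensures \<open>6 * L / e < sqrt n\<close> from \<open>N\<close> on, that is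
    \<open>2 * L / sqrt n < e / 3\<close>.\<close>
  obtain N :: nat where N: "(6 * L / e + 1)\<^sup>2 < real N" using reals_Archimedean2 by blast
  have "norm (Lp_norm p (\<lambda>x. h x - MKZ n h x) - 0) < e" if n: "max N 1 \<le> n" for n
  proof -
    have n1: "1 \<le> n" using n by simp
    have "6 * L / e + 1 \<le> sqrt (real n)" using N n by (intro real_le_rsqrt) auto
    then have "6 * L / e < sqrt (real n)" by simp
    then have small: "2 * L / sqrt (real n) < e / 3" using e n1 by (simp add: field_simps)
    define \<phi> where "\<phi> x = hg x - MKZ n hg x" for x
    define \<psi> where "\<psi> x = g x - MKZ n g x" for x
    have \<phi>: "in_Lp p \<phi>" unfolding \<phi>_def by (rule in_Lp_diff[OF p hgp MKZ_contraction(1)[OF p n1 hgm hgp]])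
    have \<psi>: "in_Lp p \<psi>" unfolding \<psi>_def by (rule in_Lp_diff[OF p gp MKZ_contraction(1)[OF p n1 _ gp]]) measurable
    have n\<phi>: "Lp_norm p \<phi> \<le> 2 * Lp_norm p hg"
      using Lp_norm_triangle_diff[OF p hgp MKZ_contraction(1)[OF p n1 hgm hgp]] MKZ_contraction(2)[OF p n1 hgm hgp]
      by (simp add: \<phi>_def[abs_def])
    have AE1: "AE x in I01. 0 \<le> x \<and> x < 1"
    proof -
      have "AE x in lebesgue. x \<noteq> (1::real)" by (rule AE_completion) (rule AE_lborel_singleton)
      then show ?thesis by (subst AE_restrict_space_iff) (auto elim!: eventually_mono)
    qed
    have n\<psi>: "Lp_norm p \<psi> \<le> 2 * L / sqrt (real n)"
    proof -
      have "Lp_norm p \<psi> \<le> Lp_norm p (\<lambda>x. 2 * L / sqrt (real n))"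
      proof (rule Lp_norm_mono[OF p in_Lp_measurable[OF \<psi>] in_Lp_const[OF p]])
        show "AE x in I01. \<bar>\<psi> x\<bar> \<le> \<bar>2 * L / sqrt (real n)\<bar>"
          using AE1
        proof eventually_elim
          case (elim x)
          have "\<bar>MKZ n g x - g x\<bar> \<le> 2 * L / sqrt (real n)"
            using elim by (intro MKZ_Lipschitz_approx n1 L gi) auto
          then show ?case using L(1) by (simp add: \<psi>_def abs_minus_commute)
        qed
      qed
      also have "\<dots> \<le> 2 * L / sqrt (real n)" using L by (intro Lp_norm_bounded[OF p]) auto
      finally show ?thesis .
    qed
    have "AE x in I01. \<bar>h x - MKZ n h x\<bar> \<le> \<bar>\<phi> x + \<psi> x\<bar>"
      using AE1
    proof eventually_elim
      case (elim x)
      then have "MKZ n hg x = MKZ n h x - MKZ n g x"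
        unfolding hg_def[abs_def] by (intro MKZ_diff n1 hi gi) auto
      then show ?case by (simp add: \<phi>_def \<psi>_def hg_def)
    qed
    then have "Lp_norm p (\<lambda>x. h x - MKZ n h x) \<le> Lp_norm p (\<lambda>x. \<phi> x + \<psi> x)"
      by (intro Lp_norm_mono[OF p _ in_Lp_add[OF p \<phi> \<psi>]] in_Lp_measurable[of p] in_Lp_diff[OF p hp MKZ_contraction(1)[OF p n1 h hp]])
    also have "\<dots> \<le> Lp_norm p \<phi> + Lp_norm p \<psi>" by (rule Lp_norm_triangle[OF p \<phi> \<psi>])
    also have "\<dots> < e" using n\<phi> n\<psi> hge small by linarith
    finally show ?thesis using Lp_norm_nonneg[of p "\<lambda>x. h x - MKZ n h x"] by simp
  qed
  then show "\<exists>no. \<forall>n\<ge>no. norm (Lp_norm p (\<lambda>x. h x - MKZ n h x) - 0) < e" by blast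
qed

section \<open>The fractal perturbation\<close>

lemma borel_measurable_affine_lebesgue:
  fixes f :: "real \<Rightarrow> real"
  assumes f: "f \<in> borel_measurable lebesgue" and a: "a \<noteq> 0"
  shows "(\<lambda>x. f ((x - b) / a)) \<in> borel_measurable lebesgue"
proof -
  have "(\<lambda>x::real. - b / a + (1 / a) * x) \<in> lebesgue \<rightarrow>\<^sub>M lebesgue"
    using lebesgue_affine_measurable[where c = "\<lambda>x::real. 1 / a" and t = "- b / a"] a by simp
  from measurable_compose[OF this f] show ?thesis by (simp add: diff_divide_distrib)
qed

lemma AE_lebesgue_affine:
  fixes a b :: real
  assumes P: "AE y in lebesgue. P y" and a: "a \<noteq> 0"
  shows "AE x in lebesgue. P ((x - b) / a)"
proof -
  obtain Z where Z: "\<And>y. y \<in> space lebesgue - Z \<Longrightarrow> P y" "Z \<in> null_sets lebesgue"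
    using AE_E3[OF P] by blast
  then have Zs: "Z \<in> sets lebesgue" by blast
  have "0 = (\<integral>\<^sup>+x. indicator Z x \<partial>lebesgue)" using Z by (simp add: null_sets_def)
  also have "\<dots> = ennreal \<bar>1 / a\<bar> * (\<integral>\<^sup>+x. indicator Z (- b / a + (1 / a) * x) \<partial>lebesgue)"
    using a Zs by (intro nn_integral_real_affine_lebesgue) auto
  finally have int0: "(\<integral>\<^sup>+x. indicator Z ((x - b) / a) \<partial>lebesgue) = 0"
    using a by (simp add: diff_divide_distrib)
  have "(\<lambda>x::real. - b / a + (1 / a) * x) \<in> lebesgue \<rightarrow>\<^sub>M lebesgue"
    using lebesgue_affine_measurable[where c = "\<lambda>x::real. 1 / a" and t = "- b / a"] a by simp
  from measurable_compose[OF this borel_measurable_indicator[OF Zs]]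
  have "(\<lambda>x. indicator Z ((x - b) / a) :: ennreal) \<in> borel_measurable lebesgue" by (simp add: diff_divide_distrib)
  then have "AE x in lebesgue. indicator Z ((x - b) / a) = (0 :: ennreal)"
    using int0 by (simp add: nn_integral_0_iff_AE)
  then show ?thesis using Z(1) by (auto elim!: eventually_mono simp: indicator_def split: if_splits)
qed

text \<open>The linear part of the self-referential equation, which becomes
  \<open>G = h + L (G - MKZ n h)\<close> for the operator \<open>L\<close> of the locale
  below.\<close>

definition pullback_sum ::
  "nat \<Rightarrow> (nat \<Rightarrow> real) \<Rightarrow> (nat \<Rightarrow> real) \<Rightarrow> (nat \<Rightarrow> real \<Rightarrow> real) \<Rightarrow> (real \<Rightarrow> real) \<Rightarrow> real \<Rightarrow> real" where
  "pullback_sum N a b \<alpha> e x = (\<Sum>i=1..N. \<alpha> i ((x - b i) / a i) * e ((x - b i) / a i)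
        * indicator ((\<lambda>t. a i * t + b i) ` {0..1}) x)"

lemma is_alpha_fractal_iff:
  "is_alpha_fractal p N a b \<alpha> n h G \<longleftrightarrow> in_Lp p G \<and>
     (AE x in I01. G x = h x + pullback_sum N a b \<alpha> (\<lambda>y. G y - MKZ n h y) x)"
  by (simp add: is_alpha_fractal_def pullback_sum_def)

locale fractal_ifs =
  fixes p :: real and N :: nat and xs :: "nat \<Rightarrow> real"
    and a b :: "nat \<Rightarrow> real" and \<alpha> :: "nat \<Rightarrow> real \<Rightarrow> real"
  assumes p: "1 \<le> p"
    and x0: "xs 0 = 0" and xN: "xs N = 1"
    and xmono: "\<And>i. i < N \<Longrightarrow> xs i < xs (Suc i)"
    and u0: "\<And>i. i \<in> {1..N} \<Longrightarrow> a i * 0 + b i = xs (i - 1)"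
    and u1: "\<And>i. i \<in> {1..N} \<Longrightarrow> a i * 1 + b i = xs i"
    and alpha_Linf: "\<And>i. i \<in> {1..N} \<Longrightarrow> in_Linf (\<alpha> i)"
    and Lambda: "(\<Sum>i=1..N. a i * Linf_norm (\<alpha> i) powr p) powr (1 / p) < 1"
begin

abbreviation "L \<equiv> pullback_sum N a b \<alpha>"

definition "\<Lambda> = (\<Sum>i=1..N. a i * Linf_norm (\<alpha> i) powr p) powr (1 / p)"

lemma \<Lambda>: "0 \<le> \<Lambda>" "\<Lambda> < 1"
  using Lambda by (auto simp: \<Lambda>_def)

lemma a_pos: assumes "i \<in> {1..N}" shows "0 < a i"
proof -
  have "xs (i - 1) < xs (Suc (i - 1))" using assms by (intro xmono) auto
  then show ?thesis using u0[OF assms] u1[OF assms] assms by simp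
qed

lemma \<Lambda>_powr: "\<Lambda> powr p = (\<Sum>i=1..N. a i * Linf_norm (\<alpha> i) powr p)"
proof -
  have "0 \<le> (\<Sum>i=1..N. a i * Linf_norm (\<alpha> i) powr p)"
    by (intro sum_nonneg mult_nonneg_nonneg less_imp_le[OF a_pos]) auto
  then show ?thesis unfolding \<Lambda>_def using p by (simp add: powr_powr)
qed

lemma xs_le: "i \<le> j \<Longrightarrow> j \<le> N \<Longrightarrow> xs i \<le> xs j"
proof (induction j rule: dec_induct)
  case (step k)
  then show ?case using xmono[of k] by simp
qed simp

lemma image_eq:
  assumes i: "i \<in> {1..N}" shows "(\<lambda>t. a i * t + b i) ` {0..1} = {xs (i - 1) .. xs i}"
proof -
  have "(\<lambda>t. a i * t + b i) ` {0..1} = {b i .. a i + b i}"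
  proof safe
    fix x assume "x \<in> {b i .. a i + b i}"
    then show "x \<in> (\<lambda>t. a i * t + b i) ` {0..1}"
      using a_pos[OF i] by (intro image_eqI[of _ _ "(x - b i) / a i"]) auto
  qed (use a_pos[OF i] in \<open>auto simp: mult_left_le\<close>)
  then show ?thesis using u0[OF i] u1[OF i] by simp
qed

lemma indicator_image:
  assumes i: "i \<in> {1..N}"
  shows "indicator ((\<lambda>t. a i * t + b i) ` {0..1}) x = (indicator {0..1} ((x - b i) / a i) :: 'b :: zero_neq_one)"
proof -
  have "xs (i - 1) = b i" "xs i = a i + b i" using u0[OF i] u1[OF i] by auto
  then show ?thesis unfolding image_eq[OF i] using a_pos[OF i] by (auto simp: indicator_def field_simps)
qed

lemma alpha_measurable: "i \<in> {1..N} \<Longrightarrow> \<alpha> i \<in> borel_measurable I01"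
  using alpha_Linf by (simp add: in_Linf_def)

lemma alpha_bound:
  assumes i: "i \<in> {1..N}" shows "AE x in I01. \<bar>\<alpha> i x\<bar> \<le> Linf_norm (\<alpha> i)"
proof -
  have AE: "AE x in I01. ereal \<bar>\<alpha> i x\<bar> \<le> esssup I01 (\<lambda>x. ereal \<bar>\<alpha> i x\<bar>)" by (rule esssup_AE)
  have "esssup I01 (\<lambda>x. ereal \<bar>\<alpha> i x\<bar>) < \<infinity>" using alpha_Linf[OF i] by (simp add: in_Linf_def)
  then show ?thesis
    using AE by (cases "esssup I01 (\<lambda>x. ereal \<bar>\<alpha> i x\<bar>)") (auto simp: Linf_norm_def elim!: eventually_mono)
qed

lemma extend_measurable: 
  fixes f :: "real \<Rightarrow> real"
  shows "f \<in> borel_measurable I01 \<Longrightarrow> (\<lambda>x. f x * indicator {0..1} x) \<in> borel_measurable lebesgue"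
  by (subst (asm) borel_measurable_restrict_space_iff) (auto simp: mult.commute)

lemma L_term:
  assumes "i \<in> {1..N}"
  shows "\<alpha> i ((x - b i) / a i) * e ((x - b i) / a i) * indicator ((\<lambda>t. a i * t + b i) ` {0..1}) x
    = (\<lambda>y. (\<alpha> i y * e y) * indicator {0..1} y) ((x - b i) / a i)"
  by (simp add: indicator_image[OF assms])

lemma L_measurable:
  assumes e: "e \<in> borel_measurable I01"
  shows "L e \<in> borel_measurable I01"
proof -
  have "(\<lambda>x. \<alpha> i ((x - b i) / a i) * e ((x - b i) / a i) * indicator ((\<lambda>t. a i * t + b i) ` {0..1}) x) \<in> borel_measurable lebesgue"
    if i: "i \<in> {1..N}" for i
    unfolding L_term[OF i]
    using a_pos[OF i] alpha_measurable[OF i] e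
    by (intro borel_measurable_affine_lebesgue extend_measurable borel_measurable_times) auto
  then have "L e \<in> borel_measurable lebesgue"
    unfolding pullback_sum_def[abs_def] by (intro borel_measurable_sum)
  then show ?thesis by (rule measurable_restrict_space1)
qed

text \<open>The image intervals overlap only in partition points; at any other point at most one
  summand is nonzero, so the power passes through the sum.\<close>

lemma AE_L_powr:
  "AE x in lebesgue. \<bar>L e x\<bar> powr p = (\<Sum>i=1..N. \<bar>\<alpha> i ((x - b i) / a i) * e ((x - b i) / a i) * indicator ((\<lambda>t. a i * t + b i) ` {0..1}) x\<bar> powr p)"
proof -
  have "AE x in lebesgue. x \<notin> xs ` {0..N}"
    by (rule AE_completion) (auto intro!: AE_not_in finite_imp_null_set_lborel)
  then show ?thesis
  proof eventually_elim
    case (elim x)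
    define f where "f i = \<alpha> i ((x - b i) / a i) * e ((x - b i) / a i) * indicator ((\<lambda>t. a i * t + b i) ` {0..1}) x" for i
    have uniq: "i = j" if ij: "i \<in> {1..N}" "j \<in> {1..N}" "f i \<noteq> 0" "f j \<noteq> 0" for i j
    proof (rule ccontr)
      have *: False if "i < j" "i \<in> {1..N}" "j \<in> {1..N}" "f i \<noteq> 0" "f j \<noteq> 0" for i j
      proof -
        have "x \<le> xs i" "xs (j - 1) \<le> x"
          using that(4,5) image_eq[OF that(2)] image_eq[OF that(3)] by (auto simp: f_def indicator_def split: if_splits)
        moreover have "xs i \<le> xs (j - 1)" using that by (intro xs_le) auto
        ultimately have "x = xs i" by simp
        then show False using elim that by auto
      qed
      assume "i \<noteq> j"
      then show False using *[of i j] *[of j i] ij by linarith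
    qed
    have "\<bar>\<Sum>i=1..N. f i\<bar> powr p = (\<Sum>i=1..N. \<bar>f i\<bar> powr p)"
    proof (cases "\<exists>j\<in>{1..N}. f j \<noteq> 0")
      case True
      then obtain j where j: "j \<in> {1..N}" "f j \<noteq> 0" by blast
      then have z: "f i = 0" if "i \<in> {1..N} - {j}" for i using uniq[of i j] that by auto
      have "(\<Sum>i=1..N. f i) = f j" using j z by (subst sum.remove[of _ j]) auto
      moreover have "(\<Sum>i=1..N. \<bar>f i\<bar> powr p) = \<bar>f j\<bar> powr p" using j z p by (subst sum.remove[of _ j]) auto
      ultimately show ?thesis by simp
    qed (use p in auto)
    then show ?case by (simp add: pullback_sum_def f_def)
  qed
qed

text \<open>Substituting \<open>a i * y + b i\<close> in piece \<open>i\<close> yields the Jacobian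
  \<open>a i\<close>, and \<open>\<alpha> i\<close> is bounded by its essential supremum; the pieces
  add up to \<open>\<Lambda> powr p\<close> times the \<open>p\<close>-th power of the norm of
  \<open>e\<close>.\<close>

lemma
  assumes e: "in_Lp p e"
  shows in_Lp_L: "in_Lp p (L e)" and Lp_norm_L: "Lp_norm p (L e) \<le> \<Lambda> * Lp_norm p e"
proof -
  have em: "e \<in> borel_measurable I01" using e by (rule in_Lp_measurable)
  define g where "g i y = (\<alpha> i y * e y) * indicator {0..1} y" for i y
  have gm: "g i \<in> borel_measurable lebesgue" if i: "i \<in> {1..N}" for i
    unfolding g_def using alpha_measurable[OF i] em by (intro extend_measurable borel_measurable_times)
  have gam: "(\<lambda>x. g i ((x - b i) / a i)) \<in> borel_measurable lebesgue" if i: "i \<in> {1..N}" for i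
    using borel_measurable_affine_lebesgue[OF gm[OF i]] a_pos[OF i] by simp
  have "(\<integral>\<^sup>+x. ennreal (\<bar>L e x\<bar> powr p) \<partial>I01) \<le> (\<integral>\<^sup>+x. ennreal (\<bar>L e x\<bar> powr p) \<partial>lebesgue)"
    by (subst nn_integral_restrict_space) (auto intro!: nn_integral_mono simp: indicator_def)
  also have "\<dots> = (\<integral>\<^sup>+x. (\<Sum>i=1..N. ennreal (\<bar>g i ((x - b i) / a i)\<bar> powr p)) \<partial>lebesgue)"
  proof (rule nn_integral_cong_AE)
    show "AE x in lebesgue. ennreal (\<bar>L e x\<bar> powr p) = (\<Sum>i=1..N. ennreal (\<bar>g i ((x - b i) / a i)\<bar> powr p))"
      using AE_L_powr[of e]
    proof eventually_elim
      case (elim x)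
      have "\<bar>L e x\<bar> powr p = (\<Sum>i=1..N. \<bar>g i ((x - b i) / a i)\<bar> powr p)"
        unfolding elim by (intro sum.cong refl) (simp only: L_term g_def)
      then show ?case by simp
    qed
  qed
  also have "\<dots> = (\<Sum>i=1..N. \<integral>\<^sup>+x. ennreal (\<bar>g i ((x - b i) / a i)\<bar> powr p) \<partial>lebesgue)"
    using gam by (intro nn_integral_sum) measurable
  also have "\<dots> \<le> (\<Sum>i=1..N. ennreal (a i * Linf_norm (\<alpha> i) powr p) * ennreal (Lp_norm p e powr p))"
  proof (rule sum_mono)
    fix i assume i: "i \<in> {1..N}"
    have "(\<integral>\<^sup>+x. ennreal (\<bar>g i ((x - b i) / a i)\<bar> powr p) \<partial>lebesgue)
       = ennreal \<bar>a i\<bar> * (\<integral>\<^sup>+x. ennreal (\<bar>g i ((b i + a i * x - b i) / a i)\<bar> powr p) \<partial>lebesgue)"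
      using a_pos[OF i] gam[OF i] by (intro nn_integral_real_affine_lebesgue[of "\<lambda>x. ennreal (\<bar>g i ((x - b i) / a i)\<bar> powr p)"]) auto
    also have "\<dots> = ennreal (a i) * (\<integral>\<^sup>+x. ennreal (\<bar>g i x\<bar> powr p) \<partial>lebesgue)"
      using a_pos[OF i] by simp
    also have "(\<integral>\<^sup>+x. ennreal (\<bar>g i x\<bar> powr p) \<partial>lebesgue) = (\<integral>\<^sup>+x. ennreal (\<bar>\<alpha> i x * e x\<bar> powr p) \<partial>I01)"
      using p by (subst nn_integral_restrict_space) (auto intro!: nn_integral_cong simp: g_def indicator_def)
    also have "\<dots> \<le> (\<integral>\<^sup>+x. ennreal (Linf_norm (\<alpha> i) powr p) * ennreal (\<bar>e x\<bar> powr p) \<partial>I01)"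
    proof (rule nn_integral_mono_AE)
      show "AE x in I01. ennreal (\<bar>\<alpha> i x * e x\<bar> powr p) \<le> ennreal (Linf_norm (\<alpha> i) powr p) * ennreal (\<bar>e x\<bar> powr p)"
        using alpha_bound[OF i]
      proof eventually_elim
        case (elim x)
        have "\<bar>\<alpha> i x\<bar> powr p \<le> Linf_norm (\<alpha> i) powr p" using elim p by (intro powr_mono2) auto
        then show ?case by (auto simp: abs_mult powr_mult mult_right_mono simp flip: ennreal_mult intro!: ennreal_leI)
      qed
    qed
    also have "\<dots> = ennreal (Linf_norm (\<alpha> i) powr p) * ennreal (Lp_norm p e powr p)"
      using em by (simp add: nn_integral_cmult in_Lp_nn_integral[OF p e])
    finally show "(\<integral>\<^sup>+x. ennreal (\<bar>g i ((x - b i) / a i)\<bar> powr p) \<partial>lebesgue) \<le> ennreal (a i * Linf_norm (\<alpha> i) powr p) * ennreal (Lp_norm p e powr p)"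
      using a_pos[OF i] by (simp add: ennreal_mult mult.assoc mult_left_mono)
  qed
  also have "\<dots> = ennreal ((\<Lambda> * Lp_norm p e) powr p)"
  proof -
    have nn: "0 \<le> a i * Linf_norm (\<alpha> i) powr p" if "i \<in> {1..N}" for i
      using a_pos[OF that] by simp
    have "(\<Sum>i=1..N. ennreal (a i * Linf_norm (\<alpha> i) powr p)) = ennreal (\<Lambda> powr p)"
      unfolding \<Lambda>_powr by (rule sum_ennreal[OF nn])
    then show ?thesis
      using \<Lambda>(1) Lp_norm_nonneg[of p e]
      by (simp add: powr_mult ennreal_mult flip: sum_distrib_right)
  qed
  finally have le: "(\<integral>\<^sup>+x. ennreal (\<bar>L e x\<bar> powr p) \<partial>I01) \<le> ennreal ((\<Lambda> * Lp_norm p e) powr p)" .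
  have "0 \<le> \<Lambda> * Lp_norm p e" using \<Lambda>(1) Lp_norm_nonneg by simp
  from in_LpI[OF p L_measurable[OF em] this le] Lp_norm_le[OF p L_measurable[OF em] this le]
  show "in_Lp p (L e)" "Lp_norm p (L e) \<le> \<Lambda> * Lp_norm p e" .
qed

text \<open>The series is summed pointwise a.e. The partial sums of the absolute values have norms
  at most the geometric bound \<open>C\<close>, so by monotone convergence the supremum
  \<open>T\<close> of their \<open>p\<close>-th powers has finite integral; \<open>T\<close> then
  also dominates the \<open>p\<close>-th power of the limit \<open>E\<close>.\<close>

lemma Neumann_series:
  assumes e0: "in_Lp p e0"
  shows "\<exists>E. in_Lp p E \<and> (AE x in I01. E x = e0 x + L E x)"
proof -
  define e where "e k = (L ^^ k) e0" for k
  have e_Suc: "e (Suc k) = L (e k)" for k by (simp add: e_def)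
  have eL: "in_Lp p (e k)" for k
    by (induction k) (auto simp: e_Suc in_Lp_L e_def[of 0] e0)
  note [measurable] = in_Lp_measurable[OF eL]
  have en: "Lp_norm p (e k) \<le> \<Lambda> ^ k * Lp_norm p e0" for k
  proof (induction k)
    case (Suc k)
    have "Lp_norm p (e (Suc k)) \<le> \<Lambda> * Lp_norm p (e k)" unfolding e_Suc by (rule Lp_norm_L[OF eL])
    also have "\<dots> \<le> \<Lambda> * (\<Lambda> ^ k * Lp_norm p e0)" using Suc \<Lambda> by (intro mult_left_mono) auto
    finally show ?case by simp
  qed (simp add: e_def)
  define C where "C = Lp_norm p e0 / (1 - \<Lambda>)"
  have C: "0 \<le> C" using \<Lambda> Lp_norm_nonneg by (simp add: C_def)
  define S where "S m x = (\<Sum>k<m. \<bar>e k x\<bar>)" for m x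
  have ea: "in_Lp p (\<lambda>x. \<bar>e k x\<bar>)" for k using eL[of k] by (auto simp: in_Lp_def)
  have S0: "0 \<le> S m x" for m x by (simp add: S_def sum_nonneg)
  have SL: "in_Lp p (S m)" for m unfolding S_def using in_Lp_sum[OF p ea] .
  note [measurable] = in_Lp_measurable[OF SL]
  have SC: "Lp_norm p (S m) \<le> C" for m
  proof -
    have "Lp_norm p (S m) \<le> (\<Sum>k<m. Lp_norm p (\<lambda>x. \<bar>e k x\<bar>))" unfolding S_def by (rule Lp_norm_sum[OF p ea])
    also have "\<dots> = (\<Sum>k<m. Lp_norm p (e k))" by (simp add: Lp_norm_def)
    also have "\<dots> \<le> (\<Sum>k<m. \<Lambda> ^ k * Lp_norm p e0)" by (intro sum_mono en)
    also have "\<dots> = (\<Sum>k<m. \<Lambda> ^ k) * Lp_norm p e0" by (rule sum_distrib_right[symmetric])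
    also have "\<dots> \<le> (1 / (1 - \<Lambda>)) * Lp_norm p e0"
      using \<Lambda> sum_le_suminf[of "\<lambda>k. \<Lambda> ^ k" "{..<m}"] by (intro mult_right_mono) (auto simp: Lp_norm_nonneg summable_geometric suminf_geometric)
    finally show ?thesis by (simp add: C_def)
  qed
  define T where "T x = (SUP m. ennreal (S m x powr p))" for x
  have intT: "(\<integral>\<^sup>+x. T x \<partial>I01) \<le> ennreal (C powr p)"
  proof -
    have "incseq (\<lambda>m x. ennreal (S m x powr p))"
      unfolding incseq_def le_fun_def S_def using p
      by (auto intro!: ennreal_leI powr_mono2 sum_mono2 sum_nonneg)
    then have "(\<integral>\<^sup>+x. T x \<partial>I01) = (SUP m. \<integral>\<^sup>+x. ennreal (S m x powr p) \<partial>I01)"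
      unfolding T_def by (intro nn_integral_monotone_convergence_SUP) measurable
    also have "\<dots> \<le> ennreal (C powr p)"
    proof (rule SUP_least)
      fix m
      have "(\<integral>\<^sup>+x. ennreal (S m x powr p) \<partial>I01) = ennreal (Lp_norm p (S m) powr p)"
        using in_Lp_nn_integral[OF p SL, of m] S0 by simp
      also have "\<dots> \<le> ennreal (C powr p)" using SC p Lp_norm_nonneg by (intro ennreal_leI powr_mono2) auto
      finally show "(\<integral>\<^sup>+x. ennreal (S m x powr p) \<partial>I01) \<le> ennreal (C powr p)" .
    qed
    finally show ?thesis .
  qed
  have Tm: "T \<in> borel_measurable I01" unfolding T_def by measurable
  have "AE x in I01. T x \<noteq> \<infinity>" using intT by (intro nn_integral_noteq_infinite Tm) (auto simp: top_unique)
  then have sum_AE: "AE x in I01. summable (\<lambda>k. \<bar>e k x\<bar>)"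
  proof eventually_elim
    case (elim x)
    then obtain r where r: "T x = ennreal r" "0 \<le> r" by (cases "T x" rule: ennreal_cases) auto
    have "S m x \<le> r powr (1 / p)" for m
    proof -
      have "ennreal (S m x powr p) \<le> T x" unfolding T_def by (intro SUP_upper) auto
      then have "S m x powr p \<le> r" using r by simp
      then have "(S m x powr p) powr (1 / p) \<le> r powr (1 / p)" using p by (intro powr_mono2) auto
      then show ?thesis using p S0 by (simp add: powr_powr)
    qed
    then show ?case by (intro summableI_nonneg_bounded[where x = "r powr (1 / p)"]) (auto simp: S_def)
  qed
  define E where "E x = (\<Sum>k. e k x)" for x
  have Em: "E \<in> borel_measurable I01" unfolding E_def by measurable
  have "(\<integral>\<^sup>+x. ennreal (\<bar>E x\<bar> powr p) \<partial>I01) \<le> (\<integral>\<^sup>+x. T x \<partial>I01)"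
  proof (rule nn_integral_mono_AE)
    show "AE x in I01. ennreal (\<bar>E x\<bar> powr p) \<le> T x"
      using sum_AE
    proof eventually_elim
      case (elim x)
      have lim: "(\<lambda>m. S m x) \<longlonglongrightarrow> (\<Sum>k. \<bar>e k x\<bar>)" unfolding S_def by (rule summable_LIMSEQ[OF elim])
      have nn: "0 \<le> (\<Sum>k. \<bar>e k x\<bar>)" by (intro suminf_nonneg elim) auto
      have "(\<lambda>m. ennreal (S m x powr p)) \<longlonglongrightarrow> ennreal ((\<Sum>k. \<bar>e k x\<bar>) powr p)"
        using lim p S0 by (intro tendsto_ennrealI tendsto_powr' tendsto_const) auto
      then have "ennreal ((\<Sum>k. \<bar>e k x\<bar>) powr p) \<le> T x"
        by (rule LIMSEQ_le_const2) (auto simp: T_def intro!: exI[of _ 0] SUP_upper)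
      moreover have "\<bar>E x\<bar> powr p \<le> (\<Sum>k. \<bar>e k x\<bar>) powr p"
        using summable_rabs[OF elim] p by (intro powr_mono2) (auto simp: E_def)
      ultimately show ?case by (meson ennreal_leI order_trans)
    qed
  qed
  with intT have le: "(\<integral>\<^sup>+x. ennreal (\<bar>E x\<bar> powr p) \<partial>I01) \<le> ennreal (C powr p)" by simp
  have EL: "in_Lp p E" by (rule in_LpI[OF p Em C le])
  have "AE x in lebesgue. x \<in> {0..1} \<longrightarrow> summable (\<lambda>k. \<bar>e k x\<bar>)"
    using sum_AE by (subst (asm) AE_restrict_space_iff) auto
  \<comment> \<open>\<open>L E\<close> evaluates \<open>E\<close> at the points
    \<open>(x - b i) / a i\<close>, so convergence is needed there too; the exceptional set stays
    null under the affine maps.\<close>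
  then have "AE x in lebesgue. \<forall>i\<in>{1..N}. (x - b i) / a i \<in> {0..1} \<longrightarrow> summable (\<lambda>k. \<bar>e k ((x - b i) / a i)\<bar>)"
    using a_pos by (intro AE_finite_allI AE_lebesgue_affine[where P = "\<lambda>x. x \<in> {0..1} \<longrightarrow> summable (\<lambda>k. \<bar>e k x\<bar>)"]) (auto simp: less_le)
  then have "AE x in I01. \<forall>i\<in>{1..N}. (x - b i) / a i \<in> {0..1} \<longrightarrow> summable (\<lambda>k. \<bar>e k ((x - b i) / a i)\<bar>)"
    by (subst AE_restrict_space_iff) (auto elim!: eventually_mono)
  with sum_AE have "AE x in I01. E x = e0 x + L E x"
  proof eventually_elim
    case (elim x)
    have "(\<lambda>k. \<alpha> i ((x - b i) / a i) * e k ((x - b i) / a i) * indicator ((\<lambda>t. a i * t + b i) ` {0..1}) x)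
        sums (\<alpha> i ((x - b i) / a i) * E ((x - b i) / a i) * indicator ((\<lambda>t. a i * t + b i) ` {0..1}) x)"
      if i: "i \<in> {1..N}" for i
    proof (cases "(x - b i) / a i \<in> {0..1}")
      case True
      then have "summable (\<lambda>k. \<bar>e k ((x - b i) / a i)\<bar>)" using elim(2) i by blast
      then have "(\<lambda>k. e k ((x - b i) / a i)) sums E ((x - b i) / a i)"
        unfolding E_def by (rule summable_sums[OF summable_rabs_cancel])
      then show ?thesis by (intro sums_mult2 sums_mult)
    qed (simp add: indicator_image[OF i])
    then have "(\<lambda>k. L (e k) x) sums L E x" unfolding pullback_sum_def by (intro sums_sum) auto
    then have "(\<lambda>k. e (Suc k) x) sums L E x" by (simp add: e_Suc)
    then have "(\<lambda>k. e k x) sums (L E x + e 0 x)" by (subst (asm) sums_Suc_iff) simp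
    then show ?case by (simp add: E_def sums_iff e_def[of 0])
  qed
  with EL show ?thesis by blast
qed

text \<open>In the unknown \<open>E = G - MKZ n h\<close> the defining equation reads
  \<open>E = (h - MKZ n h) + L E\<close>. Existence is what gives the \<open>SOME\<close> in the
  definition its meaning.\<close>

lemma alpha_fractal_exists:
  assumes h: "in_Lp p h" and M: "in_Lp p (MKZ n h)"
  shows "is_alpha_fractal p N a b \<alpha> n h (alpha_fractal p N a b \<alpha> n h)"
proof -
  obtain E where E: "in_Lp p E" "AE x in I01. E x = (h x - MKZ n h x) + L E x"
    using Neumann_series[OF in_Lp_diff[OF p h M]] by blast
  have "is_alpha_fractal p N a b \<alpha> n h (\<lambda>x. E x + MKZ n h x)"
    unfolding is_alpha_fractal_iff
  proof
    show "in_Lp p (\<lambda>x. E x + MKZ n h x)" by (rule in_Lp_add[OF p E(1) M])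
    show "AE x in I01. E x + MKZ n h x = h x + L (\<lambda>y. E y + MKZ n h y - MKZ n h y) x"
      using E(2) by eventually_elim simp
  qed
  then show ?thesis
    unfolding alpha_fractal_def by (rule someI[of "is_alpha_fractal p N a b \<alpha> n h"])
qed

text \<open>The equation bounds \<open>h - G\<close> by \<open>\<Lambda>\<close> times the norm of
  \<open>G - MKZ n h\<close>, which splits into \<open>G - h\<close> and \<open>h - MKZ n h\<close>;
  since \<open>\<Lambda> < 1\<close> the first part is absorbed. It covers every solution
  \<open>G\<close>, hence the representative that \<open>SOME\<close> picks.\<close>

lemma alpha_fractal_error:
  assumes h: "in_Lp p h" and M: "in_Lp p (MKZ n h)" and G: "is_alpha_fractal p N a b \<alpha> n h G"
  shows "Lp_norm p (\<lambda>x. h x - G x) \<le> \<Lambda> / (1 - \<Lambda>) * Lp_norm p (\<lambda>x. h x - MKZ n h x)"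
proof -
  have GL: "in_Lp p G" and eq: "AE x in I01. G x = h x + L (\<lambda>y. G y - MKZ n h y) x"
    using G by (auto simp: is_alpha_fractal_iff)
  have GM: "in_Lp p (\<lambda>x. G x - MKZ n h x)" by (rule in_Lp_diff[OF p GL M])
  define d where "d = Lp_norm p (\<lambda>x. h x - G x)"
  have d: "Lp_norm p (\<lambda>x. G x - h x) = d" unfolding d_def Lp_norm_def by (simp add: abs_minus_commute)
  have "AE x in I01. \<bar>h x - G x\<bar> \<le> \<bar>L (\<lambda>y. G y - MKZ n h y) x\<bar>"
    using eq by eventually_elim simp
  then have "d \<le> Lp_norm p (L (\<lambda>y. G y - MKZ n h y))"
    unfolding d_def by (intro Lp_norm_mono[OF p _ in_Lp_L[OF GM]] in_Lp_measurable[of p] in_Lp_diff[OF p h GL])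
  also have "\<dots> \<le> \<Lambda> * Lp_norm p (\<lambda>y. G y - MKZ n h y)" by (rule Lp_norm_L[OF GM])
  also have "\<dots> \<le> \<Lambda> * (d + Lp_norm p (\<lambda>x. h x - MKZ n h x))"
    using Lp_norm_diff_trans[OF p GL h M] \<Lambda> unfolding d by (intro mult_left_mono) auto
  finally have "d * (1 - \<Lambda>) \<le> \<Lambda> * Lp_norm p (\<lambda>x. h x - MKZ n h x)" by (simp add: algebra_simps)
  then show ?thesis using \<Lambda> unfolding d_def by (simp add: pos_le_divide_eq)
qed

end

section \<open>Density of the fractal powers\<close>

text \<open>By \<open>lam_gt\<close> all terms of the series are positive, so non-summability is
  divergence to infinity. The Muntz approximant is fixed first; afterwards one index
  \<open>n\<close> serves all of its finitely many powers.\<close>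

theorem theorem6p4:
  fixes p :: real and N :: nat and xs :: "nat \<Rightarrow> real"
    and a b :: "nat \<Rightarrow> real" and \<alpha> :: "nat \<Rightarrow> real \<Rightarrow> real" and lam :: "nat \<Rightarrow> real"
  assumes p: "1 \<le> p"
    and x0: "xs 0 = 0" and xN: "xs N = 1"
    and xmono: "\<And>i. i < N \<Longrightarrow> xs i < xs (Suc i)"
    and u0: "\<And>i. i \<in> {1..N} \<Longrightarrow> a i * 0 + b i = xs (i - 1)"
    and u1: "\<And>i. i \<in> {1..N} \<Longrightarrow> a i * 1 + b i = xs i"
    and alpha_Linf: "\<And>i. i \<in> {1..N} \<Longrightarrow> in_Linf (\<alpha> i)"
    and Lambda: "(\<Sum>i=1..N. a i * Linf_norm (\<alpha> i) powr p) powr (1 / p) < 1"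
    and lam_inj: "inj lam"
    and lam_gt: "\<And>i. lam i > - 1 / p"
    and lam_div: "\<not> summable (\<lambda>i. (lam i + 1 / p) / ((lam i + 1 / p)\<^sup>2 + 1))"
  shows "\<forall>f. in_Lp p f \<longrightarrow> (\<forall>\<epsilon>>0. \<exists>n\<ge>1. \<exists>m\<ge>1. \<exists>c :: nat \<Rightarrow> real.
           Lp_norm p (\<lambda>x. f x - (\<Sum>j\<le>m. c j * alpha_fractal p N a b \<alpha> n (\<lambda>t. t powr lam j) x)) < \<epsilon>)"
proof (intro allI impI)
  fix f and \<epsilon> :: real assume f: "in_Lp p f" and \<epsilon>: "0 < \<epsilon>"
  interpret fractal_ifs p N xs a b \<alpha>
    using p x0 xN xmono u0 u1 alpha_Linf Lambda by unfold_locales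
  define \<mu> where "\<mu> i = lam i + 1 / p" for i
  have \<mu>: "0 < \<mu> i" for i using lam_gt[of i] by (simp add: \<mu>_def)
  have inj: "inj \<mu>" using lam_inj by (auto simp: inj_def \<mu>_def)
  have h: "in_Lp p (\<lambda>x. x powr lam j)" for j
    using in_Lp_powr[OF p \<mu>[of j]] by (simp add: \<mu>_def)
  have hm: "(\<lambda>x::real. x powr lam j) \<in> borel_measurable borel" for j by measurable
  have "f \<in> Muntz_closure p (range \<mu>)"
    using lam_div by (intro full_Muntz_Lp[OF p \<mu> inj _ f]) (simp add: \<mu>_def)
  then obtain F k where F: "finite F" "F \<subseteq> range \<mu>"
    and fF: "Lp_norm p (\<lambda>x. f x - (\<Sum>\<nu>\<in>F. k \<nu> * x powr (\<nu> - 1 / p))) < \<epsilon> / 2"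
    using half_gt_zero[OF \<epsilon>] unfolding Muntz_closure_def by blast
  obtain J where J: "finite J" "F = \<mu> ` J"
    using finite_subset_image[OF F] by auto
  \<comment> \<open>Inserting 1 secures \<open>1 \<le> m\<close> and a nonempty set under
    \<open>Max\<close>; indices outside \<open>J\<close> get coefficient 0.\<close>
  define m where "m = Max (insert 1 J)"
  have m: "1 \<le> m" "J \<subseteq> {..m}" unfolding m_def using J(1) by auto
  define c where "c j = (if j \<in> J then k (\<mu> j) else 0)" for j
  have eq: "(\<Sum>\<nu>\<in>F. k \<nu> * x powr (\<nu> - 1 / p)) = (\<Sum>j\<le>m. c j * x powr lam j)" for x
  proof -
    have "(\<Sum>\<nu>\<in>F. k \<nu> * x powr (\<nu> - 1 / p)) = (\<Sum>j\<in>J. k (\<mu> j) * x powr (\<mu> j - 1 / p))"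
      unfolding J(2) by (subst sum.reindex) (auto intro: inj_on_subset[OF inj])
    also have "\<dots> = (\<Sum>j\<le>m. c j * x powr lam j)"
      using m(2) by (intro sum.mono_neutral_cong_left) (auto simp: c_def \<mu>_def)
    finally show ?thesis .
  qed
  define g where "g x = (\<Sum>j\<le>m. c j * x powr lam j)" for x
  have fg: "Lp_norm p (\<lambda>x. f x - g x) < \<epsilon> / 2" using fF unfolding eq g_def .
  \<comment> \<open>The weighted sum of the error bounds from \<open>alpha_fractal_error\<close>;
    being finite with fixed coefficients, it tends to 0 together with each \<open>MKZ\<close>
    error.\<close>
  define r where "r n = (\<Sum>j\<le>m. \<bar>c j\<bar> * (\<Lambda> / (1 - \<Lambda>) * Lp_norm p (\<lambda>x. x powr lam j - MKZ n (\<lambda>t. t powr lam j) x)))" for n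
  have "r \<longlonglongrightarrow> (\<Sum>j\<le>m. \<bar>c j\<bar> * (\<Lambda> / (1 - \<Lambda>) * 0))"
    unfolding r_def by (intro tendsto_sum tendsto_mult tendsto_const MKZ_converges_Lp[OF p hm h])
  then have "r \<longlonglongrightarrow> 0" by simp
  then have "\<forall>\<^sub>F n in sequentially. r n < \<epsilon> / 2 \<and> 1 \<le> n"
    using \<epsilon> by (intro eventually_conj order_tendstoD(2) eventually_ge_at_top) auto
  from eventually_happens'[OF trivial_limit_sequentially this]
  obtain n where n: "r n < \<epsilon> / 2" "1 \<le> n" by blast
  define G where "G j = alpha_fractal p N a b \<alpha> n (\<lambda>t. t powr lam j)" for j
  have Mh: "in_Lp p (MKZ n (\<lambda>t. t powr lam j))" for j
    by (rule MKZ_contraction(1)[OF p n(2) hm h])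
  have G: "is_alpha_fractal p N a b \<alpha> n (\<lambda>t. t powr lam j) (G j)" for j
    unfolding G_def by (rule alpha_fractal_exists[OF h Mh])
  then have GL: "in_Lp p (G j)" for j by (simp add: is_alpha_fractal_def)
  have gL: "in_Lp p g" unfolding g_def by (intro in_Lp_sum[OF p] in_Lp_cmult[OF p] h)
  have GsL: "in_Lp p (\<lambda>x. \<Sum>j\<le>m. c j * G j x)" by (intro in_Lp_sum[OF p] in_Lp_cmult[OF p] GL)
  have "Lp_norm p (\<lambda>x. g x - (\<Sum>j\<le>m. c j * G j x)) = Lp_norm p (\<lambda>x. \<Sum>j\<le>m. c j * (x powr lam j - G j x))"
    by (simp add: g_def right_diff_distrib sum_subtractf)
  also have "\<dots> \<le> (\<Sum>j\<le>m. Lp_norm p (\<lambda>x. c j * (x powr lam j - G j x)))"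
    by (intro Lp_norm_sum[OF p] in_Lp_cmult[OF p] in_Lp_diff[OF p] h GL)
  also have "\<dots> \<le> r n"
    unfolding r_def Lp_norm_cmult[OF p] by (intro sum_mono mult_left_mono alpha_fractal_error[OF h Mh G]) auto
  finally have "Lp_norm p (\<lambda>x. f x - (\<Sum>j\<le>m. c j * G j x)) < \<epsilon>"
    using Lp_norm_diff_trans[OF p f gL GsL] fg n(1) by linarith
  then show "\<exists>n\<ge>1. \<exists>m\<ge>1. \<exists>c :: nat \<Rightarrow> real.
      Lp_norm p (\<lambda>x. f x - (\<Sum>j\<le>m. c j * alpha_fractal p N a b \<alpha> n (\<lambda>t. t powr lam j) x)) < \<epsilon>"
    unfolding G_def using n(2) m(1) by blast
qed

end
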